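(* Let $m\ge 1$ be an integer, let $t,t_0,t_1,t_2,s_1,\ldots,s_m,u_1,\ldots,u_m$ be complex parameters of absolute value less than $1$ such that $|pq|<|t^2t_0t_1t_2|$ and $|pq|<|t^2\prod_{l=1}^{k}s_l^2\,u_k|$ for every $k=1,\ldots,m$, and let $x_{m+1}\in\mathbb{T}$. Then $$\kappa^{m-1}\prod_{k=1}^m\frac{\Gamma(t^2\prod_{l=1}^{k}s_l^2)}{\Gamma(s_k^2,\,t^2\prod_{l=1}^{k-1}s_l^2)}\int_{\mathbb{T}^m}\frac{\prod_{r=0}^2\Gamma(tt_rx_1^\pm)}{\Gamma(tt_0t_1t_2x_1^\pm)}\prod_{k=1}^m\frac{\Gamma(t^2\prod_{l=1}^{k-1}s_l^2\,s_ku_kx_{k+1}^\pm,\;s_kx_{k+1}^\pm x_k^\pm,\;u_kx_k^\pm)}{\Gamma(s_ku_kx_{k+1}^\pm,\;x_k^{\pm 2},\;t^2\prod_{l=1}^ks_l^2\,u_kx_k^\pm)}\prod_{l=1}^m\frac{dx_l}{x_l}$$ $$=\frac{1}{\Gamma(t^2)}\prod_{0\leq r<j\leq 2}\frac{\Gamma(t^2t_rt_j)}{\Gamma(t_rt_j)}\int_{\mathbb{T}}\frac{\Gamma(t\prod_{l=1}^ms_l\,x_{m+1}^\pm x^\pm)\prod_{r=0}^2\Gamma(t_rx^\pm)}{\Gamma(x^{\pm 2},\,t^2t_0t_1t_2x^\pm)}\prod_{k=1}^m\frac{\Gamma(t\prod_{l=1}^{k-1}s_l\,u_kx^\pm)}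{\Gamma(t\prod_{l=1}^{k-1}s_l\,s_k^2u_kx^\pm)}\,\frac{dx}{x}.$$
   Context: $\mathbb{T}$ is the positively oriented unit circle in $\mathbb{C}$; $q,p$ are fixed complex numbers with $|q|,|p|<1$. The elliptic gamma function is $$\Gamma(z)=\Gamma(z;q,p)=\prod_{j,k=0}^\infty\frac{1-z^{-1}q^{j+1}p^{k+1}}{1-zq^jp^k}.$$ Conventions: $\Gamma(a_1,\ldots,a_n)=\prod_{r=1}^n\Gamma(a_r;q,p)$; $\Gamma(az^\pm)=\Gamma(az,az^{-1})$; $\Gamma(z^{\pm2})=\Gamma(z^2,z^{-2})$; $\Gamma(az^\pm x^\pm)=\Gamma(azx,azx^{-1},az^{-1}x,az^{-1}x^{-1})$. An entry carrying $\pm$ signs inside a list of arguments is expanded in this way. The function $1/\Gamma(z^{\pm2})$ is understood as its holomorphic extension to $\mathbb{C}\setminus\{0\}$. Empty products equal $1$. Also $(q;q)_\infty=\prod_{n=1}^\infty(1-q^n)$, $(p;p)_\infty=\prod_{n=1}^\infty(1-p^n)$ and $$\kappa=\frac{(p;p)_\infty(q;q)_\infty}{4\pi i}.$$ In expressions such as $\Gamma(t^2\prod_{l=1}^{k-1}s_l^2\,s_ku_kx_{k+1}^\pm)$ the product over $l$ applies only to the factor $s_l^2$ (respectively $s_l$) immediately following it; the remaining factors are outside the product. *)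

theory Defs
  imports "HOL-Complex_Analysis.Complex_Analysis"
begin

text \<open>
  For \<open>\<bar>q\<bar>, \<bar>p\<bar> < 1\<close> the double product converges absolutely, so it may be taken iteratively.
  At a pole the totalised division makes one factor, and hence the value of \<open>ell_gamma\<close>,
  equal to \<open>0\<close>. Zeros (\<open>z = q\<^sup>j p\<^sup>k\<close> with \<open>j, k > 0\<close>) and poles (\<open>z = q\<^sup>-\<^sup>j p\<^sup>-\<^sup>k\<close> with
  \<open>j, k \<ge> 0\<close>) never coincide, so at a pole \<open>1 / ell_gamma q p z\<close> evaluates to \<open>0\<close>, which is
  the value of the holomorphic extension of the reciprocal there. In particular, on the unit
  circle \<open>1 / \<Gamma>(z\<^sup>2, z\<^sup>-\<^sup>2)\<close> has singularities of the quotient only at \<open>z = \<plusminus>1\<close>, where it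
  evaluates to \<open>0\<close>, the value of its holomorphic extension.
\<close>

definition ell_gamma :: "complex \<Rightarrow> complex \<Rightarrow> complex \<Rightarrow> complex" where
  "ell_gamma q p z =
     (\<Prod>j. \<Prod>k. (1 - inverse z * q ^ (j + 1) * p ^ (k + 1)) / (1 - z * q ^ j * p ^ k))"

text \<open>\<open>\<Gamma>(a z\<^sup>\<plusminus>)\<close>; the case \<open>a = 1\<close> with \<open>z\<^sup>2\<close> in place of \<open>z\<close> is \<open>\<Gamma>(z\<^sup>\<plusminus>\<^sup>2)\<close>.\<close>

definition ell_gamma_pm :: "complex \<Rightarrow> complex \<Rightarrow> complex \<Rightarrow> complex \<Rightarrow> complex" where
  "ell_gamma_pm q p a z = ell_gamma q p (a * z) * ell_gamma q p (a * inverse z)"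

text \<open>\<open>\<Gamma>(a z\<^sup>\<plusminus> x\<^sup>\<plusminus>)\<close>\<close>

definition ell_gamma_pm_pm ::
    "complex \<Rightarrow> complex \<Rightarrow> complex \<Rightarrow> complex \<Rightarrow> complex \<Rightarrow> complex" where
  "ell_gamma_pm_pm q p a z x =
     ell_gamma q p (a * z * x) * ell_gamma q p (a * z * inverse x) *
     ell_gamma q p (a * inverse z * x) * ell_gamma q p (a * inverse z * inverse x)"

text \<open>\<open>(q;q)\<^sub>\<infinity>\<close>\<close>

definition euler_prod :: "complex \<Rightarrow> complex" where
  "euler_prod q = (\<Prod>n. 1 - q ^ (n + 1))"

definition kappa :: "complex \<Rightarrow> complex \<Rightarrow> complex" where
  "kappa q p = euler_prod p * euler_prod q / (4 * of_real pi * \<i>)"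

text \<open>
  \<open>torus_integral m F x\<close> is the integral of \<open>F\<close> with respect to \<open>dx\<^sub>1 \<dots> dx\<^sub>m\<close>, each of
  \<open>x\<^sub>1, \<dots>, x\<^sub>m\<close> running over the positively oriented unit circle; the coordinates of \<open>x\<close> with
  index outside \<open>{1..m}\<close> are parameters. The iterated form is independent of the order
  of integration, and equal to the integral over the product, for continuous \<open>F\<close>.
\<close>

primrec torus_integral ::
    "nat \<Rightarrow> ((nat \<Rightarrow> complex) \<Rightarrow> complex) \<Rightarrow> (nat \<Rightarrow> complex) \<Rightarrow> complex" where
  "torus_integral 0 F x = F x"
| "torus_integral (Suc m) F x =
     contour_integral (circlepath 0 1) (\<lambda>z. torus_integral m F (x(Suc m := z)))"

end

(* Since Gamma(qz) = theta(z;p) Gamma(z), the substitution t_1 -> q t_1 changes the integrand of the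
   elliptic beta integral, divided by its claimed value, by a difference g(z/q) - g(z) (Spiridonov); the
   underlying theta identity is a combination of four instances of Weierstrass' addition formula.
   Hence the ratio I(t_1,...,t_5) of integral and claimed value is q-periodic in t_1, and where the
   annulus of admissible t_1 is wider than one period the maximum principle makes it constant;
   analytic continuation gives all admissible parameters, and the pinch t_1, t_2 -> i, -i, where a
   Poisson kernel appears, gives the constant. Only q \<noteq> 0 is needed here, p = 0 being allowed; the
   remaining cases follow from the symmetry in p and q and a limit.

   For the theorem, the beta integral writes the factor depending on x_1 alone as an integral over x of
   Gamma(t x_1^\<plusminus> x^\<plusminus>) times a weight; after Fubini the integrals over x_1, ..., x_m are again beta
   integrals, the k-th one turning Gamma(T x_k^\<plusminus> x^\<plusminus>) into Gamma(T s_k x_(k+1)^\<plusminus> x^\<plusminus>). *)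

theory Submission
  imports Defs
begin

section \<open>Infinite products depending on a parameter\<close>

text \<open>The contour is always the unit circle, so every parameter has to stay in |t_j| < 1, |pq|
  < |A|, where A = t_1 t_2 t_3 t_4 t_5. For q \<noteq> 0 the shift t_1 -> q t_1 respects this
  exactly if |p| < |A|; the same inequality keeps g free of poles on 1 \<le> |w| \<le> 1/|q|, so
  that g(z/q) and g(z) have equal integrals. In t_1 the domain is the annulus |pq| / |t_2 t_3 t_4
  t_5| < |t_1| < 1, which is wider than one period only if |p| < |t_2 t_3 t_4 t_5|. Hence constancy
  is proved first for all moduli close to 1, and the lower bounds are then removed one parameter at
  a time. The pinch is placed at i, -i because 1 / Gamma(z^2, z^-2) vanishes at 1 and -1. Integral
  and claimed value blow up there like 1/(1 - s^2) and 1/(1 - s) with s = t_1 t_2; what remains is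
  the constant 4 pi i / ((p;p)(q;q)), the reciprocal of \<open>kappa\<close>. In the theorem each
  integration over an x_k consumes one \<open>kappa\<close> and the initial beta integral supplies
  one, whence the exponent m - 1.\<close>

lemma convergent_prod_dominated:
  fixes f :: "nat \<Rightarrow> complex"
  assumes "\<And>n. norm (f n - 1) \<le> M n" and "summable M"
  shows "convergent_prod f"
proof -
  have "summable (\<lambda>n. norm (f n - 1))"
    by (rule summable_comparison_test'[OF assms(2), of 0]) (use assms(1) in auto)
  then show ?thesis
    by (intro abs_convergent_prod_imp_convergent_prod summable_imp_abs_convergent_prod)
qed

lemma uniform_limit_prodinf_dominated:
  fixes f :: "nat \<Rightarrow> 'a::topological_space \<Rightarrow> complex"
  assumes "compact A" and cont: "\<And>n. continuous_on A (f n)"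
    and bd: "\<And>n x. x \<in> A \<Longrightarrow> norm (f n x - 1) \<le> M n" and "summable M"
  shows "uniform_limit A (\<lambda>N x. \<Prod>n<N. f n x) (\<lambda>x. \<Prod>n. f n x) sequentially"
proof -
  have "uniformly_convergent_on A (\<lambda>N x. \<Sum>n<N. norm (f n x - 1))"
    by (rule Weierstrass_m_test'[OF _ assms(4)]) (use bd in auto)
  then have "uniformly_convergent_on A (\<lambda>N x. \<Prod>n<N. f n x)"
    by (intro uniformly_convergent_on_prod' cont assms)
  then obtain g where g: "uniform_limit A (\<lambda>N x. \<Prod>n<N. f n x) g sequentially"
    unfolding uniformly_convergent_on_def by blast
  \<comment> \<open>The uniform limit \<open>g\<close> is so far anonymous; pointwise uniqueness of
    limits identifies it with the infinite product.\<close>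
  have "g x = (\<Prod>n. f n x)" if "x \<in> A" for x
  proof -
    have "(\<lambda>N. \<Prod>n<N. f n x) \<longlonglongrightarrow> g x"
      using g that by (rule tendsto_uniform_limitI)
    moreover have "convergent_prod (\<lambda>n. f n x)"
      using convergent_prod_dominated[OF bd[OF that] assms(4)] .
    then have "(\<lambda>N. \<Prod>n<N. f n x) \<longlonglongrightarrow> (\<Prod>n. f n x)"
      by (simp add: convergent_prod_LIMSEQ LIMSEQ_lessThan_iff_atMost)
    ultimately show ?thesis
      by (rule LIMSEQ_unique)
  qed
  then show ?thesis
    using g uniform_limit_cong'[of A "\<lambda>N x. \<Prod>n<N. f n x" "\<lambda>N x. \<Prod>n<N. f n x" g] by simp
qed

lemma continuous_on_prodinf:
  fixes f :: "nat \<Rightarrow> 'a::topological_space \<Rightarrow> complex"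
  assumes "compact A" and cont: "\<And>n. continuous_on A (f n)"
    and "\<And>n x. x \<in> A \<Longrightarrow> norm (f n x - 1) \<le> M n" and "summable M"
  shows "continuous_on A (\<lambda>x. \<Prod>n. f n x)"
  by (rule uniform_limit_theorem[OF _ uniform_limit_prodinf_dominated[OF assms]])
    (auto intro!: always_eventually continuous_intros cont)

text \<open>The majorant may depend on the radius: holomorphy is local, and factors such as 1 - x
  q^n are close to 1 only uniformly on bounded sets.\<close>

lemma holomorphic_on_prodinf:
  fixes f :: "nat \<Rightarrow> complex \<Rightarrow> complex"
  assumes hol: "\<And>n. f n holomorphic_on UNIV"
    and bd: "\<And>R n x. norm x \<le> R \<Longrightarrow> norm (f n x - 1) \<le> M R n" and sm: "\<And>R. summable (M R)"
  shows "(\<lambda>x. \<Prod>n. f n x) holomorphic_on UNIV"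
proof (rule holomorphic_uniform_sequence[OF open_UNIV, where f = "\<lambda>N x. \<Prod>n<N. f n x"])
  show "(\<lambda>x. \<Prod>n<N. f n x) holomorphic_on UNIV" for N
    by (intro holomorphic_intros hol)
  fix x :: complex
  have "uniform_limit (cball x 1) (\<lambda>N x. \<Prod>n<N. f n x) (\<lambda>x. \<Prod>n. f n x) sequentially"
  proof (rule uniform_limit_prodinf_dominated[OF compact_cball, where M = "M (norm x + 1)"])
    show "continuous_on (cball x 1) (f n)" for n
      using hol holomorphic_on_imp_continuous_on holomorphic_on_subset by blast
    show "norm (f n y - 1) \<le> M (norm x + 1) n" if "y \<in> cball x 1" for n y
      by (rule bd) (use that norm_triangle_sub[of y x] in \<open>auto simp: dist_norm norm_minus_commute\<close>)
  qed (rule sm)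
  then show "\<exists>d>0. cball x d \<subseteq> UNIV \<and>
      uniform_limit (cball x d) (\<lambda>N x. \<Prod>n<N. f n x) (\<lambda>x. \<Prod>n. f n x) sequentially"
    using zero_less_one by blast
qed

text \<open>The difference quotient at 0, completed by the derivative, is entire and so bounded on a
  ball. Applied to the inner factorial, this makes the factors of the double product approach 1
  geometrically.\<close>

lemma holomorphic_linear_bound:
  assumes "f holomorphic_on UNIV"
  shows "\<exists>C. \<forall>b. norm b \<le> R \<longrightarrow> norm (f b - f 0) \<le> C * norm (b::complex)"
proof -
  define h where "h = (\<lambda>z. if z = 0 then deriv f 0 else (f z - f 0) / (z - 0))"
  have "h holomorphic_on UNIV"
    unfolding h_def by (rule pole_lemma_open) (use assms in auto)
  then have "compact (h ` cball 0 R)"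
    by (meson compact_cball compact_continuous_image holomorphic_on_imp_continuous_on
        holomorphic_on_subset subset_UNIV)
  then obtain C where C: "\<And>b. norm b \<le> R \<Longrightarrow> norm (h b) \<le> C"
    using compact_imp_bounded[of "h ` cball 0 R"] by (metis bounded_iff imageI mem_cball_0)
  have "norm (f b - f 0) \<le> C * norm b" if "norm b \<le> R" for b
    using C[OF that] by (cases "b = 0") (auto simp: h_def norm_divide field_simps)
  then show ?thesis by blast
qed

text \<open>A vanishing first factor is allowed, since splitting the factorials at their zero 1 is
  what yields \<open>theta_1\<close> and the behaviour of the gamma function at its pole.\<close>

lemma prodinf_split_first:
  fixes f :: "nat \<Rightarrow> complex"
  assumes "convergent_prod f"
  shows "(\<Prod>n. f n) = f 0 * (\<Prod>n. f (Suc n))"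
proof (cases "f 0 = 0")
  case True
  then show ?thesis
    using assms has_prod_zeroI[of f] by (metis convergent_prod_has_prod has_prod_eq_0_iff mult_zero_left)
next
  case False
  then show ?thesis
    using prodinf_split_head[OF assms] by simp
qed

section \<open>The shifted factorials\<close>

definition qpoch :: "complex \<Rightarrow> complex \<Rightarrow> complex" where
  "qpoch a q = (\<Prod>k. 1 - a * q ^ k)"

text \<open>The double factorial (a; q, p)_infinity, iterated so that the outer product has entire
  functions of \<open>a\<close> as factors.\<close>

definition qpoch2 :: "complex \<Rightarrow> complex \<Rightarrow> complex \<Rightarrow> complex" where
  "qpoch2 a q p = (\<Prod>j. qpoch (a * q ^ j) p)"

text \<open>The modified Jacobi theta function of nome \<open>p\<close>; for p = 0 it degenerates to
  1 - x.\<close>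

definition theta :: "complex \<Rightarrow> complex \<Rightarrow> complex" where
  "theta x p = qpoch x p * qpoch (p / x) p"

lemma summable_geometric_const: "norm (q::complex) < 1 \<Longrightarrow> summable (\<lambda>n. C * norm q ^ n)"
  by (intro summable_mult summable_geometric) auto

lemma qpoch_factor_bound:
  "norm (a::complex) \<le> R \<Longrightarrow> norm ((1 - a * q ^ k) - 1) \<le> R * norm q ^ k"
  by (auto simp: norm_mult norm_power intro!: mult_right_mono)

lemma qpoch_convergent: "norm (q::complex) < 1 \<Longrightarrow> convergent_prod (\<lambda>k. 1 - a * q ^ k)"
  using convergent_prod_dominated[OF qpoch_factor_bound[OF order_refl] summable_geometric_const] .

lemma qpoch_holomorphic_UNIV:
  assumes "norm p < 1"
  shows "(\<lambda>a. qpoch a p) holomorphic_on UNIV"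
  unfolding qpoch_def
  by (rule holomorphic_on_prodinf[OF _ qpoch_factor_bound summable_geometric_const[OF assms]])
    (auto intro!: holomorphic_intros)

lemma qpoch_holomorphic [holomorphic_intros]:
  assumes "norm p < 1" and "f holomorphic_on S"
  shows "(\<lambda>z. qpoch (f z) p) holomorphic_on S"
  using holomorphic_on_compose[OF assms(2), of "\<lambda>a. qpoch a p"] qpoch_holomorphic_UNIV[OF assms(1)]
  by (auto simp: o_def intro: holomorphic_on_subset)

lemma qpoch_0 [simp]: "qpoch 0 p = 1"
  by (simp add: qpoch_def)

lemma qpoch_0_right: "qpoch a 0 = 1 - a"
proof -
  have "(\<lambda>k. 1 - a * 0 ^ k) has_prod (\<Prod>k\<in>{0}. 1 - a * 0 ^ k)"
    by (rule has_prod_finite) (auto simp: power_0_left)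
  then show ?thesis
    unfolding qpoch_def using has_prod_unique by fastforce
qed

lemma qpoch_split:
  assumes "norm p < 1"
  shows "qpoch a p = (1 - a) * qpoch (a * p) p"
  unfolding qpoch_def
  by (subst prodinf_split_first[OF qpoch_convergent[OF assms]]) (simp add: mult_ac)

lemma qpoch_nonzero:
  assumes "norm p < 1" and "norm a < 1"
  shows "qpoch a p \<noteq> 0"
  unfolding qpoch_def
proof (rule prodinf_nonzero[OF qpoch_convergent[OF assms(1)]])
  fix k
  have "norm (a * p ^ k) \<le> norm a * 1"
    unfolding norm_mult norm_power by (intro mult_left_mono power_le_one) (use assms in auto)
  then show "1 - a * p ^ k \<noteq> 0"
    using assms(2) by (metis eq_iff_diff_eq_0 linorder_not_le mult.right_neutral norm_one)
qed

lemma qpoch_linear_bound: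
  assumes "norm p < 1"
  obtains C where "\<And>b. norm b \<le> R \<Longrightarrow> norm (qpoch b p - 1) \<le> C * norm b"
  using holomorphic_linear_bound[OF qpoch_holomorphic_UNIV[OF assms], of R] by auto

lemma qpoch2_factor_bound:
  assumes "norm q < 1" and "norm p < 1"
  obtains C where "\<And>a j. norm a \<le> R \<Longrightarrow> norm (qpoch (a * q ^ j) p - 1) \<le> C * norm q ^ j"
proof -
  obtain C where C: "\<And>b. norm b \<le> R \<Longrightarrow> norm (qpoch b p - 1) \<le> C * norm b"
    using qpoch_linear_bound[OF assms(2)] by blast
  have "norm (qpoch (a * q ^ j) p - 1) \<le> (\<bar>C\<bar> * R) * norm q ^ j" if "norm a \<le> R" for a j
  proof -
    have "norm (a * q ^ j) \<le> R * norm q ^ j"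
      unfolding norm_mult norm_power by (intro mult_right_mono that) auto
    moreover have "R * norm q ^ j \<le> R * 1"
      by (intro mult_left_mono power_le_one)
        (use assms that norm_ge_zero[of a] in \<open>auto intro: order_trans[of 0 "norm a"]\<close>)
    ultimately have "norm (qpoch (a * q ^ j) p - 1) \<le> C * norm (a * q ^ j)"
      by (intro C) linarith
    also have "\<dots> \<le> \<bar>C\<bar> * norm (a * q ^ j)"
      by (intro mult_right_mono) auto
    also have "\<dots> \<le> \<bar>C\<bar> * (R * norm q ^ j)"
      by (rule mult_left_mono) (use \<open>norm (a * q ^ j) \<le> R * norm q ^ j\<close> in auto)
    finally show ?thesis by (simp add: mult_ac)
  qed
  then show thesis using that by blast
qed

lemma qpoch2_convergent:
  assumes "norm q < 1" and "norm p < 1"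
  shows "convergent_prod (\<lambda>j. qpoch (a * q ^ j) p)"
proof -
  obtain C where "\<And>b j. norm b \<le> norm a \<Longrightarrow> norm (qpoch (b * q ^ j) p - 1) \<le> C * norm q ^ j"
    using qpoch2_factor_bound[OF assms] by blast
  then show ?thesis
    by (intro convergent_prod_dominated[OF _ summable_geometric_const[OF assms(1)]]) auto
qed

lemma qpoch2_holomorphic_UNIV:
  assumes "norm q < 1" and "norm p < 1"
  shows "(\<lambda>a. qpoch2 a q p) holomorphic_on UNIV"
proof -
  have "\<exists>C. \<forall>a j. norm a \<le> R \<longrightarrow> norm (qpoch (a * q ^ j) p - 1) \<le> C * norm q ^ j" for R
    using qpoch2_factor_bound[OF assms, of R] by blast
  then obtain C where C: "\<And>R a j. norm a \<le> R \<Longrightarrow> norm (qpoch (a * q ^ j) p - 1) \<le> C R * norm q ^ j"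
    by metis
  show ?thesis
    unfolding qpoch2_def
  proof (rule holomorphic_on_prodinf[OF _ C summable_geometric_const[OF assms(1)]])
    show "(\<lambda>a. qpoch (a * q ^ n) p) holomorphic_on UNIV" for n
      by (intro qpoch_holomorphic assms holomorphic_intros)
  qed
qed

lemma qpoch2_0 [simp]: "qpoch2 0 q p = 1"
  by (simp add: qpoch2_def)

lemma qpoch2_0_right: "qpoch2 a q 0 = qpoch a q"
  by (simp add: qpoch2_def qpoch_0_right) (simp add: qpoch_def)

lemma qpoch2_0_middle:
  assumes "norm p < 1"
  shows "qpoch2 a 0 p = qpoch a p"
  unfolding qpoch2_def
  by (subst prodinf_split_first[OF qpoch2_convergent[OF _ assms]]) auto

lemma qpoch2_split1:
  assumes "norm q < 1" and "norm p < 1"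
  shows "qpoch2 a q p = qpoch a p * qpoch2 (a * q) q p"
  unfolding qpoch2_def
  by (subst prodinf_split_first[OF qpoch2_convergent[OF assms]]) (simp add: mult_ac)

text \<open>As the q-product is the outer one, the shift by \<open>p\<close> is obtained by
  splitting off the first factor of every inner product simultaneously.\<close>

lemma qpoch2_split2:
  assumes "norm q < 1" and "norm p < 1"
  shows "qpoch2 a q p = qpoch a q * qpoch2 (a * p) q p"
proof -
  have "qpoch2 a q p = (\<Prod>j. (1 - a * q ^ j) * qpoch (a * p * q ^ j) p)"
    unfolding qpoch2_def by (subst qpoch_split[OF assms(2)]) (simp add: mult_ac)
  also have "\<dots> = qpoch a q * qpoch2 (a * p) q p"
    unfolding qpoch2_def qpoch_def[of a q]
    by (rule prodinf_mult[symmetric]) (rule qpoch_convergent qpoch2_convergent assms)+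
  finally show ?thesis .
qed

lemma qpoch2_nonzero:
  assumes "norm q < 1" and "norm p < 1" and "norm a < 1"
  shows "qpoch2 a q p \<noteq> 0"
  unfolding qpoch2_def
proof (rule prodinf_nonzero[OF qpoch2_convergent[OF assms(1,2)]])
  fix j
  have "norm (a * q ^ j) \<le> norm a * 1"
    unfolding norm_mult norm_power by (intro mult_left_mono power_le_one) (use assms in auto)
  then show "qpoch (a * q ^ j) p \<noteq> 0"
    using assms by (intro qpoch_nonzero) auto
qed

text \<open>Continuity in the base as well as in the argument serves the limit q -> 0 that settles p
  = q = 0.\<close>

lemma qpoch_continuous_joint:
  assumes "0 \<le> r" "r < 1"
  shows "continuous_on (cball 0 R \<times> cball 0 r) (\<lambda>(a, q). qpoch a q)"
proof -
  have bd: "norm (1 - fst x * snd x ^ n - 1) \<le> R * r ^ n"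
    if "x \<in> cball 0 R \<times> cball 0 r" for x :: "complex \<times> complex" and n
  proof -
    have "norm (fst x) * norm (snd x) ^ n \<le> R * r ^ n"
      using that by (intro mult_mono power_mono) (auto intro: order_trans[of 0 "norm (fst x)"])
    then show ?thesis by (simp add: norm_mult norm_power)
  qed
  have "continuous_on (cball 0 R \<times> cball 0 r) (\<lambda>x. \<Prod>n. 1 - fst x * snd x ^ n :: complex)"
    by (rule continuous_on_prodinf[where M = "\<lambda>n. R * r ^ n", OF _ _ bd])
      (use assms in \<open>auto intro!: compact_Times continuous_intros summable_mult summable_geometric\<close>)
  then show ?thesis
    by (simp add: qpoch_def case_prod_unfold)
qed

lemma qpoch2_holomorphic [holomorphic_intros]:
  assumes "norm q < 1" "norm p < 1" and "f holomorphic_on S"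
  shows "(\<lambda>z. qpoch2 (f z) q p) holomorphic_on S"
  using holomorphic_on_compose[OF assms(3), of "\<lambda>a. qpoch2 a q p"] qpoch2_holomorphic_UNIV[OF assms(1,2)]
  by (auto simp: o_def intro: holomorphic_on_subset)

lemma qpoch_continuous [continuous_intros]:
  assumes "norm p < 1" and "continuous_on S f"
  shows "continuous_on S (\<lambda>z. qpoch (f z) p)"
  using continuous_on_compose2[OF holomorphic_on_imp_continuous_on[OF qpoch_holomorphic_UNIV[OF assms(1)]] assms(2)]
  by auto

lemma qpoch2_continuous [continuous_intros]:
  assumes "norm q < 1" "norm p < 1" and "continuous_on S f"
  shows "continuous_on S (\<lambda>z. qpoch2 (f z) q p)"
  using continuous_on_compose2[OF holomorphic_on_imp_continuous_on[OF qpoch2_holomorphic_UNIV[OF assms(1,2)]] assms(3)]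
  by auto

section \<open>Theta functions and the elliptic gamma function\<close>

lemma theta_holomorphic [holomorphic_intros]:
  assumes "norm p < 1" and "f holomorphic_on S" and "\<And>z. z \<in> S \<Longrightarrow> f z \<noteq> 0"
  shows "(\<lambda>z. theta (f z) p) holomorphic_on S"
  unfolding theta_def by (intro holomorphic_intros assms) (use assms in auto)

lemma theta_continuous [continuous_intros]:
  assumes "norm p < 1" and "continuous_on S f" and "\<And>z. z \<in> S \<Longrightarrow> f z \<noteq> 0"
  shows "continuous_on S (\<lambda>z. theta (f z) p)"
  unfolding theta_def by (intro continuous_intros assms) (use assms in auto)

lemma theta_1 [simp]: "norm p < 1 \<Longrightarrow> theta 1 p = 0"
  by (simp add: theta_def qpoch_split[of p 1])

lemma theta_nonzero:
  assumes "norm p < 1" "norm x < 1" "norm p < norm x"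
  shows "theta x p \<noteq> 0"
proof -
  have "norm (p / x) < 1"
    using assms le_less_trans[OF norm_ge_zero assms(3)] by (simp add: norm_divide)
  then show ?thesis
    by (simp add: theta_def qpoch_nonzero assms)
qed

lemma theta_inverse:
  assumes "norm p < 1" "x \<noteq> 0"
  shows "theta (inverse x) p = - inverse x * theta x p"
proof -
  have 1: "qpoch (inverse x) p = (1 - inverse x) * qpoch (p / x) p"
    using qpoch_split[OF assms(1), of "inverse x"] by (simp add: field_simps)
  have 2: "qpoch x p = (1 - x) * qpoch (p * x) p"
    using qpoch_split[OF assms(1), of x] by (simp add: mult.commute)
  have "theta (inverse x) p = (1 - inverse x) * qpoch (p / x) p * qpoch (p * x) p"
    unfolding theta_def 1 by (simp only: divide_inverse inverse_inverse_eq)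
  also have "\<dots> = - inverse x * ((1 - x) * qpoch (p * x) p * qpoch (p / x) p)"
  proof -
    have "1 - inverse x = - inverse x * (1 - x)"
      using assms(2) by (simp add: field_simps)
    then show ?thesis by (simp only: mult_ac)
  qed
  finally show ?thesis
    unfolding theta_def 2 .
qed

lemma theta_shift:
  assumes "norm p < 1" "x \<noteq> 0" "p \<noteq> 0"
  shows "theta (p * x) p = - inverse x * theta x p"
proof -
  have 1: "p / (p * x) = inverse x" and 2: "p / inverse x = p * x"
    using assms by (simp_all add: field_simps)
  \<comment> \<open>Both thetas consist of the same two factorials in opposite order.\<close>
  have "theta (p * x) p = theta (inverse x) p"
    unfolding theta_def 1 2 by (rule mult.commute)
  then show ?thesis
    by (simp only: theta_inverse[OF assms(1,2)])
qed

text \<open>A quotient of entire functions of p q / z and z. Both products converge for every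
  \<open>z\<close>, so the formula also covers the poles, where the denominator is 0; all analytic
  properties of the gamma function are read off from it.\<close>

lemma ell_gamma_eq:
  assumes "norm q < 1" and "norm p < 1"
  shows "ell_gamma q p z = qpoch2 (p * q / z) q p / qpoch2 z q p"
proof -
  have 1: "(\<Prod>k. (1 - inverse z * q ^ (j + 1) * p ^ (k + 1)) / (1 - z * q ^ j * p ^ k)) =
        qpoch (p * q / z * q ^ j) p / qpoch (z * q ^ j) p" for j
    using prodinf_divide[OF qpoch_convergent[OF assms(2), of "p * q / z * q ^ j"]
        qpoch_convergent[OF assms(2), of "z * q ^ j"]]
    by (simp add: qpoch_def field_simps)
  show ?thesis
    unfolding ell_gamma_def 1 unfolding qpoch2_def
    by (rule prodinf_divide[symmetric]) (rule qpoch2_convergent assms)+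
qed

lemma ell_gamma_0_left: "norm p < 1 \<Longrightarrow> ell_gamma 0 p z = ell_gamma p 0 z"
  by (simp add: ell_gamma_eq qpoch2_0_right qpoch2_0_middle)

lemma ell_gamma_num_nonzero:
  assumes "norm q < 1" and "norm p < 1" and "norm (p * q) < norm z"
  shows "qpoch2 (p * q / z) q p \<noteq> 0"
  using assms le_less_trans[OF norm_ge_zero assms(3)]
  by (intro qpoch2_nonzero) (simp_all add: norm_divide)

lemma ell_gamma_nonzero:
  assumes "norm q < 1" and "norm p < 1" and "norm z < 1" and "norm (p * q) < norm z"
  shows "ell_gamma q p z \<noteq> 0"
  using assms by (simp add: ell_gamma_eq qpoch2_nonzero ell_gamma_num_nonzero)

lemma ell_gamma_shift:
  assumes "norm q < 1" and "norm p < 1" and "norm z < 1" and "z \<noteq> 0" and "q \<noteq> 0"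
  shows "ell_gamma q p (q * z) = theta z p * ell_gamma q p z"
proof -
  have "p * q / (q * z) = p / z" "p / z * q = p * q / z"
    using assms by auto
  moreover have "qpoch2 z q p \<noteq> 0" "qpoch z p \<noteq> 0"
    using qpoch2_nonzero[of q p z] qpoch_nonzero[of p z] assms by auto
  ultimately show ?thesis
    using qpoch2_split1[OF assms(1,2), of z] qpoch2_split1[OF assms(1,2), of "p / z"]
    by (simp add: ell_gamma_eq assms theta_def field_simps)
qed

text \<open>The reflection formula. Splitting each double factorial once in either base leaves only
  the nonvanishing \<open>X\<close> and \<open>Y\<close> to be cancelled. Therefore z = 1 is
  included: there the totalised quotient is 0, and so is theta. This is how the removable
  singularities of the weight disappear.\<close>

lemma inverse_ell_gamma_pm:
  assumes "norm q < 1" and "norm p < 1" and "norm z = 1"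
  shows "1 / (ell_gamma q p z * ell_gamma q p (inverse z)) = theta z p * theta (inverse z) q"
proof -
  have z: "z \<noteq> 0" using assms by auto
  define X where "X = qpoch2 (z * q * p) q p"
  define Y where "Y = qpoch2 (inverse z * q * p) q p"
  have lt: "norm q * norm p < 1"
    using mult_strict_mono[of "norm q" 1 "norm p" 1] assms by auto
  have XY: "X \<noteq> 0" "Y \<noteq> 0"
    unfolding X_def Y_def
    by (rule qpoch2_nonzero; use assms lt in \<open>simp add: norm_mult norm_inverse\<close>)+
  have a: "qpoch2 z q p = qpoch z p * qpoch (z * q) q * X"
    unfolding X_def using qpoch2_split1[OF assms(1,2), of z] qpoch2_split2[OF assms(1,2), of "z * q"]
    by simp
  have b: "qpoch2 (inverse z) q p = qpoch (inverse z) p * qpoch (inverse z * q) q * Y"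
    unfolding Y_def using qpoch2_split1[OF assms(1,2), of "inverse z"]
      qpoch2_split2[OF assms(1,2), of "inverse z * q"] by simp
  have e: "ell_gamma q p z * ell_gamma q p (inverse z) = 
     (Y / (qpoch z p * qpoch (z * q) q * X)) * (X / (qpoch (inverse z) p * qpoch (inverse z * q) q * Y))"
    unfolding ell_gamma_eq[OF assms(1,2)] a b unfolding X_def Y_def by (simp add: divide_inverse mult_ac)
  have "1 / (ell_gamma q p z * ell_gamma q p (inverse z)) =
      qpoch z p * qpoch (z * q) q * (qpoch (inverse z) p * qpoch (inverse z * q) q)"
    unfolding e using XY by (simp add: field_simps)
  also have "\<dots> = theta z p * theta (inverse z) q"
  proof -
    have "qpoch (inverse z) p = (1 - inverse z) * qpoch (p / z) p"
      "qpoch (inverse z) q = (1 - inverse z) * qpoch (inverse z * q) q"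
      by (subst qpoch_split; use assms in \<open>simp add: field_simps\<close>)+
    then show ?thesis
      by (simp add: theta_def divide_inverse mult_ac)
  qed
  finally show ?thesis .
qed

lemma ell_gamma_holomorphic [holomorphic_intros]:
  assumes "norm q < 1" "norm p < 1" and "f holomorphic_on S"
    and "\<And>z. z \<in> S \<Longrightarrow> norm (f z) < 1" "\<And>z. z \<in> S \<Longrightarrow> f z \<noteq> 0"
  shows "(\<lambda>z. ell_gamma q p (f z)) holomorphic_on S"
  unfolding ell_gamma_eq[OF assms(1,2)]
  by (intro holomorphic_intros assms qpoch2_nonzero)

lemma ell_gamma_continuous [continuous_intros]:
  assumes "norm q < 1" "norm p < 1" and "continuous_on S f"
    and "\<And>z. z \<in> S \<Longrightarrow> norm (f z) < 1" "\<And>z. z \<in> S \<Longrightarrow> f z \<noteq> 0"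
  shows "continuous_on S (\<lambda>z. ell_gamma q p (f z))"
  unfolding ell_gamma_eq[OF assms(1,2)]
  by (intro continuous_intros assms ballI qpoch2_nonzero)

section \<open>Multiplicatively periodic functions on an annulus\<close>

definition annulus :: "real \<Rightarrow> real \<Rightarrow> complex set" where
  "annulus r R = {z. r < norm z \<and> norm z < R}"

lemma open_annulus: "open (annulus r R)"
  unfolding annulus_def by (intro open_Collect_conj open_Collect_less continuous_intros)

lemma connected_annulus_complex: "connected (annulus r R)"
  using connected_annulus(1)[of r "0::complex" R] by (simp add: annulus_def dist_norm)

text \<open>The norm of \<open>h\<close> attains its maximum over a closed fundamental annulus; by
  periodicity this is a maximum over a neighbourhood too, so the maximum principle applies. The
  width condition lets such a closed annulus fit inside.\<close>

lemma multiplicatively_periodic_constant: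
  assumes hol: "h holomorphic_on annulus r R" and "0 \<le> r" and "q \<noteq> 0" and "norm q < 1"
    and wide: "r < norm q * R"
    and per: "\<And>x. r < norm (q * x) \<Longrightarrow> norm x < R \<Longrightarrow> h (q * x) = h x"
  shows "h constant_on annulus r R"
proof -
  define Q where "Q = norm q"
  have Q: "0 < Q" "Q < 1" using assms by (auto simp: Q_def)
  \<comment> \<open>Chosen so that the circles of radius \<open>\<rho>\<close> and
    \<open>Q * \<rho>\<close>, the rims of a period, both lie in the open annulus.\<close>
  obtain \<rho> where \<rho>: "r / Q < \<rho>" "\<rho> < R"
    using dense[of "r / Q" R] wide Q by (auto simp: field_simps Q_def)
  have \<rho>0: "0 < \<rho>" using \<rho>(1) \<open>0 \<le> r\<close> Q by (smt (verit) divide_nonneg_pos)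
  have r\<rho>: "r < Q * \<rho>" using \<rho> Q by (simp add: field_simps)
  define K where "K = cball 0 \<rho> - ball (0::complex) (Q * \<rho>)"
  have "compact K" unfolding K_def by (intro compact_diff) auto
  have K: "z \<in> K \<longleftrightarrow> Q * \<rho> \<le> norm z \<and> norm z \<le> \<rho>" for z
    by (auto simp: K_def)
  have "of_real \<rho> \<in> K" using \<rho>0 Q by (simp add: K)
  have "K \<subseteq> annulus r R" using \<rho> r\<rho> by (auto simp: K annulus_def)
  then have "continuous_on K (\<lambda>x. norm (h x))"
    using hol holomorphic_on_imp_continuous_on continuous_on_norm continuous_on_subset by blast
  then obtain \<xi> where \<xi>: "\<xi> \<in> K" "\<And>x. x \<in> K \<Longrightarrow> norm (h x) \<le> norm (h \<xi>)"
    using continuous_attains_sup[OF \<open>compact K\<close>] \<open>of_real \<rho> \<in> K\<close> by (metis empty_iff)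
  \<comment> \<open>One further period on either side: the maximum point may lie on the rim of
    \<open>K\<close>, but it is interior to \<open>U\<close>.\<close>
  define U where "U = annulus r R \<inter> annulus (Q * (Q * \<rho>)) (\<rho> / Q)"
  show ?thesis
  proof (rule maximum_modulus_principle[OF hol open_annulus connected_annulus_complex])
    show "open U" unfolding U_def by (intro open_Int open_annulus)
    show "U \<subseteq> annulus r R" by (auto simp: U_def)
    have "Q * (Q * \<rho>) < Q * \<rho>" "\<rho> < \<rho> / Q" using \<rho>0 Q by (auto simp: field_simps)
    then show "\<xi> \<in> U"
      using \<xi>(1) \<open>K \<subseteq> annulus r R\<close> K[of \<xi>] by (auto simp: U_def annulus_def)
    fix x assume x: "x \<in> U"
    consider "x \<in> K" | "norm x < Q * \<rho>" | "\<rho> < norm x" using K[of x] by linarith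
    then show "norm (h x) \<le> norm (h \<xi>)"
    proof cases
      case 1
      then show ?thesis by (rule \<xi>)
    next
      case 2
      have "norm (x / q) = norm x / Q" by (simp add: Q_def norm_divide)
      moreover have "norm x / Q < \<rho>" "Q * \<rho> < norm x / Q"
        using 2 x Q by (auto simp: U_def annulus_def field_simps)
      ultimately have "x / q \<in> K" and "norm (x / q) < R" using \<rho> by (auto simp: K)
      moreover have "h (q * (x / q)) = h (x / q)"
        by (rule per) (use x \<open>norm (x / q) < R\<close> \<open>q \<noteq> 0\<close> in \<open>auto simp: U_def annulus_def\<close>)
      ultimately show ?thesis using \<xi>(2) \<open>q \<noteq> 0\<close> by simp
    next
      case 3
      have n: "norm (q * x) = Q * norm x" by (simp add: Q_def norm_mult)
      have "Q * \<rho> < Q * norm x" "Q * norm x < \<rho>"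
        using 3 x Q by (auto simp: U_def annulus_def field_simps)
      then have "q * x \<in> K" "r < norm (q * x)" using n r\<rho> by (auto simp: K)
      moreover have "h (q * x) = h x"
        by (rule per) (use x \<open>r < norm (q * x)\<close> in \<open>auto simp: U_def annulus_def\<close>)
      ultimately show ?thesis using \<xi>(2) by metis
    qed
  qed
qed

section \<open>Weierstrass' addition formula\<close>

text \<open>The multiplier does not depend on \<open>v\<close>, so all three terms of the addition
  formula scale alike in \<open>x\<close>.\<close>

lemma theta_pair_shift:
  assumes "norm p < 1" "p \<noteq> 0" "x \<noteq> 0" "v \<noteq> 0"
  shows "theta (p * x * v) p * theta (p * x / v) p = theta (x * v) p * theta (x / v) p / x\<^sup>2"
proof -
  have "theta (p * x * v) p = - inverse (x * v) * theta (x * v) p"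
    using theta_shift[of p "x * v"] assms by (simp add: mult_ac)
  moreover have "theta (p * x / v) p = - inverse (x / v) * theta (x / v) p"
    using theta_shift[of p "x / v"] assms by simp
  ultimately show ?thesis
    using assms by (simp only:) (simp add: field_simps power2_eq_square)
qed

lemma theta_pair_inverse:
  assumes "norm p < 1" "x \<noteq> 0" "v \<noteq> 0"
  shows "theta (inverse x * v) p * theta (inverse x / v) p = theta (x * v) p * theta (x / v) p / x\<^sup>2"
proof -
  have "theta (inverse x / v) p = - inverse (x * v) * theta (x * v) p"
    using theta_inverse[of p "x * v"] assms by (simp add: divide_inverse mult_ac)
  moreover have "theta (inverse x * v) p = - inverse (x / v) * theta (x / v) p"
    using theta_inverse[of p "x / v"] assms by (simp add: divide_inverse mult_ac)
  ultimately show ?thesis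
    using assms by (simp only:) (simp add: field_simps power2_eq_square)
qed

text \<open>The addition formula as a difference of its sides: a single function of \<open>x\<close>
  whose zeros and multiplier under x -> p x can be studied.\<close>

definition weierstrass :: "complex \<Rightarrow> complex \<Rightarrow> complex \<Rightarrow> complex \<Rightarrow> complex \<Rightarrow> complex" where
  "weierstrass p x y u v =
     theta (x * y) p * theta (x / y) p * (theta (u * v) p * theta (u / v) p)
     - theta (x * v) p * theta (x / v) p * (theta (u * y) p * theta (u / y) p)
     - u / y * (theta (y * v) p * theta (y / v) p) * (theta (x * u) p * theta (x / u) p)"

lemma theta_swap:
  assumes "norm p < 1" "x \<noteq> 0" "y \<noteq> 0"
  shows "theta (x / y) p = - (x / y) * theta (y / x) p"
  using theta_inverse[of p "y / x"] assms by (simp add: field_simps)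

text \<open>At x = v the middle term contains theta at 1, which is 0, and the outer terms cancel by
  \<open>theta_swap\<close>.\<close>

lemma weierstrass_zero_v:
  assumes "norm p < 1" "y \<noteq> 0" "u \<noteq> 0" "v \<noteq> 0"
  shows "weierstrass p v y u v = 0"
  unfolding weierstrass_def theta_swap[OF assms(1,2,4)] theta_swap[OF assms(1,4,3)]
  using assms by (simp add: field_simps)

lemma weierstrass_inverse:
  assumes "norm p < 1" "x \<noteq> 0" "y \<noteq> 0" "u \<noteq> 0" "v \<noteq> 0"
  shows "weierstrass p (inverse x) y u v = weierstrass p x y u v / x\<^sup>2"
  unfolding weierstrass_def theta_pair_inverse[OF assms(1,2,3)] theta_pair_inverse[OF assms(1,2,4)]
    theta_pair_inverse[OF assms(1,2,5)]
  by (simp add: diff_divide_distrib)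

lemma weierstrass_shift:
  assumes "norm p < 1" "p \<noteq> 0" "x \<noteq> 0" "y \<noteq> 0" "u \<noteq> 0" "v \<noteq> 0"
  shows "weierstrass p (p * x) y u v = weierstrass p x y u v / x\<^sup>2"
  unfolding weierstrass_def theta_pair_shift[OF assms(1,2,3,4)] theta_pair_shift[OF assms(1,2,3,5)]
    theta_pair_shift[OF assms(1,2,3,6)]
  by (simp add: diff_divide_distrib)

text \<open>Divide by theta(x v) theta(x / v), which has the same multiplier in \<open>x\<close> and
  whose two zeros in the annulus are also zeros of the numerator. The quotient is p-periodic and
  holomorphic, hence constant, and it vanishes at x = u. The condition |p| < |v|^2 says that the
  annulus is wider than one period.\<close>

lemma weierstrass_zero_generic:
  assumes p: "norm p < 1" "p \<noteq> 0" and yu: "y \<noteq> 0" "u \<noteq> 0"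
    and v: "norm v < 1" "norm p < norm v ^ 2"
    and u: "norm p / norm v < norm u" "norm u < norm v / norm p" "u \<noteq> v" "u \<noteq> inverse v"
    and x: "norm p / norm v < norm x" "norm x < norm v / norm p" "x \<noteq> v" "x \<noteq> inverse v"
  shows "weierstrass p x y u v = 0"
proof -
  have v0: "v \<noteq> 0" using v by (metis norm_zero power_zero_numeral not_less norm_ge_zero)
  define U where "U = annulus (norm p / norm v) (norm v / norm p)"
  have U0: "z \<noteq> 0" if "z \<in> U" for z
    using that p v0 by (auto simp: U_def annulus_def divide_less_0_iff)
  have pv: "norm p < norm v"
    using v by (smt (verit) mult_left_le_one_le norm_ge_zero power2_eq_square)
  define W where "W = (\<lambda>z. weierstrass p z y u v)"
  have holW: "W holomorphic_on U"
    unfolding W_def weierstrass_def using U0 yu v0 p by (auto intro!: holomorphic_intros)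
  \<comment> \<open>The zeros at \<open>v\<close> and then at \<open>inverse v\<close> are divided
    out, the removable singularities being filled by derivatives.\<close>
  define W1 where "W1 = (\<lambda>z. if z = v then deriv W v else (W z - W v) / (z - v))"
  have holW1: "W1 holomorphic_on U"
    unfolding W1_def by (rule pole_lemma_open[OF holW]) (simp add: U_def open_annulus)
  define W2 where "W2 = (\<lambda>z. if z = inverse v then deriv W1 (inverse v)
      else (W1 z - W1 (inverse v)) / (z - inverse v))"
  have holW2: "W2 holomorphic_on U"
    unfolding W2_def by (rule pole_lemma_open[OF holW1]) (simp add: U_def open_annulus)
  have vv: "v \<noteq> inverse v"
  proof
    assume "v = inverse v"
    then have "v * v = 1" using v0 by (metis right_inverse)
    then have "norm v * norm v = 1" by (metis norm_mult norm_one)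
    moreover have "norm v * norm v < 1 * 1" using v by (intro mult_strict_mono) auto
    ultimately show False by simp
  qed
  have Wv: "W v = 0" "W (inverse v) = 0"
    unfolding W_def using p yu v0 by (simp_all add: weierstrass_zero_v weierstrass_inverse)
  then have W1v: "W1 (inverse v) = 0" using vv by (auto simp: W1_def)
  have fac: "W z = (z - v) * (z - inverse v) * W2 z" for z
    using Wv W1v by (auto simp: W2_def W1_def)
  \<comment> \<open>What is left of theta(z v) theta(z / v) when the two linear factors are removed;
    it has no zeros in \<open>U\<close>.\<close>
  define T where "T = (\<lambda>z. qpoch (p * z * v) p * qpoch (p / (z * v)) p *
                          (qpoch (p * z / v) p * qpoch (p * v / z) p))"
  have th: "theta (z * v) p * theta (z / v) p = (z - v) * (z - inverse v) * T z" if "z \<noteq> 0" for z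
  proof -
    have 1: "theta (z * v) p = (1 - z * v) * qpoch (p * z * v) p * qpoch (p / (z * v)) p"
      unfolding theta_def by (subst qpoch_split[OF p(1)]) (simp add: mult_ac)
    have 2: "theta (z / v) p = (1 - z / v) * qpoch (p * z / v) p * qpoch (p * v / z) p"
      unfolding theta_def by (subst qpoch_split[OF p(1)]) (simp add: mult_ac)
    have 3: "(1 - z * v) * (1 - z / v) = (z - v) * (z - inverse v)"
      using v0 by (simp add: field_simps)
    show ?thesis unfolding 1 2 T_def 3[symmetric] by (simp only: mult_ac)
  qed
  have T0: "T z \<noteq> 0" if "z \<in> U" for z
  proof -
    have z: "norm p < norm z * norm v" "norm z * norm p < norm v"
      using that p v0 by (auto simp: U_def annulus_def field_simps)
    have "norm p * norm z * norm v < 1"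
      using z v by (smt (verit, best) mult.commute mult_left_le_one_le mult_right_le_one_le norm_ge_zero zero_le_mult_iff mult_less_cancel_left2)
    moreover have "norm p * norm v < norm z"
    proof -
      have "norm p * norm v \<le> norm p" using v by (simp add: mult_left_le)
      also have "norm p < norm z * norm v" by (rule z)
      also have "\<dots> \<le> norm z" using v by (simp add: mult_left_le)
      finally show ?thesis .
    qed
    ultimately show ?thesis
      unfolding T_def using z U0[OF that] v0 p
      by (intro no_zero_divisors qpoch_nonzero) (simp_all add: norm_mult norm_divide field_simps)
  qed
  define h where "h = (\<lambda>z. W2 z / T z)"
  have holT: "T holomorphic_on U"
    unfolding T_def using U0 v0 p by (auto intro!: holomorphic_intros)
  have holh: "h holomorphic_on U"
    unfolding h_def by (intro holomorphic_intros holW2 holT T0)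
  have per: "h (p * z) = h z" if "norm p / norm v < norm (p * z)" "norm z < norm v / norm p" for z
  proof -
    have h_eq: "h w = W w / (theta (w * v) p * theta (w / v) p)"
      if "w \<in> U" "w \<noteq> v" "w \<noteq> inverse v" for w
      using that T0[OF that(1)] unfolding h_def th[OF U0[OF that(1)]] fac by simp
    have n: "1 < norm z * norm v" "norm z * norm p < norm v"
      using that p v0 by (auto simp: norm_mult field_simps)
    have vv1: "norm v * norm v < 1" using v mult_strict_mono[of "norm v" 1 "norm v" 1] by auto
    have "norm p * (norm z * norm v) > norm p * 1" "norm z * norm v > norm p"
      using n p by (auto intro: mult_strict_left_mono)
    moreover have "norm p * (norm z * norm p) < norm v"
      using n p by (smt (verit) mult_left_le_one_le norm_ge_zero mult_nonneg_nonneg)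
    ultimately have zU: "z \<in> U" "p * z \<in> U"
      using n p v0 by (auto simp: U_def annulus_def norm_mult field_simps)
    \<comment> \<open>Here |z| > 1/|v| > |v| and |p z| < |v|, so \<open>z\<close> and
      \<open>p * z\<close> both avoid the two points where the quotient formula for \<open>h\<close>
      fails.\<close>
    have "z \<noteq> v" "z \<noteq> inverse v"
      using n vv1 v0 by (auto simp: norm_inverse)
    moreover have "p * z \<noteq> v"
      using n by (auto simp: norm_mult mult.commute)
    moreover have "p * z \<noteq> inverse v"
    proof
      assume "p * z = inverse v"
      then have "norm z * norm p = 1 / norm v"
        by (metis inverse_eq_divide mult.commute norm_inverse norm_mult)
      then have "norm v * (norm z * norm p) = 1" using v0 by simp
      moreover have "norm v * (norm z * norm p) < norm v * norm v"
        by (rule mult_strict_left_mono) (use n v0 in auto)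
      ultimately show False using vv1 by linarith
    qed
    moreover have "z \<noteq> 0" using U0 zU by auto
    ultimately show ?thesis
      using zU p yu v0 h_eq[of z] h_eq[of "p * z"]
      by (simp add: theta_pair_shift W_def weierstrass_shift)
  qed
  have "h constant_on U"
    unfolding U_def
  proof (rule multiplicatively_periodic_constant[where q = p])
    show "norm p / norm v < norm p * (norm v / norm p)"
      using v p v0 by (simp add: field_simps power2_eq_square)
  qed (use holh p per in \<open>auto simp: U_def\<close>)
  then obtain c where c: "\<And>z. z \<in> U \<Longrightarrow> h z = c"
    by (auto simp: constant_on_def)
  have "W u = 0"
    using theta_swap[of p] p by (simp add: W_def weierstrass_def)
  then have "h u = 0" using u fac[of u] by (simp add: h_def)
  then have "c = 0" using c[of u] u by (auto simp: U_def annulus_def)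
  then have "h x = 0" using c[of x] x by (auto simp: U_def annulus_def)
  then have "W2 x = 0" using T0[of x] x by (auto simp: h_def U_def annulus_def)
  then show ?thesis using fac[of x] by (simp add: W_def)
qed

lemma punctured_plane_continuation:
  assumes "f holomorphic_on - {0}" and "open S" "S \<noteq> {}" "S \<subseteq> - {0}"
    and "\<And>z. z \<in> S \<Longrightarrow> f z = 0" and "z \<noteq> (0::complex)"
  shows "f z = 0"
  using analytic_continuation_open[of S "- {0}" f "\<lambda>_. 0" z] assms
    connected_punctured_universe[of "0::complex"] by (simp add: open_Compl)

text \<open>For p = 0 this is a rational identity. Otherwise the generic case spreads by the
  identity theorem over the whole punctured plane, first in \<open>x\<close>, then in
  \<open>u\<close>, finally in \<open>v\<close>.\<close>

theorem weierstrass_zero: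
  assumes p: "norm p < 1" and nz: "x \<noteq> 0" "y \<noteq> 0" "u \<noteq> 0" "v \<noteq> 0"
  shows "weierstrass p x y u v = 0"
proof (cases "p = 0")
  case True
  have t: "theta a 0 = 1 - a" for a
    by (simp add: theta_def qpoch_0_right)
  show ?thesis
    using nz unfolding True weierstrass_def t by (simp add: field_simps)
next
  case False
  have hol: "(\<lambda>w. weierstrass p w y u v) holomorphic_on - {0}"
    "(\<lambda>w. weierstrass p x y w v) holomorphic_on - {0}"
    "(\<lambda>w. weierstrass p x y u w) holomorphic_on - {0}"
    if "x \<noteq> 0" "y \<noteq> 0" "u \<noteq> 0" "v \<noteq> 0" for x y u v
    unfolding weierstrass_def using that p by (auto intro!: holomorphic_intros)
  have gen: "weierstrass p x y u v = 0"
    if v: "norm v < 1" "norm p < norm v ^ 2" and xu: "x \<noteq> 0" "u \<noteq> 0" for x u v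
  proof -
    have v0: "v \<noteq> 0" using v by (metis norm_zero power_zero_numeral not_less norm_ge_zero)
    have pv: "norm p < norm v"
      using v by (smt (verit) mult_left_le_one_le norm_ge_zero power2_eq_square)
    define S where "S = annulus (norm p / norm v) (norm v / norm p) - {v, inverse v}"
    have "open S" unfolding S_def by (intro open_Diff open_annulus finite_imp_closed) auto
    have "v \<noteq> 1" using v by auto
    then have "1 \<in> S" using pv False v0 by (auto simp: S_def annulus_def)
    then have "S \<noteq> {}" by blast
    have "S \<subseteq> - {0}" by (auto simp: S_def annulus_def divide_less_0_iff)
    have 1: "weierstrass p x y u v = 0" if "x \<in> S" "u \<in> S" for x u
      by (rule weierstrass_zero_generic)
        (use that v nz p False \<open>S \<subseteq> - {0}\<close> in \<open>auto simp: S_def annulus_def\<close>)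
    have 2: "weierstrass p x y u v = 0" if "u \<in> S" "x \<noteq> 0" for x u
      by (rule punctured_plane_continuation[OF hol(1) \<open>open S\<close> \<open>S \<noteq> {}\<close> \<open>S \<subseteq> - {0}\<close> 1])
        (use that nz v0 xu \<open>S \<subseteq> - {0}\<close> in auto)
    show ?thesis
      by (rule punctured_plane_continuation[OF hol(2) \<open>open S\<close> \<open>S \<noteq> {}\<close> \<open>S \<subseteq> - {0}\<close> 2])
        (use xu nz v0 in auto)
  qed
  \<comment> \<open>The moduli of \<open>v\<close> meeting both conditions of the generic
    case.\<close>
  define S where "S = annulus (sqrt (norm p)) 1"
  obtain r where "sqrt (norm p) < r" "r < 1"
    using dense[of "sqrt (norm p)" 1] p by auto
  moreover from this have "0 \<le> r"
    using real_sqrt_ge_zero[OF norm_ge_zero, of p] by linarith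
  ultimately have "of_real r \<in> S" by (simp add: S_def annulus_def)
  have S: "norm v < 1" "norm p < norm v ^ 2" if "v \<in> S" for v
  proof -
    have "sqrt (norm p) ^ 2 < norm v ^ 2"
      by (rule power_strict_mono) (use that in \<open>auto simp: S_def annulus_def\<close>)
    then show "norm v < 1" "norm p < norm v ^ 2"
      using that by (auto simp: S_def annulus_def)
  qed
  show ?thesis
  proof (rule punctured_plane_continuation[where S = S, OF hol(3)])
    show "S \<subseteq> - {0}" using False by (auto simp: S_def annulus_def)
    show "S \<noteq> {}" using \<open>of_real r \<in> S\<close> by blast
  qed (use gen S nz in \<open>auto simp: S_def open_annulus\<close>)
qed

section \<open>A four-term theta identity\<close>

text \<open>The addition formula at \<open>X * c\<close>, \<open>a / c\<close>,
  \<open>c * z\<close>, \<open>c / z\<close> with c^2 = a b. The root only centres the parameters: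
  it occurs squared or cancels in every theta argument.\<close>

lemma theta_expand_pair:
  assumes p: "norm p < 1" and nz: "X \<noteq> 0" "z \<noteq> 0" "a \<noteq> 0" "b \<noteq> 0"
  shows "theta (X * a) p * theta (X * b) p * theta (a * b) p * theta (z\<^sup>2) p =
    theta (X * a * b / z) p * theta (X * z) p * (theta (a * z) p * theta (b * z) p)
    - z\<^sup>2 * theta (X * a * b * z) p * theta (X / z) p * (theta (a / z) p * theta (b / z) p)"
proof -
  define c where "c = csqrt (a * b)"
  have c: "c * c = a * b" by (metis c_def power2_csqrt power2_eq_square)
  then have c0: "c \<noteq> 0" using nz by auto
  have W: "weierstrass p (X * c) (a / c) (c * z) (c / z) = 0"
    by (rule weierstrass_zero) (use p nz c0 in auto)
  have e: "X * c * (a / c) = X * a" "X * c / (a / c) = X * b" "c * z * (c / z) = a * b"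
      "c * z / (c / z) = z * z" "c * z / (a / c) = b * z" "X * c * (c / z) = X * a * b / z" "X * c / (c / z) = X * z"
      "c * z * (a / c) = a * z" "a / c * (c / z) = a / z"
      "a / c / (c / z) = z / b" "X * c * (c * z) = X * a * b * z" "X * c / (c * z) = X / z"
    using c c0 nz by (auto simp: field_simps)
  have "b * theta (z / b) p = - z * theta (b / z) p"
    using theta_swap[OF p nz(2,4)] nz by (simp add: field_simps)
  moreover have "theta (X * a) p * theta (X * b) p * (theta (a * b) p * theta (z * z) p)
     - theta (X * a * b / z) p * theta (X * z) p * (theta (a * z) p * theta (b * z) p)
     - b * z * (theta (a / z) p * theta (z / b) p) * (theta (X * a * b * z) p * theta (X / z) p) = 0"
    using W unfolding weierstrass_def e .
  ultimately show ?thesis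
    unfolding power2_eq_square by algebra
qed

text \<open>Again the addition formula with centred parameters, now read so that a difference of two
  products collapses to a single one.\<close>

lemma theta_contract_pair:
  assumes p: "norm p < 1" and nz: "t \<noteq> 0" "C \<noteq> 0" "z \<noteq> 0" "a \<noteq> 0" "b \<noteq> 0"
  shows "theta (t / z) p * theta (t * a * b * z) p * (theta (t * C * a) p * theta (t * C * b) p)
    - theta (t * C * a * b * z) p * theta (t * C / z) p * (theta (t * a) p * theta (t * b) p)
    = - (t / z) * theta (t * (t * C * a * b)) p * theta C p * (theta (a * z) p * theta (b * z) p)"
proof -
  define d where "d = csqrt (a * b)"
  have d: "d * d = a * b" by (metis d_def power2_csqrt power2_eq_square)
  then have d0: "d \<noteq> 0" using nz by auto
  have W: "weierstrass p (t * d) (d * z) (t * C * d) (a / d) = 0"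
    by (rule weierstrass_zero) (use p nz d0 in auto)
  have e: "t * d * (d * z) = t * a * b * z" "t * d / (d * z) = t / z"
      "t * C * d * (a / d) = t * C * a" "t * C * d / (a / d) = t * C * b"
      "t * d * (a / d) = t * a" "t * d / (a / d) = t * b"
      "t * C * d * (d * z) = t * C * a * b * z" "t * C * d / (d * z) = t * C / z"
      "d * z * (a / d) = a * z" "d * z / (a / d) = b * z"
      "t * d * (t * C * d) = t * (t * C * a * b)" "t * d / (t * C * d) = 1 / C"
      "t * C * d / (d * z) = t * C / z"
    using d d0 nz by (auto simp: field_simps)
  have "C * theta (1 / C) p = - theta C p"
    using theta_swap[of p 1 C] p nz by simp
  moreover have "theta (t * a * b * z) p * theta (t / z) p * (theta (t * C * a) p * theta (t * C * b) p)
     - theta (t * a) p * theta (t * b) p * (theta (t * C * a * b * z) p * theta (t * C / z) p)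
     - t / z * C * (theta (a * z) p * theta (b * z) p) * (theta (t * (t * C * a * b)) p * theta (1 / C) p) = 0"
    using W unfolding weierstrass_def e by simp
  ultimately show ?thesis
    by algebra
qed

text \<open>After multiplication by theta(b c), \<open>theta_expand_pair\<close> splits both
  products on the left into a z-part and a 1/z-part. Each of the two parts is then a difference that
  \<open>theta_contract_pair\<close> collapses, and the factor theta(b c) it produces is cancelled
  at the end.\<close>

lemma theta_four_term:
  assumes p: "norm p < 1" and nz: "z \<noteq> 0" "a \<noteq> 0" "b \<noteq> 0" "c \<noteq> 0" "d \<noteq> 0" "e \<noteq> 0"
    and A: "A = a * b * c * d * e" and bc: "theta (b * c) p \<noteq> 0"
  shows "theta (z\<^sup>2) p *
     (theta (a * z) p * theta (a / z) p *
        (theta (A / b) p * theta (A / c) p * theta (A / d) p * theta (A / e) p)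
      - theta (A * z) p * theta (A / z) p *
        (theta (a * b) p * theta (a * c) p * theta (a * d) p * theta (a * e) p))
    = - a * theta (a * A) p *
     (theta (a * z) p * theta (b * z) p * theta (c * z) p * theta (d * z) p * theta (e * z) p
        * theta (A / z) p / z
      - z ^ 3 * (theta (a / z) p * theta (b / z) p * theta (c / z) p * theta (d / z) p * theta (e / z) p)
        * theta (A * z) p)"
proof -
  define th where "th = (\<lambda>x. theta x p)"
  define B where "B = a * d * e"
  have nzB: "B \<noteq> 0" using nz by (simp add: B_def)
  have 1: "th (A / b) * th (A / c) * th (b * c) * th (z\<^sup>2) =
     th (A / z) * th (B * z) * (th (b * z) * th (c * z))
     - z\<^sup>2 * th (A * z) * th (B / z) * (th (b / z) * th (c / z))"
  proof -
    have "B * b = A / c" "B * c = A / b" "B * b * c = A"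
      using nz by (auto simp: A B_def field_simps)
    then show ?thesis
      using theta_expand_pair[OF p nzB nz(1,3,4)] by (simp add: th_def mult_ac)
  qed
  have 2: "th (a * b) * th (a * c) * th (b * c) * th (z\<^sup>2) =
     th (a * (b * c) / z) * th (a * z) * (th (b * z) * th (c * z))
     - z\<^sup>2 * th (a * (b * c) * z) * th (a / z) * (th (b / z) * th (c / z))"
    using theta_expand_pair[OF p nz(2,1,3,4)] by (simp add: th_def mult.assoc)
  have A': "a * (b * c) * d = A / e" "a * (b * c) * e = A / d" "a * (b * c) * d * e = A"
    using nz by (auto simp: A field_simps)
  have 3: "th (a / z) * th (B * z) * (th (A / d) * th (A / e)) -
        th (A * z) * th (a * (b * c) / z) * (th (a * d) * th (a * e)) =
        - (a / z) * th (a * A) * th (b * c) * (th (d * z) * th (e * z))" if "z \<noteq> 0" for z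
    using theta_contract_pair[OF p nz(2) _ that nz(5,6), of "b * c"] nz
    by (simp add: th_def A' B_def mult.commute[of "theta (A / e) p"])
  \<comment> \<open>The contraction at 1/z, needed for the second half of the expansion.\<close>
  have 4: "th (a * z) * th (B / z) * (th (A / d) * th (A / e)) -
        th (A / z) * th (a * (b * c) * z) * (th (a * d) * th (a * e)) =
        - (a * z) * th (a * A) * th (b * c) * (th (d / z) * th (e / z))"
    using 3[of "inverse z"] nz by (simp add: divide_inverse)
  define P where "P = th (A / d) * th (A / e)"
  define R where "R = th (a * d) * th (a * e)"
  have "th (b * c) * (th (z\<^sup>2) * (th (a * z) * th (a / z) * (th (A / b) * th (A / c) * P)
      - th (A * z) * th (A / z) * (th (a * b) * th (a * c) * R)))
     = th (a * z) * th (a / z) * P * (th (A / b) * th (A / c) * th (b * c) * th (z\<^sup>2))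
      - th (A * z) * th (A / z) * R * (th (a * b) * th (a * c) * th (b * c) * th (z\<^sup>2))"
    by (simp add: algebra_simps)
  also have "\<dots> = th (b * z) * th (c * z) * th (A / z) * th (a * z) *
        (th (a / z) * th (B * z) * P - th (A * z) * th (a * (b * c) / z) * R)
      - z\<^sup>2 * (th (b / z) * th (c / z)) * th (A * z) * th (a / z) *
        (th (a * z) * th (B / z) * P - th (A / z) * th (a * (b * c) * z) * R)"
    unfolding 1 2 by (simp add: algebra_simps)
  also have "\<dots> = th (b * c) * (- a * th (a * A) *
     (th (a * z) * th (b * z) * th (c * z) * th (d * z) * th (e * z) * th (A / z) / z
      - z ^ 3 * (th (a / z) * th (b / z) * th (c / z) * th (d / z) * th (e / z)) * th (A * z)))"
    unfolding P_def R_def 3[OF nz(1)] 4 by (simp add: algebra_simps power2_eq_square power3_eq_cube)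
  finally show ?thesis
    using bc unfolding th_def P_def R_def by (simp only: mult_left_cancel mult.assoc simp_thms)
qed

section \<open>Contour integrals depending on a parameter\<close>

lemma continuous_on_contour_integral_param:
  assumes F: "continuous_on (U \<times> path_image \<gamma>) (\<lambda>(w, z). F w z)"
    and \<gamma>: "path \<gamma>" "continuous_on {0..1} (\<lambda>t. vector_derivative \<gamma> (at t))"
  shows "continuous_on U (\<lambda>w. contour_integral \<gamma> (F w))"
proof -
  have "continuous_on (U \<times> {0..1}) (\<lambda>x. (\<lambda>(w, z). F w z) (fst x, \<gamma> (snd x)))"
    by (rule continuous_on_compose2[OF F])
      (use \<gamma> in \<open>auto simp: path_def path_image_def intro!: continuous_intros
        continuous_on_compose2[OF _ continuous_on_snd]\<close>)
  moreover have "continuous_on (U \<times> {0..1}) (\<lambda>x. vector_derivative \<gamma> (at (snd x)))"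
    by (rule continuous_on_compose2[OF \<gamma>(2) continuous_on_snd]) auto
  ultimately have "continuous_on (U \<times> cbox 0 1) (\<lambda>(w, t). F w (\<gamma> t) * vector_derivative \<gamma> (at t))"
    by (simp add: case_prod_unfold continuous_on_mult)
  then show ?thesis
    unfolding contour_integral_integral by (subst box_real(2)[symmetric]) (rule integral_continuous_on_param)
qed

lemma continuous_vector_derivative_circlepath:
  "continuous_on A (\<lambda>t. vector_derivative (circlepath z r) (at t))"
  by (simp add: vector_derivative_circlepath) (intro continuous_intros)

text \<open>Morera's theorem: by Fubini the integral over a triangle moves inside, where it vanishes
  by Cauchy's theorem for each fixed \<open>z\<close>.\<close>

lemma holomorphic_on_contour_integral_param:
  fixes F :: "complex \<Rightarrow> complex \<Rightarrow> complex"
  assumes "open U" and F: "continuous_on (U \<times> sphere 0 1) (\<lambda>(w, z). F w z)"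
    and hol: "\<And>z. norm z = 1 \<Longrightarrow> (\<lambda>w. F w z) holomorphic_on U"
  shows "(\<lambda>w. contour_integral (circlepath 0 1) (F w)) holomorphic_on U"
proof (rule analytic_imp_holomorphic[OF Morera_triangle[OF _ \<open>open U\<close>]], safe)
  let ?\<gamma> = "circlepath 0 1 :: real \<Rightarrow> complex"
  show "continuous_on U (\<lambda>w. contour_integral ?\<gamma> (F w))"
    using F by (intro continuous_on_contour_integral_param continuous_vector_derivative_circlepath) auto
  fix a b c :: complex
  assume hull: "convex hull {a, b, c} \<subseteq> U"
  have seg: "closed_segment x y \<subseteq> U" if "x \<in> {a, b, c}" "y \<in> {a, b, c}" for x y
    using closed_segment_subset_convex_hull[OF hull_inc[OF that(1)] hull_inc[OF that(2)]] hull
    by (rule order_trans)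
  have Fseg: "continuous_on (closed_segment x y \<times> sphere 0 1) (\<lambda>(w, z). F w z)"
    if "x \<in> {a, b, c}" "y \<in> {a, b, c}" for x y
    by (rule continuous_on_subset[OF F]) (use seg[OF that] in auto)
  have Fseg': "continuous_on (sphere 0 1 \<times> closed_segment x y) (\<lambda>(z, w). F w z)"
    if "x \<in> {a, b, c}" "y \<in> {a, b, c}" for x y
  proof -
    have "continuous_on (sphere 0 1 \<times> closed_segment x y) (\<lambda>x. (\<lambda>(w, z). F w z) (snd x, fst x))"
      by (rule continuous_on_compose2[OF Fseg[OF that]]) (auto intro!: continuous_intros)
    then show ?thesis by (simp add: case_prod_unfold)
  qed
  have swap: "contour_integral (linepath x y) (\<lambda>w. contour_integral ?\<gamma> (F w)) =
      contour_integral ?\<gamma> (\<lambda>z. contour_integral (linepath x y) (\<lambda>w. F w z))"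
    if "x \<in> {a, b, c}" "y \<in> {a, b, c}" for x y
    by (rule contour_integral_swap)
      (use Fseg[OF that] in \<open>auto simp: continuous_vector_derivative_circlepath\<close>)
  have int: "(\<lambda>z. contour_integral (linepath x y) (\<lambda>w. F w z)) contour_integrable_on ?\<gamma>"
    if "x \<in> {a, b, c}" "y \<in> {a, b, c}" for x y
    by (intro contour_integrable_continuous_circlepath continuous_on_contour_integral_param)
      (use Fseg'[OF that] in auto)
  have zero: "contour_integral (linepath a b) (\<lambda>w. F w z) + contour_integral (linepath b c) (\<lambda>w. F w z)
      + contour_integral (linepath c a) (\<lambda>w. F w z) = 0" if "norm z = 1" for z
  proof -
    have "(\<lambda>w. F w z) holomorphic_on convex hull {a, b, c}"
      using hol[OF that] hull holomorphic_on_subset by blast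
    from has_chain_integral_chain_integral3[OF Cauchy_theorem_triangle[OF this]] show ?thesis .
  qed
  have "contour_integral (linepath a b) (\<lambda>w. contour_integral ?\<gamma> (F w)) +
      contour_integral (linepath b c) (\<lambda>w. contour_integral ?\<gamma> (F w)) +
      contour_integral (linepath c a) (\<lambda>w. contour_integral ?\<gamma> (F w)) =
      contour_integral ?\<gamma> (\<lambda>z. contour_integral (linepath a b) (\<lambda>w. F w z)
        + contour_integral (linepath b c) (\<lambda>w. F w z) + contour_integral (linepath c a) (\<lambda>w. F w z))"
    by (simp add: swap contour_integral_add int contour_integrable_add)
  also have "\<dots> = contour_integral ?\<gamma> (\<lambda>z. 0)"
    by (rule contour_integral_cong) (use zero in auto)
  finally show "contour_integral (linepath a b) (\<lambda>w. contour_integral ?\<gamma> (F w)) +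
      contour_integral (linepath b c) (\<lambda>w. contour_integral ?\<gamma> (F w)) +
      contour_integral (linepath c a) (\<lambda>w. contour_integral ?\<gamma> (F w)) = 0"
    by simp
qed

text \<open>The form dz/z is invariant under z -> z/q, so the left side is an integral over the
  circle of radius 1/|q|; that circle is homotopic to the unit circle inside the domain of
  holomorphy.\<close>

lemma contour_integral_dilation:
  assumes g: "g holomorphic_on S" "open S" and q: "q \<noteq> 0" "norm q < 1"
    and sub: "\<And>w. 1 \<le> norm w \<Longrightarrow> norm w \<le> 1 / norm q \<Longrightarrow> w \<in> S"
  shows "contour_integral (circlepath 0 1) (\<lambda>z. g (z / q) / z) =
         contour_integral (circlepath 0 1) (\<lambda>z. g z / z)"
proof -
  let ?\<gamma> = "circlepath 0 1 :: real \<Rightarrow> complex"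
  have "contour_integral ((\<lambda>w. w / q) \<circ> ?\<gamma>) (\<lambda>w. g w / w) =
      contour_integral ?\<gamma> (\<lambda>w. deriv (\<lambda>w. w / q) w * (g (w / q) / (w / q)))"
    by (rule contour_integral_comp_analyticW[where s = UNIV])
      (use q in \<open>auto intro!: analytic_intros\<close>)
  also have "\<dots> = contour_integral ?\<gamma> (\<lambda>z. g (z / q) / z)"
    using q by (intro contour_integral_cong) (auto simp: field_simps power2_eq_square)
  finally have 1: "contour_integral ?\<gamma> (\<lambda>z. g (z / q) / z) =
    contour_integral ((\<lambda>w. w / q) \<circ> ?\<gamma>) (\<lambda>w. g w / w)" ..
  \<comment> \<open>Multiplication by exp(s L) deforms the identity into division by
    \<open>q\<close>; on the unit circle its image has modulus |q|^(-s), between 1 and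
    1/|q|.\<close>
  define L where "L = Ln (1 / q)"
  have eL: "exp L = 1 / q" unfolding L_def using q by (intro exp_Ln) auto
  have "contour_integral ?\<gamma> (\<lambda>w. g w / w) = contour_integral ((\<lambda>w. w / q) \<circ> ?\<gamma>) (\<lambda>w. g w / w)"
  proof (rule Cauchy_theorem_homotopic_loops[where S = "S - {0}"])
    show "open (S - {0})" using g by auto
    show "(\<lambda>w. g w / w) holomorphic_on S - {0}"
      by (intro holomorphic_intros holomorphic_on_subset[OF g(1)]) auto
    show "valid_path ?\<gamma>" by simp
    show "valid_path ((\<lambda>w. w / q) \<circ> ?\<gamma>)"
      by (rule valid_path_compose_holomorphic[where S = UNIV]) (use q in \<open>auto intro!: holomorphic_intros\<close>)
    define H where "H = (\<lambda>x :: real \<times> real. exp (of_real (fst x) * L) * ?\<gamma> (snd x))"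
    have nH: "norm (H (s, t)) = (1 / norm q) powr s" for s t
    proof -
      have "Re L = ln (1 / norm q)" unfolding L_def using q by (simp add: norm_divide)
      then show ?thesis using q by (simp add: H_def norm_mult powr_def circlepath norm_exp)
    qed
    show "homotopic_loops (S - {0}) ?\<gamma> ((\<lambda>w. w / q) \<circ> ?\<gamma>)"
      unfolding homotopic_loops
    proof (intro exI[of _ H] conjI ballI)
      show "continuous_on ({0..1} \<times> {0..1}) H"
        unfolding H_def circlepath by (intro continuous_intros)
      have "H (s, t) \<in> S - {0}" if "0 \<le> s" "s \<le> 1" for s t
      proof -
        have "1 \<le> 1 / norm q" using q by auto
        then have "1 \<le> (1 / norm q) powr s" "(1 / norm q) powr s \<le> 1 / norm q"
          using that powr_mono[of s 1 "1 / norm q"] q by (auto intro: ge_one_powr_ge_zero)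
        then show ?thesis using nH[of s t] sub[of "H (s, t)"] by fastforce
      qed
      then show "H \<in> {0..1} \<times> {0..1} \<rightarrow> S - {0}" by auto
      show "H (0, x) = ?\<gamma> x" for x by (simp add: H_def)
      show "H (1, x) = ((\<lambda>w. w / q) \<circ> ?\<gamma>) x" for x by (simp add: H_def eL)
      show "pathfinish (H \<circ> Pair t) = pathstart (H \<circ> Pair t)" for t
        by (simp add: H_def pathfinish_def pathstart_def circlepath)
    qed
  qed
  then show ?thesis using 1 by simp
qed

section \<open>The elliptic beta integral as a function of its parameters\<close>

lemma norm_mult_less_one:
  "norm x < 1 \<Longrightarrow> norm y < 1 \<Longrightarrow> norm (x * y :: complex) < 1"
  using mult_strict_mono[of "norm x" 1 "norm y" 1] by (simp add: norm_mult)

lemma norm_mult_lower: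
  assumes "r < norm (x * y :: complex)" "norm y < 1"
  shows "r < norm x"
proof -
  have "norm x * norm y \<le> norm x" using assms(2) by (intro mult_left_le) auto
  then show ?thesis using assms(1) by (simp add: norm_mult)
qed

text \<open>On the unit circle this is 1 / Gamma(z^2, z^-2), written by the reflection formula so
  that no singularity has to be removed.\<close>

definition beta_weight :: "complex \<Rightarrow> complex \<Rightarrow> complex \<Rightarrow> complex" where
  "beta_weight q p z = theta (z\<^sup>2) p * theta (inverse (z\<^sup>2)) q"

text \<open>Spiridonov's integrand with the sixth parameter t_6 = pq / (a b c d e) eliminated:
  Gamma(t_6 z) is the reciprocal of Gamma(a b c d e / z).\<close>

definition beta_integrand ::
  "complex \<Rightarrow> complex \<Rightarrow> complex \<Rightarrow> complex \<Rightarrow> complex \<Rightarrow> complex \<Rightarrow> complex \<Rightarrow> complex \<Rightarrow> complex" where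
  "beta_integrand q p a b c d e z = beta_weight q p z *
     (ell_gamma_pm q p a z * ell_gamma_pm q p b z * ell_gamma_pm q p c z * ell_gamma_pm q p d z *
      ell_gamma_pm q p e z) / ell_gamma_pm q p (a * b * c * d * e) z"

definition beta_integral ::
  "complex \<Rightarrow> complex \<Rightarrow> complex \<Rightarrow> complex \<Rightarrow> complex \<Rightarrow> complex \<Rightarrow> complex \<Rightarrow> complex" where
  "beta_integral q p a b c d e =
     contour_integral (circlepath 0 1) (\<lambda>z. beta_integrand q p a b c d e z / z)"

text \<open>The product of Gamma(t_j t_k) over all pairs of six parameters: a pair containing the
  eliminated one contributes the reciprocal of a gamma of four of the remaining five.\<close>

definition beta_value ::
  "complex \<Rightarrow> complex \<Rightarrow> complex \<Rightarrow> complex \<Rightarrow> complex \<Rightarrow> complex \<Rightarrow> complex \<Rightarrow> complex" where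
  "beta_value q p a b c d e =
     ell_gamma q p (a * b) * ell_gamma q p (a * c) * ell_gamma q p (a * d) * ell_gamma q p (a * e) *
     ell_gamma q p (b * c) * ell_gamma q p (b * d) * ell_gamma q p (b * e) *
     ell_gamma q p (c * d) * ell_gamma q p (c * e) * ell_gamma q p (d * e) /
     (ell_gamma q p (b * c * d * e) * ell_gamma q p (a * c * d * e) * ell_gamma q p (a * b * d * e) *
      ell_gamma q p (a * b * c * e) * ell_gamma q p (a * b * c * d))"

definition beta_ratio ::
  "complex \<Rightarrow> complex \<Rightarrow> complex \<Rightarrow> complex \<Rightarrow> complex \<Rightarrow> complex \<Rightarrow> complex \<Rightarrow> complex" where
  "beta_ratio q p a b c d e = beta_integral q p a b c d e / beta_value q p a b c d e"

text \<open>For nonzero \<open>p\<close> and \<open>q\<close> the last condition is |t_6| < 1 for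
  the eliminated parameter; it keeps the zeros of the denominator off the circle.\<close>

definition beta_domain ::
  "complex \<Rightarrow> complex \<Rightarrow> complex \<Rightarrow> complex \<Rightarrow> complex \<Rightarrow> complex \<Rightarrow> complex \<Rightarrow> bool" where
  "beta_domain q p a b c d e \<longleftrightarrow> norm a < 1 \<and> norm b < 1 \<and> norm c < 1 \<and> norm d < 1 \<and> norm e < 1 \<and>
     norm (p * q) < norm (a * b * c * d * e)"

text \<open>Cyclic symmetry is enough to bring any parameter into the first place, where shifts and
  continuations take place.\<close>

lemma beta_ratio_rotate: "beta_ratio q p a b c d e = beta_ratio q p b c d e a"
proof -
  have "beta_integrand q p a b c d e = beta_integrand q p b c d e a"
    by (intro ext) (simp only: beta_integrand_def mult_ac)
  moreover have "beta_value q p a b c d e = beta_value q p b c d e a"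
    by (simp only: beta_value_def mult_ac)
  ultimately show ?thesis
    by (simp add: beta_ratio_def beta_integral_def)
qed

lemma beta_domain_rotate: "beta_domain q p a b c d e \<longleftrightarrow> beta_domain q p b c d e a"
  by (auto simp: beta_domain_def mult_ac)

lemma beta_domain_nonzero:
  "beta_domain q p a b c d e \<Longrightarrow> a \<noteq> 0 \<and> b \<noteq> 0 \<and> c \<noteq> 0 \<and> d \<noteq> 0 \<and> e \<noteq> 0"
  using not_less[of "norm (p * q)" 0] by (auto simp: beta_domain_def)

text \<open>A partial product has modulus above that of the full product. So all gamma arguments lie
  in |pq| < |z| < 1, where the gamma function has neither zeros nor poles.\<close>

lemma beta_domain_products:
  assumes "beta_domain q p a b c d e"
  defines "I \<equiv> {z. norm (p * q) < norm z \<and> norm z < 1}"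
  shows "a * b \<in> I" "a * c \<in> I" "a * d \<in> I" "a * e \<in> I" "b * c \<in> I" "b * d \<in> I" "b * e \<in> I"
    "c * d \<in> I" "c * e \<in> I" "d * e \<in> I" "b * c * d * e \<in> I" "a * c * d * e \<in> I"
    "a * b * d * e \<in> I" "a * b * c * e \<in> I" "a * b * c * d \<in> I" "a * b * c * d * e \<in> I"
proof -
  have n: "norm a < 1" "norm b < 1" "norm c < 1" "norm d < 1" "norm e < 1"
    and A: "norm (p * q) < norm (a * b * c * d * e)"
    using assms(1) by (auto simp: beta_domain_def)
  have *: "x \<in> I" if "a * b * c * d * e = x * y" "norm x < 1" "norm y < 1" for x y
    using A norm_mult_lower[of "norm (p * q)" x y] that by (simp add: I_def)
  show "a * b \<in> I" by (rule *[of _ "c * d * e"]) (intro norm_mult_less_one n; fail | simp only: mult_ac)+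
  show "a * c \<in> I" by (rule *[of _ "b * d * e"]) (intro norm_mult_less_one n; fail | simp only: mult_ac)+
  show "a * d \<in> I" by (rule *[of _ "b * c * e"]) (intro norm_mult_less_one n; fail | simp only: mult_ac)+
  show "a * e \<in> I" by (rule *[of _ "b * c * d"]) (intro norm_mult_less_one n; fail | simp only: mult_ac)+
  show "b * c \<in> I" by (rule *[of _ "a * d * e"]) (intro norm_mult_less_one n; fail | simp only: mult_ac)+
  show "b * d \<in> I" by (rule *[of _ "a * c * e"]) (intro norm_mult_less_one n; fail | simp only: mult_ac)+
  show "b * e \<in> I" by (rule *[of _ "a * c * d"]) (intro norm_mult_less_one n; fail | simp only: mult_ac)+
  show "c * d \<in> I" by (rule *[of _ "a * b * e"]) (intro norm_mult_less_one n; fail | simp only: mult_ac)+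
  show "c * e \<in> I" by (rule *[of _ "a * b * d"]) (intro norm_mult_less_one n; fail | simp only: mult_ac)+
  show "d * e \<in> I" by (rule *[of _ "a * b * c"]) (intro norm_mult_less_one n; fail | simp only: mult_ac)+
  show "b * c * d * e \<in> I" by (rule *[of _ a]) (intro norm_mult_less_one n; fail | simp only: mult_ac)+
  show "a * c * d * e \<in> I" by (rule *[of _ b]) (intro norm_mult_less_one n; fail | simp only: mult_ac)+
  show "a * b * d * e \<in> I" by (rule *[of _ c]) (intro norm_mult_less_one n; fail | simp only: mult_ac)+
  show "a * b * c * e \<in> I" by (rule *[of _ d]) (intro norm_mult_less_one n; fail | simp only: mult_ac)+
  show "a * b * c * d \<in> I" by (rule *[of _ e]) (intro norm_mult_less_one n; fail | simp only: mult_ac)+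
  show "a * b * c * d * e \<in> I" unfolding I_def by (intro CollectI conjI A norm_mult_less_one n)
qed

text \<open>All that remains of the difference equation after every gamma function is expressed by its
  value at the unshifted parameters is the four-term theta identity, multiplied by a common factor.\<close>

lemma shift_algebra:
  fixes x y GA z :: complex
  assumes nz: "x \<noteq> 0" "y \<noteq> 0" "GA \<noteq> 0" "z \<noteq> 0"
    and "t * (u * u' * P1 - x * y * P2) = - a * T * (B * y / z - z ^ 3 * B' * x)"
  shows "t * E * (u * u' * G) / (x * y * GA) * P1 - t * E * G / GA * P2 =
    - a * T * (E * (B * G) / (x * GA) / z - z ^ 3 * E * (B' * G) / (y * GA))"
proof -
  have "t * E * (u * u' * G) / (x * y * GA) * P1 - t * E * G / GA * P2 =
      E * G / (x * y * GA) * (t * (u * u' * P1 - x * y * P2))"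
    using nz by (simp add: field_simps)
  also have "\<dots> = - a * T * (E * (B * G) / (x * GA) / z - z ^ 3 * E * (B' * G) / (y * GA))"
    unfolding assms(5) using nz by (simp add: field_simps)
  finally show ?thesis .
qed

lemma shift_value_algebra:
  fixes t1 t2 t3 t4 :: complex
  assumes "t1 \<noteq> 0" "t2 \<noteq> 0" "t3 \<noteq> 0" "t4 \<noteq> 0"
  shows "(u1 * g1) * (u2 * g2) * (u3 * g3) * (u4 * g4) * r1 * r2 * r3 * r4 * r5 * r6 /
      (h * (t1 * h1) * (t2 * h2) * (t3 * h3) * (t4 * h4)) * (t1 * t2 * t3 * t4) =
    g1 * g2 * g3 * g4 * r1 * r2 * r3 * r4 * r5 * r6 / (h * h1 * h2 * h3 * h4) * (u1 * u2 * u3 * u4)"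
proof -
  have "h * (t1 * h1) * (t2 * h2) * (t3 * h3) * (t4 * h4) = (t1 * t2 * t3 * t4) * (h * h1 * h2 * h3 * h4)"
    "(u1 * g1) * (u2 * g2) * (u3 * g3) * (u4 * g4) * r1 * r2 * r3 * r4 * r5 * r6 =
      (g1 * g2 * g3 * g4 * r1 * r2 * r3 * r4 * r5 * r6) * (u1 * u2 * u3 * u4)"
    by (simp_all only: mult_ac)
  moreover have "x / (t * y) * t = x / y" if "t \<noteq> 0" for x y t :: complex
    using that by simp
  ultimately show ?thesis
    using assms by (simp only: mult_eq_0_iff simp_thms times_divide_eq_left)
qed

section \<open>The q-difference equation in the first parameter\<close>

context
  fixes q p :: complex
  assumes q: "norm q < 1" and p: "norm p < 1"
begin

lemma ell_gamma_pm_nonzero: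
  assumes "norm a < 1" "norm (p * q) < norm a" "norm z = 1"
  shows "ell_gamma_pm q p a z \<noteq> 0"
  using assms unfolding ell_gamma_pm_def
  by (intro no_zero_divisors ell_gamma_nonzero q p) (simp_all add: norm_mult norm_inverse)

lemma ell_gamma_pm_continuous [continuous_intros]:
  assumes "continuous_on S f" "continuous_on S g"
    and "\<And>x. x \<in> S \<Longrightarrow> norm (f x) < 1" "\<And>x. x \<in> S \<Longrightarrow> f x \<noteq> 0" "\<And>x. x \<in> S \<Longrightarrow> norm (g x) = 1"
  shows "continuous_on S (\<lambda>x. ell_gamma_pm q p (f x) (g x))"
proof -
  have "g x \<noteq> 0" if "x \<in> S" for x using assms(5)[OF that] by auto
  then show ?thesis
    unfolding ell_gamma_pm_def using assms
    by (intro continuous_intros q p) (auto simp: norm_mult norm_inverse)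
qed

lemma beta_weight_continuous [continuous_intros]:
  assumes "continuous_on S g" "\<And>x. x \<in> S \<Longrightarrow> norm (g x) = 1"
  shows "continuous_on S (\<lambda>x. beta_weight q p (g x))"
proof -
  have "g x \<noteq> 0" if "x \<in> S" for x using assms(2)[OF that] by auto
  then show ?thesis
    unfolding beta_weight_def using assms by (intro continuous_intros q p) auto
qed

lemma ell_gamma_pm_shift:
  assumes "norm a < 1" "a \<noteq> 0" "norm z = 1" "q \<noteq> 0"
  shows "ell_gamma_pm q p (q * a) z = theta (a * z) p * theta (a / z) p * ell_gamma_pm q p a z"
proof -
  have "z \<noteq> 0" using assms by auto
  then show ?thesis
    using ell_gamma_shift[OF q p, of "a * z"] ell_gamma_shift[OF q p, of "a / z"] assms
    by (simp add: ell_gamma_pm_def norm_mult norm_divide norm_inverse divide_inverse mult_ac)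
qed

lemma beta_value_nonzero:
  assumes "beta_domain q p a b c d e"
  shows "beta_value q p a b c d e \<noteq> 0"
  using beta_domain_products[OF assms] by (simp add: beta_value_def ell_gamma_nonzero q p)

lemma theta_triples_nonzero:
  assumes "beta_domain q p a b c d e" "norm p < norm (a * b * c * d * e)"
  shows "theta (a * c * d * e) p \<noteq> 0" "theta (a * b * d * e) p \<noteq> 0" "theta (a * b * c * e) p \<noteq> 0"
      "theta (a * b * c * d) p \<noteq> 0"
proof -
  note P = beta_domain_products[OF assms(1)]
  have n: "norm b < 1" "norm c < 1" "norm d < 1" "norm e < 1"
    using assms by (auto simp: beta_domain_def)
  have th: "theta x p \<noteq> 0" if "a * b * c * d * e = x * y" "norm x < 1" "norm y < 1" for x y
    by (rule theta_nonzero) (use that p assms(2) norm_mult_lower[of "norm p" x y] in auto)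
  show "theta (a * c * d * e) p \<noteq> 0"
    by (rule th[of _ b]) (use P n in \<open>auto simp only: mult_ac mem_Collect_eq\<close>)
  show "theta (a * b * d * e) p \<noteq> 0"
    by (rule th[of _ c]) (use P n in \<open>auto simp only: mult_ac mem_Collect_eq\<close>)
  show "theta (a * b * c * e) p \<noteq> 0"
    by (rule th[of _ d]) (use P n in \<open>auto simp only: mult_ac mem_Collect_eq\<close>)
  show "theta (a * b * c * d) p \<noteq> 0"
    by (rule th[of _ e]) (use P n in \<open>auto simp only: mult_ac mem_Collect_eq\<close>)
qed

text \<open>Eight of the fifteen arguments contain \<open>a\<close>, and each gains one theta; the
  theta factors are those that multiply the two integrands in
  \<open>beta_integrand_shift\<close>.\<close>

lemma beta_value_shift:
  assumes "beta_domain q p a b c d e" "q \<noteq> 0" "norm p < norm (a * b * c * d * e)"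
  shows "beta_value q p (q * a) b c d e *
      (theta (a * c * d * e) p * theta (a * b * d * e) p * theta (a * b * c * e) p * theta (a * b * c * d) p) =
    beta_value q p a b c d e * (theta (a * b) p * theta (a * c) p * theta (a * d) p * theta (a * e) p)"
    (is "?L * ?T = _")
proof -
  note P = beta_domain_products[OF assms(1)] and nz = beta_domain_nonzero[OF assms(1)]
  have s: "ell_gamma q p (q * x) = theta x p * ell_gamma q p x" if "norm x < 1" "x \<noteq> 0" for x
    by (rule ell_gamma_shift) (use q p assms that in auto)
  have eqs: "q * a * b = q * (a * b)" "q * a * c = q * (a * c)" "q * a * d = q * (a * d)" "q * a * e = q * (a * e)"
    "q * (a * c) * d * e = q * (a * c * d * e)" "q * (a * b) * d * e = q * (a * b * d * e)"
    "q * (a * b) * c * e = q * (a * b * c * e)" "q * (a * b) * c * d = q * (a * b * c * d)"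
    by (simp_all only: mult_ac)
  have "theta (a * c * d * e) p \<noteq> 0" "theta (a * b * d * e) p \<noteq> 0" "theta (a * b * c * e) p \<noteq> 0"
      "theta (a * b * c * d) p \<noteq> 0"
    using theta_triples_nonzero[OF assms(1,3)] by auto
  have g: "ell_gamma q p (q * (a * b)) = theta (a * b) p * ell_gamma q p (a * b)"
    "ell_gamma q p (q * (a * c)) = theta (a * c) p * ell_gamma q p (a * c)"
    "ell_gamma q p (q * (a * d)) = theta (a * d) p * ell_gamma q p (a * d)"
    "ell_gamma q p (q * (a * e)) = theta (a * e) p * ell_gamma q p (a * e)"
    "ell_gamma q p (q * (a * c * d * e)) = theta (a * c * d * e) p * ell_gamma q p (a * c * d * e)"
    "ell_gamma q p (q * (a * b * d * e)) = theta (a * b * d * e) p * ell_gamma q p (a * b * d * e)"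
    "ell_gamma q p (q * (a * b * c * e)) = theta (a * b * c * e) p * ell_gamma q p (a * b * c * e)"
    "ell_gamma q p (q * (a * b * c * d)) = theta (a * b * c * d) p * ell_gamma q p (a * b * c * d)"
    by (rule s; use P nz in \<open>simp only: mem_Collect_eq mult_eq_0_iff simp_thms\<close>)+
  show ?thesis
    unfolding beta_value_def eqs g by (rule shift_value_algebra) fact+
qed

text \<open>The telescoping function. Its asymmetric factors \<open>h t\<close> equal theta(t w)
  Gamma(t w, t / w) at w = z, and theta(t / z) Gamma(t z, t / z) at w = z / q; these are the two
  theta products on the right of \<open>theta_four_term\<close>. The p-theta of the weight is absent
  because that identity absorbs it.\<close>

definition beta_certificate ::
    "complex \<Rightarrow> complex \<Rightarrow> complex \<Rightarrow> complex \<Rightarrow> complex \<Rightarrow> complex \<Rightarrow> complex" where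
  "beta_certificate a b c d e w =
     (let h = (\<lambda>t. ell_gamma q p (q * t * w) * ell_gamma q p (t * inverse w)) in
      theta (inverse (w\<^sup>2)) q * (h a * h b * h c * h d * h e) / h (a * b * c * d * e) / w)"

lemma beta_integrand_shift:
  assumes dom: "beta_domain q p a b c d e" and q0: "q \<noteq> 0" and A: "norm p < norm (a * b * c * d * e)"
    and z: "norm z = 1"
  shows "beta_integrand q p (q * a) b c d e z *
      (theta (a * c * d * e) p * theta (a * b * d * e) p * theta (a * b * c * e) p * theta (a * b * c * d) p)
    - beta_integrand q p a b c d e z *
      (theta (a * b) p * theta (a * c) p * theta (a * d) p * theta (a * e) p)
    = - a * theta (a * (a * b * c * d * e)) p *
      (beta_certificate a b c d e z - beta_certificate a b c d e (z / q))"
proof -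
  define A where "A = a * b * c * d * e"
  note P = beta_domain_products[OF dom]
  have nz: "a \<noteq> 0" "b \<noteq> 0" "c \<noteq> 0" "d \<noteq> 0" "e \<noteq> 0" "z \<noteq> 0"
    using beta_domain_nonzero[OF dom] z by auto
  have n: "norm a < 1" "norm b < 1" "norm c < 1" "norm d < 1" "norm e < 1"
    using dom by (auto simp: beta_domain_def)
  have nA: "norm A < 1" "A \<noteq> 0" "norm (p * q) < norm A" "norm p < norm A"
    using P(16) A nz by (auto simp: A_def)
  define th where "th = (\<lambda>x. theta x p)"
  define G where "G = (\<lambda>t. ell_gamma_pm q p t z)"
  define E where "E = theta (inverse (z\<^sup>2)) q"
  have sh: "G (q * t) = th (t * z) * th (t / z) * G t" if "norm t < 1" "t \<noteq> 0" for t
    unfolding G_def th_def using that z q0 by (rule ell_gamma_pm_shift)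
  have h1: "ell_gamma q p (q * t * z) * ell_gamma q p (t * inverse z) = th (t * z) * G t"
    if "norm t < 1" "t \<noteq> 0" for t
    using ell_gamma_shift[OF q p, of "t * z"] that z nz q0
    by (simp add: G_def th_def ell_gamma_pm_def norm_mult mult.assoc)
  have h2: "ell_gamma q p (q * t * (z / q)) * ell_gamma q p (t * inverse (z / q)) = th (t / z) * G t"
    if "norm t < 1" "t \<noteq> 0" for t
    using ell_gamma_shift[OF q p, of "t / z"] that z nz q0
    by (simp add: G_def th_def ell_gamma_pm_def norm_divide field_simps)
  \<comment> \<open>Two q-shifts of theta give z^4 / q; combined with the 1/w of the certificate
    this is the z^3 of the four-term identity.\<close>
  have E2: "theta (inverse ((z / q)\<^sup>2)) q = E * z ^ 4 / q"
  proof -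
    have "inverse ((z / q)\<^sup>2) = q * (q * inverse (z\<^sup>2))"
      using q0 by (simp add: field_simps power2_eq_square)
    then have "theta (inverse ((z / q)\<^sup>2)) q = - inverse (q * inverse (z\<^sup>2)) * (- inverse (inverse (z\<^sup>2)) * E)"
      using theta_shift[OF q, of "q * inverse (z\<^sup>2)"] theta_shift[OF q, of "inverse (z\<^sup>2)"] q0 nz
      by (simp add: E_def)
    also have "\<dots> = E * z ^ 4 / q"
      using q0 nz by (simp add: field_simps power2_eq_square power4_eq_xxxx)
    finally show ?thesis .
  qed
  have c1: "beta_certificate a b c d e z =
     E * ((th (a * z) * th (b * z) * th (c * z) * th (d * z) * th (e * z)) * (G a * G b * G c * G d * G e))
       / (th (A * z) * G A) / z"
    unfolding beta_certificate_def Let_def A_def[symmetric]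
    using h1 n nz nA by (simp add: E_def mult_ac)
  have c2: "beta_certificate a b c d e (z / q) =
     z ^ 3 * E * ((th (a / z) * th (b / z) * th (c / z) * th (d / z) * th (e / z)) * (G a * G b * G c * G d * G e))
       / (th (A / z) * G A)"
    unfolding beta_certificate_def Let_def A_def[symmetric] h2[OF n(1) nz(1)] h2[OF n(2) nz(2)]
      h2[OF n(3) nz(3)] h2[OF n(4) nz(4)] h2[OF n(5) nz(5)] h2[OF nA(1,2)] E2
    using q0 nz by (simp add: field_simps power4_eq_xxxx power3_eq_cube)
  have i1: "beta_integrand q p (q * a) b c d e z = th (z\<^sup>2) * E *
     (th (a * z) * th (a / z) * (G a * G b * G c * G d * G e)) / (th (A * z) * th (A / z) * G A)"
  proof -
    have qA: "q * a * b * c * d * e = q * A" by (simp only: A_def mult_ac)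
    show ?thesis
      unfolding beta_integrand_def beta_weight_def qA
        sh[OF n(1) nz(1), unfolded G_def] sh[OF nA(1,2), unfolded G_def]
      by (simp add: G_def th_def E_def mult_ac)
  qed
  have i2: "beta_integrand q p a b c d e z = th (z\<^sup>2) * E * (G a * G b * G c * G d * G e) / G A"
    by (simp add: beta_integrand_def beta_weight_def G_def th_def E_def A_def)
  have th0: "th x \<noteq> 0" if "norm p < norm x" "norm x < 1" for x
    unfolding th_def using that p by (intro theta_nonzero)
  have "th (b * c) \<noteq> 0"
  proof (rule th0)
    have "A = b * c * (a * d * e)" by (simp add: A_def mult_ac)
    then show "norm p < norm (b * c)"
      using norm_mult_lower[of "norm p" "b * c" "a * d * e"] nA n by (auto intro: norm_mult_less_one)
  qed (use P in auto)
  then have bc: "theta (b * c) p \<noteq> 0" by (simp add: th_def)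
  have Ab: "a * c * d * e = A / b" "a * b * d * e = A / c" "a * b * c * e = A / d" "a * b * c * d = A / e"
    using nz by (simp_all add: A_def)
  have th: "theta x p = th x" for x by (simp add: th_def)
  show ?thesis
    unfolding A_def[symmetric] unfolding i1 i2 c1 c2 Ab th
  proof (rule shift_algebra)
    show "th (A * z) \<noteq> 0" "th (A / z) \<noteq> 0"
      by (rule th0; use nA z in \<open>simp add: norm_mult norm_divide\<close>)+
    show "G A \<noteq> 0" unfolding G_def using nA z by (intro ell_gamma_pm_nonzero)
    show "z \<noteq> 0" by (rule nz)
    show "th (z\<^sup>2) * (th (a * z) * th (a / z) * (th (A / b) * th (A / c) * th (A / d) * th (A / e)) -
        th (A * z) * th (A / z) * (th (a * b) * th (a * c) * th (a * d) * th (a * e))) =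
      - a * th (a * A) * (th (a * z) * th (b * z) * th (c * z) * th (d * z) * th (e * z) * th (A / z) / z -
        z ^ 3 * (th (a / z) * th (b / z) * th (c / z) * th (d / z) * th (e / z)) * th (A * z))"
      unfolding th_def using theta_four_term[OF p nz(6,1,2,3,4,5) A_def bc] .
  qed
qed

text \<open>The certificate is holomorphic on an open set containing 1 \<le> |w| \<le> 1/|q|, so the
  dilation lemma applies. The bound |p| < |A| is used at both rims of that closed annulus, to keep
  the denominator nonzero.\<close>

lemma beta_certificate_integral:
  assumes dom: "beta_domain q p a b c d e" and q0: "q \<noteq> 0" and A: "norm p < norm (a * b * c * d * e)"
  shows "contour_integral (circlepath 0 1) (\<lambda>z. beta_certificate a b c d e (z / q) / z) =
    contour_integral (circlepath 0 1) (\<lambda>z. beta_certificate a b c d e z / z)"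
    and "(\<lambda>z. beta_certificate a b c d e z / z) contour_integrable_on circlepath 0 1"
    and "(\<lambda>z. beta_certificate a b c d e (z / q) / z) contour_integrable_on circlepath 0 1"
proof -
  define M where "M = Max {norm a, norm b, norm c, norm d, norm e}"
  define A where "A = a * b * c * d * e"
  note P = beta_domain_products[OF dom]
  have nz: "a \<noteq> 0" "b \<noteq> 0" "c \<noteq> 0" "d \<noteq> 0" "e \<noteq> 0"
    using beta_domain_nonzero[OF dom] by auto
  have n: "norm a < 1" "norm b < 1" "norm c < 1" "norm d < 1" "norm e < 1"
    using dom by (auto simp: beta_domain_def)
  have nA: "norm A < 1" "A \<noteq> 0" "norm p < norm A"
    using P(16) A nz by (auto simp: A_def)
  have M: "norm a \<le> M" "norm b \<le> M" "norm c \<le> M" "norm d \<le> M" "norm e \<le> M" "M < 1"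
    using n by (auto simp: M_def)
  have M0: "0 < M" using M(1) nz by (meson less_le_trans zero_less_norm_iff)
  have AM: "norm A \<le> M"
  proof -
    have "norm A = norm a * norm (b * c * d * e)" by (simp add: A_def norm_mult)
    also have "\<dots> \<le> norm a" using P(11) by (intro mult_left_le) auto
    finally show ?thesis using M by linarith
  qed
  \<comment> \<open>The first two inequalities put all t / w and q t w inside the unit disc, away
    from poles; the last two keep q A w and A / w above |pq| in modulus, away from zeros.\<close>
  define S where "S = {w :: complex. M < norm w \<and> norm q * M * norm w < 1 \<and> norm p < norm A * norm w \<and>
      norm (p * q) * norm w < norm A}"
  have openS: "open S"
    unfolding S_def by (intro open_Collect_conj open_Collect_less continuous_intros)
  have S0: "w \<noteq> 0" if "w \<in> S" for w :: complex using that M0 by (auto simp: S_def)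
  have St: "norm (q * t * w) < 1" "norm (t * inverse w) < 1" if "w \<in> S" "norm t \<le> M" for t w :: complex
  proof -
    have "norm q * norm t * norm w \<le> norm q * M * norm w"
      using that by (intro mult_right_mono mult_left_mono) auto
    then show "norm (q * t * w) < 1" using that by (simp add: S_def norm_mult)
    have "norm t < norm w" using that by (simp add: S_def)
    then show "norm (t * inverse w) < 1"
      using S0[OF that(1)] by (simp add: divide_inverse[symmetric] norm_divide)
  qed
  define h where "h = (\<lambda>t w. ell_gamma q p (q * t * w) * ell_gamma q p (t * inverse w))"
  have hol: "h t holomorphic_on S" if "norm t \<le> M" "t \<noteq> 0" for t
    unfolding h_def using that S0 St q0 by (intro holomorphic_intros q p) auto
  have den: "h A w \<noteq> 0" if "w \<in> S" for w
    unfolding h_def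
  proof (intro no_zero_divisors ell_gamma_nonzero q p St that AM)
    show "norm (p * q) < norm (q * A * w)"
      using that q0 by (simp add: S_def norm_mult mult.commute mult.left_commute)
    show "norm (p * q) < norm (A * inverse w)"
      using that S0[OF that] by (simp add: S_def norm_mult divide_inverse[symmetric] norm_divide pos_less_divide_eq mult_ac)
  qed
  have hol': "beta_certificate a b c d e holomorphic_on S"
  proof -
    have eq: "beta_certificate a b c d e =
        (\<lambda>w. theta (inverse (w\<^sup>2)) q * (h a w * h b w * h c w * h d w * h e w) / h A w / w)"
      by (simp add: fun_eq_iff beta_certificate_def Let_def h_def A_def)
    have "(\<lambda>w. theta (inverse (w\<^sup>2)) q) holomorphic_on S"
      using S0 by (intro holomorphic_intros q) auto
    then show ?thesis
      unfolding eq using den S0 hol M AM nz nA by (intro holomorphic_on_mult holomorphic_on_divide holomorphic_on_ident)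
  qed
  have sub: "w \<in> S" if "1 \<le> norm w" "norm w \<le> 1 / norm q" for w
  proof -
    have qw: "norm q * norm w \<le> 1" using that(2) q0 by (simp add: field_simps)
    have "norm q * M * norm w = M * (norm q * norm w)" by simp
    also have "\<dots> \<le> M" using M0 qw by (intro mult_left_le) auto
    finally have 1: "norm q * M * norm w < 1" using M by linarith
    have "norm A * 1 \<le> norm A * norm w" using that by (intro mult_left_mono) auto
    then have 2: "norm p < norm A * norm w" using nA by linarith
    have "norm (p * q) * norm w = norm p * (norm q * norm w)" by (simp add: norm_mult)
    also have "\<dots> \<le> norm p" using qw by (intro mult_left_le) auto
    finally show ?thesis using 1 2 nA M that by (simp add: S_def)
  qed
  show "contour_integral (circlepath 0 1) (\<lambda>z. beta_certificate a b c d e (z / q) / z) =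
    contour_integral (circlepath 0 1) (\<lambda>z. beta_certificate a b c d e z / z)"
    by (rule contour_integral_dilation[OF hol' openS q0 q sub])
  have q1: "1 \<le> 1 / norm q" using q q0 by simp
  have c: "continuous_on S (beta_certificate a b c d e)"
    using hol' by (rule holomorphic_on_imp_continuous_on)
  show "(\<lambda>z. beta_certificate a b c d e z / z) contour_integrable_on circlepath 0 1"
    by (intro contour_integrable_continuous_circlepath continuous_intros continuous_on_compose2[OF c])
      (use sub q1 in auto)
  show "(\<lambda>z. beta_certificate a b c d e (z / q) / z) contour_integrable_on circlepath 0 1"
    by (intro contour_integrable_continuous_circlepath continuous_intros continuous_on_compose2[OF c])
      (use sub q1 q0 in \<open>auto simp: norm_divide\<close>)
qed

lemma beta_integrand_continuous:
  assumes "beta_domain q p a b c d e"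
  shows "continuous_on (sphere 0 1) (\<lambda>z. beta_integrand q p a b c d e z / z)"
proof -
  have n: "norm a < 1" "norm b < 1" "norm c < 1" "norm d < 1" "norm e < 1"
    and A: "norm (a * b * c * d * e) < 1" "norm (p * q) < norm (a * b * c * d * e)"
    using assms beta_domain_products(16)[OF assms] by (auto simp: beta_domain_def)
  have z: "norm z = 1 \<and> z \<noteq> 0" if "z \<in> sphere 0 1" for z :: complex
    using that by auto
  show ?thesis
    unfolding beta_integrand_def
    by (intro continuous_intros ell_gamma_pm_nonzero ballI n A; (use z beta_domain_nonzero[OF assms] in simp))
qed

lemma beta_domain_shift:
  assumes "beta_domain q p a b c d e" "q \<noteq> 0" "norm p < norm (a * b * c * d * e)"
  shows "beta_domain q p (q * a) b c d e"
  using assms q norm_mult_less_one[of q a] by (auto simp: beta_domain_def norm_mult mult_ac)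

text \<open>Integrating \<open>beta_integrand_shift\<close> removes the certificate terms, and the
  factors \<open>X\<close>, \<open>Y\<close> that remain are those by which the claimed values
  differ.\<close>

lemma beta_ratio_shift:
  assumes dom: "beta_domain q p a b c d e" and q0: "q \<noteq> 0" and A: "norm p < norm (a * b * c * d * e)"
  shows "beta_ratio q p (q * a) b c d e = beta_ratio q p a b c d e"
proof -
  define X where "X = theta (a * c * d * e) p * theta (a * b * d * e) p * theta (a * b * c * e) p * theta (a * b * c * d) p"
  define Y where "Y = theta (a * b) p * theta (a * c) p * theta (a * d) p * theta (a * e) p"
  note c = beta_certificate_integral[OF assms]
  let ?\<gamma> = "circlepath 0 1 :: real \<Rightarrow> complex"
  have int: "(\<lambda>z. beta_integrand q p a b c d e z / z) contour_integrable_on ?\<gamma>"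
    "(\<lambda>z. beta_integrand q p (q * a) b c d e z / z) contour_integrable_on ?\<gamma>"
    using beta_domain_shift[OF assms] dom
    by (auto intro!: contour_integrable_continuous_circlepath beta_integrand_continuous)
  have "X * beta_integral q p (q * a) b c d e - Y * beta_integral q p a b c d e =
     contour_integral ?\<gamma> (\<lambda>z. X * (beta_integrand q p (q * a) b c d e z / z) -
        Y * (beta_integrand q p a b c d e z / z))"
    unfolding beta_integral_def using int
    by (simp only: contour_integral_diff contour_integral_lmul contour_integrable_lmul)
  also have "\<dots> = contour_integral ?\<gamma> (\<lambda>z. - a * theta (a * (a * b * c * d * e)) p *
      (beta_certificate a b c d e z / z - beta_certificate a b c d e (z / q) / z))"
  proof (rule contour_integral_cong)
    fix z assume "z \<in> path_image ?\<gamma>"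
    then have "norm z = 1" by simp
    then show "X * (beta_integrand q p (q * a) b c d e z / z) - Y * (beta_integrand q p a b c d e z / z) =
        - a * theta (a * (a * b * c * d * e)) p *
      (beta_certificate a b c d e z / z - beta_certificate a b c d e (z / q) / z)"
      using arg_cong[OF beta_integrand_shift[OF assms], of z "\<lambda>w. w / z"]
      by (simp add: X_def Y_def diff_divide_distrib right_diff_distrib mult_ac)
  qed simp
  also have "\<dots> = 0"
    using c by (simp only: contour_integral_lmul contour_integrable_diff contour_integral_diff) simp
  finally have "X * beta_integral q p (q * a) b c d e = Y * beta_integral q p a b c d e" by simp
  moreover have "beta_value q p (q * a) b c d e * X = beta_value q p a b c d e * Y"
    unfolding X_def Y_def by (rule beta_value_shift[OF assms])
  moreover have "beta_value q p (q * a) b c d e \<noteq> 0" "beta_value q p a b c d e \<noteq> 0"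
    using beta_value_nonzero dom beta_domain_shift[OF assms] by auto
  moreover have "X \<noteq> 0"
    unfolding X_def using theta_triples_nonzero[OF dom A] by simp
  ultimately show ?thesis
    unfolding beta_ratio_def
    by (metis mult.commute mult_divide_mult_cancel_left mult_eq_0_iff)
qed

end

section \<open>Independence of the ratio from all five parameters\<close>

lemma power_gap:
  fixes x :: real
  assumes "0 \<le> x" "x < 1" "0 < n"
  obtains r where "x < r ^ n" "0 < r" "r < 1"
proof -
  have m: "0 \<le> root n x" "root n x < 1" "root n x ^ n = x"
    using assms by auto
  obtain r where "root n x < r" "r < 1" using dense[OF m(2)] by auto
  then have "root n x ^ n < r ^ n" using m assms by (intro power_strict_mono) auto
  then show ?thesis using that[of r] m \<open>root n x < r\<close> \<open>r < 1\<close> by auto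
qed

lemma annulus_iff_beta_domain:
  assumes "norm b < 1" "norm c < 1" "norm d < 1" "norm e < 1" "b * c * d * e \<noteq> 0"
  shows "a \<in> annulus (norm (p * q) / norm (b * c * d * e)) 1 \<longleftrightarrow> beta_domain q p a b c d e"
  using assms by (auto simp: annulus_def beta_domain_def norm_mult field_simps)

context
  fixes q p :: complex
  assumes q: "norm q < 1" and p: "norm p < 1"
begin

lemma ell_gamma_pm_holomorphic:
  assumes "f holomorphic_on S" "norm z = 1"
    and "\<And>x. x \<in> S \<Longrightarrow> norm (f x) < 1" "\<And>x. x \<in> S \<Longrightarrow> f x \<noteq> 0"
  shows "(\<lambda>x. ell_gamma_pm q p (f x) z) holomorphic_on S"
proof -
  have "z \<noteq> 0" using assms(2) by auto
  then show ?thesis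
    unfolding ell_gamma_pm_def using assms
    by (intro holomorphic_intros q p) (auto simp: norm_mult norm_inverse)
qed

lemma ell_gamma_holomorphic_domain:
  assumes "f holomorphic_on S" "\<And>x. x \<in> S \<Longrightarrow> f x \<in> {z. norm (p * q) < norm z \<and> norm z < 1}"
  shows "(\<lambda>x. ell_gamma q p (f x)) holomorphic_on S"
proof (rule ell_gamma_holomorphic[OF q p assms(1)])
  fix x assume "x \<in> S"
  then show "norm (f x) < 1" "f x \<noteq> 0"
    using assms(2)[of x] not_less[of "norm (p * q)" 0] by auto
qed

lemma beta_value_holomorphic:
  assumes "\<And>a. a \<in> S \<Longrightarrow> beta_domain q p a b c d e"
  shows "(\<lambda>a. beta_value q p a b c d e) holomorphic_on S"
proof -
  note P = beta_domain_products[OF assms]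
  have "ell_gamma q p (b * c * d * e) * ell_gamma q p (a * c * d * e) * ell_gamma q p (a * b * d * e) *
      ell_gamma q p (a * b * c * e) * ell_gamma q p (a * b * c * d) \<noteq> 0" if "a \<in> S" for a
    using P[OF that] by (simp add: ell_gamma_nonzero q p)
  moreover have "(\<lambda>a. ell_gamma q p (a * b)) holomorphic_on S" "(\<lambda>a. ell_gamma q p (a * c)) holomorphic_on S"
    "(\<lambda>a. ell_gamma q p (a * d)) holomorphic_on S" "(\<lambda>a. ell_gamma q p (a * e)) holomorphic_on S"
    "(\<lambda>a. ell_gamma q p (a * c * d * e)) holomorphic_on S" "(\<lambda>a. ell_gamma q p (a * b * d * e)) holomorphic_on S"
    "(\<lambda>a. ell_gamma q p (a * b * c * e)) holomorphic_on S" "(\<lambda>a. ell_gamma q p (a * b * c * d)) holomorphic_on S"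
    by (rule ell_gamma_holomorphic_domain; (intro holomorphic_intros | rule P; assumption))+
  ultimately show ?thesis
    unfolding beta_value_def
    by (intro holomorphic_on_divide holomorphic_on_mult holomorphic_on_const)
qed

lemma beta_integral_holomorphic:
  assumes "open S" and dom: "\<And>a. a \<in> S \<Longrightarrow> beta_domain q p a b c d e"
  shows "(\<lambda>a. beta_integral q p a b c d e) holomorphic_on S"
proof (cases "S = {}")
  case False
  then obtain a0 where "a0 \<in> S" by blast
  then have n: "norm b < 1" "norm c < 1" "norm d < 1" "norm e < 1"
    and nz: "b \<noteq> 0" "c \<noteq> 0" "d \<noteq> 0" "e \<noteq> 0"
    using dom[of a0] beta_domain_nonzero[OF dom, of a0] by (auto simp: beta_domain_def)
  have na: "norm a < 1" "a \<noteq> 0" if "a \<in> S" for a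
    using dom[OF that] beta_domain_nonzero[OF dom[OF that]] by (auto simp: beta_domain_def)
  have nA: "norm (a * b * c * d * e) < 1" "norm (p * q) < norm (a * b * c * d * e)" "a * b * c * d * e \<noteq> 0"
    if "a \<in> S" for a
    using beta_domain_products(16)[OF dom[OF that]] beta_domain_nonzero[OF dom[OF that]] by auto
  note den = ell_gamma_pm_nonzero[OF q p nA(1,2)]
  show ?thesis
    unfolding beta_integral_def
  proof (rule holomorphic_on_contour_integral_param[OF \<open>open S\<close>])
    have z: "norm (snd x) = 1" "snd x \<noteq> 0" "fst x \<in> S" if "x \<in> S \<times> sphere 0 1" for x :: "complex \<times> complex"
      using that by auto
    have cont: "continuous_on (S \<times> sphere 0 1) (\<lambda>x. ell_gamma_pm q p t (snd x))"
      if "norm t < 1" "t \<noteq> 0" for t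
      using that z by (intro ell_gamma_pm_continuous[OF q p] continuous_intros)
    have "continuous_on (S \<times> sphere 0 1) (\<lambda>x. ell_gamma_pm q p (fst x) (snd x))"
      using na z by (intro ell_gamma_pm_continuous[OF q p] continuous_intros) auto
    moreover have "continuous_on (S \<times> sphere 0 1) (\<lambda>x. ell_gamma_pm q p (fst x * b * c * d * e) (snd x))"
      by (intro ell_gamma_pm_continuous[OF q p] continuous_intros nA z)
    moreover have "continuous_on (S \<times> sphere 0 1) (\<lambda>x. beta_weight q p (snd x))"
      using z by (intro beta_weight_continuous[OF q p] continuous_intros)
    moreover have "\<forall>x\<in>S \<times> sphere 0 1. ell_gamma_pm q p (fst x * b * c * d * e) (snd x) \<noteq> 0"
      using den z by blast
    moreover have "\<forall>x\<in>S \<times> sphere 0 1. snd x \<noteq> (0::complex)"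
      using z by blast
    ultimately show "continuous_on (S \<times> sphere 0 1) (\<lambda>(a, z). beta_integrand q p a b c d e z / z)"
      unfolding beta_integrand_def case_prod_unfold
      by (intro continuous_on_divide continuous_on_mult continuous_on_snd continuous_on_id cont n nz)
    fix z :: complex assume z: "norm z = 1"
    then have "z \<noteq> 0" by auto
    have "(\<lambda>a. ell_gamma_pm q p a z) holomorphic_on S"
      using na z by (intro ell_gamma_pm_holomorphic holomorphic_intros)
    moreover have "(\<lambda>a. ell_gamma_pm q p (a * b * c * d * e) z) holomorphic_on S"
      using nA z by (intro ell_gamma_pm_holomorphic holomorphic_intros)
    ultimately show "(\<lambda>a. beta_integrand q p a b c d e z / z) holomorphic_on S"
      unfolding beta_integrand_def using den z \<open>z \<noteq> 0\<close>
      by (intro holomorphic_on_divide holomorphic_on_mult holomorphic_on_const)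
  qed
qed (simp add: holomorphic_on_def)

lemma beta_ratio_holomorphic:
  assumes "norm b < 1" "norm c < 1" "norm d < 1" "norm e < 1" "b * c * d * e \<noteq> 0"
  shows "(\<lambda>a. beta_ratio q p a b c d e) holomorphic_on annulus (norm (p * q) / norm (b * c * d * e)) 1"
  unfolding beta_ratio_def
  by (intro holomorphic_on_divide beta_integral_holomorphic beta_value_holomorphic open_annulus
      beta_value_nonzero[OF q p]) (use annulus_iff_beta_domain[OF assms] in auto)

text \<open>The inner radius is |pq| / |bcde|, so \<open>wide\<close> states that it is below |q|:
  the annulus of admissible \<open>a\<close> exceeds one period.\<close>

lemma beta_ratio_const_first:
  assumes q0: "q \<noteq> 0" and n: "norm b < 1" "norm c < 1" "norm d < 1" "norm e < 1"
    and wide: "norm p < norm (b * c * d * e)"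
    and dom: "beta_domain q p a b c d e" "beta_domain q p a' b c d e"
  shows "beta_ratio q p a b c d e = beta_ratio q p a' b c d e"
proof -
  have nz: "b * c * d * e \<noteq> 0" using wide not_less[of "norm p" 0] by auto
  note iff = annulus_iff_beta_domain[OF n nz]
  have "(\<lambda>a. beta_ratio q p a b c d e) constant_on annulus (norm (p * q) / norm (b * c * d * e)) 1"
  proof (rule multiplicatively_periodic_constant[where q = q])
    show "norm (p * q) / norm (b * c * d * e) < norm q * 1"
      using wide q0 nz by (simp add: norm_mult field_simps)
    fix x :: complex
    assume x: "norm (p * q) / norm (b * c * d * e) < norm (q * x)" "norm x < 1"
    have "norm q * norm x \<le> norm x" using q by (intro mult_left_le_one_le) auto
    then have "norm (p * q) / norm (b * c * d * e) < norm x" using x(1) by (simp add: norm_mult)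
    then have "beta_domain q p x b c d e" using iff[of x] x(2) by (simp add: annulus_def)
    \<comment> \<open>The lower bound on \<open>q * x\<close>, stronger than that on
      \<open>x\<close>, yields the hypothesis |p| < |A| of \<open>beta_ratio_shift\<close>.\<close>
    moreover have "norm p < norm (x * b * c * d * e)"
    proof -
      have "norm q * norm p < norm q * (norm (x * b * c * d * e))"
        using x(1) nz by (simp add: norm_mult field_simps)
      then show ?thesis using q0 by simp
    qed
    ultimately show "beta_ratio q p (q * x) b c d e = beta_ratio q p x b c d e"
      using q0 by (intro beta_ratio_shift[OF q p])
  qed (use q q0 n nz beta_ratio_holomorphic in auto)
  then show ?thesis
    using dom iff by (auto simp: constant_on_def)
qed

text \<open>With all moduli above \<open>r\<close> and r^5 > |p|, the width condition persists while
  the parameters are replaced by \<open>x0\<close> one after another.\<close>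

lemma beta_ratio_const_near_boundary:
  assumes q0: "q \<noteq> 0" and r: "norm p < r ^ 5" "0 < r"
    and t: "\<And>x. x \<in> {a, b, c, d, e, x0} \<Longrightarrow> x \<in> annulus r 1"
  shows "beta_ratio q p a b c d e = beta_ratio q p x0 x0 x0 x0 x0"
proof -
  have step: "beta_ratio q p a b c d e = beta_ratio q p b c d e x0"
    if t: "\<And>x. x \<in> {a, b, c, d, e} \<Longrightarrow> x \<in> annulus r 1" for a b c d e
  proof -
    have n: "r < norm x" "norm x < 1" if "x \<in> {a, b, c, d, e, x0}" for x
      using t assms(4) that unfolding annulus_def by blast+
    have "r * r * r * r < norm b * norm c * norm d * norm e"
      using n r by (intro mult_strict_mono') auto
    then have 4: "r * r * r * r < norm (b * c * d * e)" by (simp only: norm_mult)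
    have low: "norm p < norm (y * b * c * d * e)" if "y \<in> {a, x0}" for y
    proof -
      have "norm p < r * (r * r * r * r)" using r by (simp add: eval_nat_numeral)
      also have "\<dots> < norm y * norm (b * c * d * e)"
        using 4 n[of y] that r by (intro mult_strict_mono') auto
      finally show ?thesis by (simp add: norm_mult mult_ac)
    qed
    have "norm (p * q) \<le> norm p" using q by (simp add: norm_mult mult_left_le)
    then have "beta_domain q p a b c d e" "beta_domain q p x0 b c d e"
      using low[of a] low[of x0] n by (auto simp: beta_domain_def)
    moreover have "norm p < norm (b * c * d * e)"
      using low[of a] norm_mult_lower[of "norm p" "b * c * d * e" a] n by (simp add: mult_ac)
    ultimately have "beta_ratio q p a b c d e = beta_ratio q p x0 b c d e"
      using n q0 by (intro beta_ratio_const_first) auto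
    \<comment> \<open>Rotating the new \<open>x0\<close> to the end brings the next parameter into
      first place, so five equal steps suffice.\<close>
    then show ?thesis by (simp add: beta_ratio_rotate[of q p x0])
  qed
  have "beta_ratio q p a b c d e = beta_ratio q p b c d e x0" by (rule step) (use t in auto)
  also have "\<dots> = beta_ratio q p c d e x0 x0" by (rule step) (use t in auto)
  also have "\<dots> = beta_ratio q p d e x0 x0 x0" by (rule step) (use t in auto)
  also have "\<dots> = beta_ratio q p e x0 x0 x0 x0" by (rule step) (use t in auto)
  also have "\<dots> = beta_ratio q p x0 x0 x0 x0 x0" by (rule step) (use t in auto)
  finally show ?thesis .
qed

text \<open>The ratio is holomorphic on the whole annulus of admissible first parameters; knowing it
  for moduli above \<open>r\<close> determines it everywhere.\<close>

lemma beta_ratio_continuation: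
  assumes dom: "beta_domain q p a b c d e" and "r < 1"
    and eq: "\<And>x. r < norm x \<Longrightarrow> norm x < 1 \<Longrightarrow> beta_domain q p x b c d e \<Longrightarrow> beta_ratio q p x b c d e = C"
  shows "beta_ratio q p a b c d e = C"
proof -
  have n: "norm b < 1" "norm c < 1" "norm d < 1" "norm e < 1" "b * c * d * e \<noteq> 0"
    using dom beta_domain_nonzero[OF dom] by (auto simp: beta_domain_def)
  define r1 where "r1 = norm (p * q) / norm (b * c * d * e)"
  note iff = annulus_iff_beta_domain[OF n, where p = p and q = q, folded r1_def]
  have "0 \<le> r1" by (simp add: r1_def)
  have "r1 < 1" using dom iff[of a] by (auto simp: annulus_def)
  then obtain y where y: "max r r1 < y" "y < 1" using dense[of "max r r1" 1] \<open>r < 1\<close> by auto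
  have "of_real y \<in> annulus (max r r1) 1" using y \<open>0 \<le> r1\<close> by (auto simp: annulus_def)
  show ?thesis
  proof (rule analytic_continuation_open[where s = "annulus (max r r1) 1" and s' = "annulus r1 1"
        and f = "\<lambda>a. beta_ratio q p a b c d e" and g = "\<lambda>_. C"])
    show "annulus (max r r1) 1 \<noteq> {}" using \<open>of_real y \<in> _\<close> by blast
    show "(\<lambda>a. beta_ratio q p a b c d e) holomorphic_on annulus r1 1"
      unfolding r1_def by (rule beta_ratio_holomorphic[OF n])
    show "annulus (max r r1) 1 \<subseteq> annulus r1 1" by (auto simp: annulus_def)
    show "a \<in> annulus r1 1" using dom iff by blast
    show "beta_ratio q p z b c d e = C" if "z \<in> annulus (max r r1) 1" for z
      by (rule eq) (use that iff[of z] in \<open>auto simp: annulus_def\<close>)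
  qed (auto simp: open_annulus connected_annulus_complex)
qed

lemma beta_ratio_const:
  assumes q0: "q \<noteq> 0" and dom: "beta_domain q p a b c d e" "beta_domain q p a' b' c' d' e'"
  shows "beta_ratio q p a b c d e = beta_ratio q p a' b' c' d' e'"
proof -
  \<comment> \<open>The fifth power accounts for five parameters, each of modulus above
    \<open>r\<close>.\<close>
  obtain r where r: "norm p < r ^ 5" "0 < r" "r < 1"
    using power_gap[of "norm p" 5] p by auto
  obtain y where y: "r < y" "y < 1" using dense[OF r(3)] by auto
  define x0 where "x0 = complex_of_real y"
  have x0: "x0 \<in> annulus r 1" using y r by (simp add: x0_def annulus_def)
  define C where "C = beta_ratio q p x0 x0 x0 x0 x0"
  have all: "beta_ratio q p a b c d e = C" if dom: "beta_domain q p a b c d e" for a b c d e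
  proof -
    \<comment> \<open>From here on the lower bound is dropped for one more parameter at a time: the
      tuple is rotated so that this parameter comes first, and the continuation uses the preceding
      statement.\<close>
    have 0: "beta_ratio q p a b c d e = C"
      if "r < norm a" "r < norm b" "r < norm c" "r < norm d" "r < norm e" "beta_domain q p a b c d e"
      for a b c d e
      unfolding C_def
      by (rule beta_ratio_const_near_boundary[OF q0 r(1,2)])
        (use that x0 in \<open>auto simp: annulus_def beta_domain_def\<close>)
    have 1: "beta_ratio q p a b c d e = C"
      if "r < norm b" "r < norm c" "r < norm d" "r < norm e" "beta_domain q p a b c d e" for a b c d e
      by (rule beta_ratio_continuation[OF that(5) r(3)]) (rule 0; use that in blast)
    have R2: "beta_ratio q p a b c d e = beta_ratio q p c d e a b"
      "beta_domain q p a b c d e = beta_domain q p c d e a b" for a b c d e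
      by (simp_all only: beta_ratio_rotate[of q p a b] beta_ratio_rotate[of q p b c]
          beta_domain_rotate[of q p a b] beta_domain_rotate[of q p b c])
    have R3: "beta_ratio q p a b c d e = beta_ratio q p d e a b c"
      "beta_domain q p a b c d e = beta_domain q p d e a b c" for a b c d e
      by (simp_all only: R2[of a b] beta_ratio_rotate[of q p c d] beta_domain_rotate[of q p c d])
    have R4: "beta_ratio q p a b c d e = beta_ratio q p e a b c d"
      "beta_domain q p a b c d e = beta_domain q p e a b c d" for a b c d e
      by (simp_all only: beta_ratio_rotate[of q p e a] beta_domain_rotate[of q p e a])
    have 2: "beta_ratio q p a b c d e = C"
      if "r < norm c" "r < norm d" "r < norm e" "beta_domain q p a b c d e" for a b c d e
    proof -
      have "beta_ratio q p b c d e a = C"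
      proof (rule beta_ratio_continuation[OF _ r(3)])
        show "beta_domain q p b c d e a" using that(4) by (simp only: beta_domain_rotate[of q p a b])
        show "beta_ratio q p x c d e a = C" if x: "r < norm x" "beta_domain q p x c d e a" for x
          using 1[of x c d e a] that \<open>r < norm c\<close> \<open>r < norm d\<close> \<open>r < norm e\<close>
          by (simp only: beta_ratio_rotate[of q p a x] beta_domain_rotate[of q p a x])
      qed
      then show ?thesis by (simp only: beta_ratio_rotate[of q p a b])
    qed
    have 3: "beta_ratio q p a b c d e = C"
      if "r < norm d" "r < norm e" "beta_domain q p a b c d e" for a b c d e
    proof -
      have "beta_ratio q p c d e a b = C"
      proof (rule beta_ratio_continuation[OF _ r(3)])
        show "beta_domain q p c d e a b" using that(3) by (simp only: R2[of a b])
        show "beta_ratio q p x d e a b = C" if x: "r < norm x" "beta_domain q p x d e a b" for x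
          using 2[of x d e a b] that \<open>r < norm d\<close> \<open>r < norm e\<close> by (simp only: R2[of a b x])
      qed
      then show ?thesis by (simp only: R2[of a b])
    qed
    have 4: "beta_ratio q p a b c d e = C"
      if "r < norm e" "beta_domain q p a b c d e" for a b c d e
    proof -
      have "beta_ratio q p d e a b c = C"
      proof (rule beta_ratio_continuation[OF _ r(3)])
        show "beta_domain q p d e a b c" using that(2) by (simp only: R3[of a b])
        show "beta_ratio q p x e a b c = C" if x: "r < norm x" "beta_domain q p x e a b c" for x
          using 3[of x e a b c] that \<open>r < norm e\<close> by (simp only: R3[of a b c x])
      qed
      then show ?thesis by (simp only: R3[of a b])
    qed
    have "beta_ratio q p e a b c d = C"
    proof (rule beta_ratio_continuation[OF _ r(3)])
      show "beta_domain q p e a b c d" using dom by (simp only: R4[of a b])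
      show "beta_ratio q p x a b c d = C" if x: "r < norm x" "beta_domain q p x a b c d" for x
        using 4[of x a b c d] that by (simp only: R4[of a b c d x])
    qed
    then show ?thesis by (simp only: R4[of a b])
  qed
  show ?thesis using all[OF dom(1)] all[OF dom(2)] by simp
qed

end

section \<open>The Poisson kernel\<close>

text \<open>The Poisson kernel of radius \<open>s\<close> in the variable \<open>z\<^sup>2\<close>, with its mass concentrating
  at \<open>z\<^sup>2 = -1\<close> as \<open>s\<close> tends to \<open>1\<close>.\<close>

definition poisson :: "real \<Rightarrow> complex \<Rightarrow> real" where
  "poisson s z = (1 - s\<^sup>2) / (norm (1 + of_real s * z\<^sup>2))\<^sup>2"

lemma circle_integral:
  "contour_integral (circlepath 0 1) (\<lambda>z. f z / z) =
     2 * of_real pi * \<i> * integral {0..1} (\<lambda>t. f (circlepath 0 1 t))"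
proof -
  have "f (circlepath 0 1 t) / circlepath 0 1 t * vector_derivative (circlepath 0 1) (at t) =
      2 * of_real pi * \<i> * f (circlepath 0 1 t)" for t
    by (simp add: vector_derivative_circlepath) (simp add: circlepath)
  then show ?thesis
    by (simp add: contour_integral_integral)
qed

lemma poisson_denominator_nonzero:
  assumes "0 \<le> s" "s < 1" "norm z \<le> 1"
  shows "1 + of_real s * (z::complex)\<^sup>2 \<noteq> 0"
proof
  assume "1 + of_real s * z\<^sup>2 = 0"
  then have "of_real s * z\<^sup>2 = -1" by (simp add: add_eq_0_iff)
  then have "norm (of_real s * z\<^sup>2) = 1" by simp
  then have "s * norm z ^ 2 = 1" using assms by (simp add: norm_mult norm_power)
  moreover have "s * norm z ^ 2 \<le> s" using assms by (intro mult_left_le power_le_one) auto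
  ultimately show False using assms by simp
qed

text \<open>On the circle conjugation is inversion. The resulting rational form is the one produced
  by the four pinching gamma factors.\<close>

lemma poisson_eq:
  assumes "norm z = 1"
  shows "complex_of_real (poisson s z) = (1 - of_real (s\<^sup>2)) / ((1 + of_real s * z\<^sup>2) * (1 + of_real s * inverse (z\<^sup>2)))"
proof -
  have "cnj z * z = 1" using assms complex_norm_square[of z] by (simp add: mult.commute)
  then have "cnj z = inverse z" by (metis inverse_unique mult.commute)
  then have "cnj (1 + of_real s * z\<^sup>2) = 1 + of_real s * inverse (z\<^sup>2)"
    by (simp add: power_inverse)
  then show ?thesis
    using complex_norm_square[of "1 + of_real s * z\<^sup>2"] by (simp add: poisson_def)
qed

lemma poisson_continuous:
  assumes "0 \<le> s" "s < 1"
  shows "continuous_on (sphere 0 1) (poisson s)"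
  unfolding poisson_def using poisson_denominator_nonzero[OF assms]
  by (intro continuous_intros) auto

text \<open>Partial fractions: the kernel divided by z is 1/(z (1 + s z^2)) - 1/z + z/(z^2 + s). The
  last term has poles at the two square roots of -s, inside the circle and with residue 1/2 each, so
  the residues sum to 1 - 1 + 1/2 + 1/2.\<close>

lemma integral_poisson:
  assumes s: "0 \<le> s" "s < 1"
  shows "integral {0..1} (\<lambda>t. complex_of_real (poisson s (circlepath 0 1 t))) = 1"
proof -
  define r where "r = \<i> * of_real (sqrt s)"
  have r2: "r * r = - of_real s"
    using s by (simp add: r_def mult.assoc mult.left_commute[of "of_real (sqrt s)"] flip: of_real_mult)
  have nr: "norm r < 1" using s by (simp add: r_def norm_mult)
  let ?c = "2 * of_real pi * \<i>"
  have "((\<lambda>u. (1 / (1 + of_real s * u\<^sup>2)) / (u - 0)) has_contour_integral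
      ?c * (1 / (1 + of_real s * 0\<^sup>2))) (circlepath 0 1)"
    by (rule Cauchy_integral_circlepath_simple)
      (use poisson_denominator_nonzero[OF s] in \<open>auto intro!: holomorphic_intros\<close>)
  then have 1: "((\<lambda>u. (1 / (1 + of_real s * u\<^sup>2)) / u) has_contour_integral ?c) (circlepath 0 1)"
    by simp
  have inv: "((\<lambda>u. w / (u - v)) has_contour_integral ?c * w) (circlepath 0 1)" if "norm v < 1" for v w
    using Cauchy_integral_circlepath_simple[of "\<lambda>_. w" 0 1 v] that by simp
  have "((\<lambda>u. (1 / (1 + of_real s * u\<^sup>2)) / u - 1 / (u - 0) + (1 / 2) / (u - r) + (1 / 2) / (u - (- r)))
      has_contour_integral ?c - ?c * 1 + ?c * (1 / 2) + ?c * (1 / 2)) (circlepath 0 1)"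
    by (intro has_contour_integral_add has_contour_integral_diff 1 inv) (use nr in auto)
  then have "((\<lambda>u. complex_of_real (poisson s u) / u) has_contour_integral
      ?c - ?c * 1 + ?c * (1 / 2) + ?c * (1 / 2)) (circlepath 0 1)"
  proof (rule has_contour_integral_eq)
    fix z :: complex assume "z \<in> path_image (circlepath 0 1)"
    then have z: "norm z = 1" by simp
    then have z0: "z \<noteq> 0" by auto
    have d1: "1 + of_real s * z\<^sup>2 \<noteq> 0" by (rule poisson_denominator_nonzero) (use s z in auto)
    have d2: "1 + of_real s * inverse (z\<^sup>2) \<noteq> 0"
      using poisson_denominator_nonzero[OF s, of "inverse z"] z by (simp add: power_inverse norm_inverse)
    then have d3: "z\<^sup>2 + of_real s \<noteq> 0" using z0 by (auto simp: field_simps)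
    have f: "(z - r) * (z - (- r)) = z\<^sup>2 + of_real s" using r2 by (simp add: algebra_simps power2_eq_square)
    then have d4: "z - r \<noteq> 0" "z - (- r) \<noteq> 0" using d3 by auto
    have "(1 / 2) / (z - r) + (1 / 2) / (z - (- r)) = z / ((z - r) * (z - (- r)))"
    proof -
      have "(1 / 2) / x + (1 / 2) / y = ((x + y) / 2) / (x * y)" if "x \<noteq> 0" "y \<noteq> 0" for x y :: complex
        using that by (simp add: field_simps)
      from this[OF d4] show ?thesis by simp
    qed
    then have "(1 / (1 + of_real s * z\<^sup>2)) / z - 1 / (z - 0) + (1 / 2) / (z - r) + (1 / 2) / (z - (- r))
        = (1 / (1 + of_real s * z\<^sup>2)) / z - 1 / z + z / (z\<^sup>2 + of_real s)"
      unfolding f by simp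
    also have "\<dots> = (1 - of_real (s\<^sup>2)) / ((1 + of_real s * z\<^sup>2) * (1 + of_real s * inverse (z\<^sup>2))) / z"
      using d1 d2 d3 z0 by (simp add: divide_simps) (simp add: algebra_simps power2_eq_square)
    finally show "(1 / (1 + of_real s * z\<^sup>2)) / z - 1 / (z - 0) + (1 / 2) / (z - r) + (1 / 2) / (z - (- r))
        = complex_of_real (poisson s z) / z"
      by (simp only: poisson_eq[OF z])
  qed
  then have "contour_integral (circlepath 0 1) (\<lambda>u. complex_of_real (poisson s u) / u) = ?c * 1"
    by (simp only: contour_integral_unique) simp
  then have "?c * integral {0..1} (\<lambda>t. complex_of_real (poisson s (circlepath 0 1 t))) = ?c * 1"
    by (simp only: circle_integral)
  then show ?thesis by (simp only: mult_cancel_left) simp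
qed

lemma circlepath_continuous: "continuous_on A (circlepath z r)"
  unfolding circlepath by (intro continuous_intros)

lemma continuous_on_circle_compose:
  assumes "continuous_on (sphere 0 1) f"
  shows "continuous_on {0..1} (\<lambda>t. f (circlepath 0 1 t))"
  by (rule continuous_on_compose2[OF assms circlepath_continuous]) (auto simp: circlepath norm_mult)

text \<open>The kernel is an approximate identity in z^2, so its mass gathers at both i and -i;
  \<open>sym\<close> makes the two contributions agree. Since \<open>H\<close> varies with
  \<open>s\<close> too, joint continuity is required.\<close>

lemma poisson_limit:
  fixes H :: "real \<Rightarrow> complex \<Rightarrow> complex"
  assumes s0: "0 \<le> s0" "s0 < 1"
    and cont: "continuous_on ({s0..1} \<times> sphere 0 1) (\<lambda>(s, z). H s z)"
    and sym: "H 1 (- \<i>) = H 1 \<i>"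
  shows "((\<lambda>s. integral {0..1} (\<lambda>t. H s (circlepath 0 1 t) * of_real (poisson s (circlepath 0 1 t))))
      \<longlongrightarrow> H 1 \<i>) (at_left 1)"
proof (rule tendstoI)
  fix \<epsilon>' :: real assume "0 < \<epsilon>'"
  define \<epsilon> where "\<epsilon> = \<epsilon>' / 2"
  have \<epsilon>: "0 < \<epsilon>" using \<open>0 < \<epsilon>'\<close> by (simp add: \<epsilon>_def)
  define K where "K = {s0..1} \<times> sphere (0::complex) 1"
  define h where "h = H 1 \<i>"
  have contH: "continuous_on K (\<lambda>x. H (fst x) (snd x))"
    using cont by (simp add: K_def case_prod_unfold)
  have "compact ((\<lambda>x. H (fst x) (snd x) - h) ` K)"
    by (intro compact_continuous_image continuous_intros contH) (simp add: K_def compact_Times)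
  then obtain M where M0: "0 < M" "\<forall>y\<in>(\<lambda>x. H (fst x) (snd x) - h) ` K. norm y \<le> M"
    using bounded_pos compact_imp_bounded by metis
  have M: "0 < M" "norm (H s z - h) \<le> M" if "(s, z) \<in> K" for s z
    using M0 bspec[OF M0(2) imageI[OF that]] by simp_all
  have "\<exists>\<eta>>0. \<forall>x\<in>K. dist x (1, w) < \<eta> \<longrightarrow> dist (H (fst x) (snd x)) h < \<epsilon>" if "w \<in> {\<i>, - \<i>}" for w
  proof -
    have "(1, w) \<in> K" "H 1 w = h" using that s0 sym by (auto simp: K_def h_def)
    then show ?thesis
      using contH[unfolded continuous_on_iff, rule_format, of "(1, w)" \<epsilon>] \<epsilon> by (simp only: fst_conv snd_conv)
  qed
  then obtain \<eta>1 \<eta>2 where \<eta>12: "0 < \<eta>1" "0 < \<eta>2"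
    "\<And>x. x \<in> K \<Longrightarrow> dist x (1, \<i>) < \<eta>1 \<Longrightarrow> dist (H (fst x) (snd x)) h < \<epsilon>"
    "\<And>x. x \<in> K \<Longrightarrow> dist x (1, - \<i>) < \<eta>2 \<Longrightarrow> dist (H (fst x) (snd x)) h < \<epsilon>"
    by (metis insertI1 insertI2)
  define \<eta> where "\<eta> = min \<eta>1 \<eta>2"
  have \<eta>: "0 < \<eta>" using \<eta>12 by (simp add: \<eta>_def)
  have near: "norm (H s z - h) < \<epsilon>"
    if "(s, z) \<in> K" "\<bar>s - 1\<bar> < \<eta> / 2" "norm (z - w) < \<eta> / 2" "w \<in> {\<i>, - \<i>}" for s z w
  proof -
    have "dist (s, z) (1, w) \<le> \<bar>s - 1\<bar> + norm (z - w)"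
      using sqrt_sum_squares_le_sum[of "\<bar>s - 1\<bar>" "norm (z - w)"]
      unfolding dist_Pair_Pair unfolding dist_norm real_norm_def by simp
    then have "dist (s, z) (1, w) < \<eta>" using that by linarith
    then have "dist (s, z) (1, w) < \<eta>1" "dist (s, z) (1, w) < \<eta>2" by (simp_all add: \<eta>_def)
    then have "dist (H s z) h < \<epsilon>"
      using \<eta>12(3,4)[OF that(1), unfolded fst_conv snd_conv] that(4) by blast
    then show ?thesis by (simp only: dist_norm)
  qed
  \<comment> \<open>As |1 + z^2| = |z - i| |z + i|, a value below (\<eta>/2)^2 forces
    \<open>z\<close> within \<eta>/2 of i or of -i.\<close>
  define \<delta> where "\<delta> = min (\<eta> / 2) ((\<eta> / 2)\<^sup>2)"
  have \<delta>: "0 < \<delta>" "\<delta> \<le> \<eta> / 2" "\<delta> \<le> (\<eta> / 2)\<^sup>2" using \<eta> by (auto simp: \<delta>_def)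
  \<comment> \<open>Beyond \<open>b\<close>, 1 - s is below \<delta>/2, so |1 + s z^2| \<ge>
    \<delta>/2 away from the two points; the last entry pushes the tail 8 M (1 - s) / \<delta>^2
    below \<epsilon>.\<close>
  define b where "b = max s0 (max (1 - \<delta> / 2) (1 - \<epsilon> * \<delta>\<^sup>2 / (8 * M)))"
  have "b < 1" using s0 \<delta> M0(1) \<epsilon> by (auto simp: b_def)
  have "norm (integral {0..1} (\<lambda>t. H s (circlepath 0 1 t) * of_real (poisson s (circlepath 0 1 t))) - h) < \<epsilon>'"
    if s: "b < s" "s < 1" for s
  proof -
    have sb: "s0 < s" "1 - s < \<delta> / 2" "1 - s < \<epsilon> * \<delta>\<^sup>2 / (8 * M)" "0 \<le> s"
      using s s0 by (auto simp: b_def)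
    have P0: "0 \<le> poisson s z" for z
      using sb s by (simp add: poisson_def power_le_one)
    define e where "e = M * ((1 - s\<^sup>2) / (\<delta> / 2)\<^sup>2)"
    have "1 - s\<^sup>2 = (1 + s) * (1 - s)" by (simp add: algebra_simps power2_eq_square)
    also have "\<dots> \<le> 2 * (1 - s)" using s by (intro mult_right_mono) auto
    finally have s2: "1 - s\<^sup>2 \<le> 2 * (1 - s)" .
    have "e \<le> M * ((2 * (1 - s)) / (\<delta> / 2)\<^sup>2)"
      unfolding e_def using M0(1) s2 by (intro mult_left_mono divide_right_mono) auto
    also have "\<dots> = (1 - s) * (8 * M) / \<delta>\<^sup>2" by (simp add: power2_eq_square field_simps)
    also have "\<dots> < \<epsilon>" using sb(3) M0(1) \<delta> by (simp add: field_simps)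
    finally have e: "e < \<epsilon>" .
    have e0: "0 \<le> e" unfolding e_def using M0(1) s sb by (simp add: power_le_one)
    \<comment> \<open>Near i and -i the first factor is below \<epsilon>; elsewhere it is at most
      \<open>M\<close> and the kernel is small. The sum of both bounds holds on the whole circle and
      integrates to \<epsilon> + e.\<close>
    have bound: "norm ((H s z - h) * of_real (poisson s z)) \<le> \<epsilon> * poisson s z + e" if z: "norm z = 1" for z
    proof -
      have K: "(s, z) \<in> K" using sb s z by (auto simp: K_def)
      have n: "norm ((H s z - h) * of_real (poisson s z)) = norm (H s z - h) * poisson s z"
        using P0 by (simp add: norm_mult)
      show ?thesis
      proof (cases "norm (1 + z\<^sup>2) < \<delta>")
        case True
        have "1 + z\<^sup>2 = (z - \<i>) * (z - (- \<i>))" by (simp add: algebra_simps power2_eq_square)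
        then have lt: "norm (z - \<i>) * norm (z - (- \<i>)) < (\<eta> / 2) * (\<eta> / 2)"
          using True \<delta> by (metis norm_mult order_less_le_trans power2_eq_square)
        have "norm (z - \<i>) < \<eta> / 2 \<or> norm (z - (- \<i>)) < \<eta> / 2"
        proof (rule ccontr)
          assume "\<not> ?thesis"
          then have "(\<eta> / 2) * (\<eta> / 2) \<le> norm (z - \<i>) * norm (z - (- \<i>))"
            using \<eta> by (intro mult_mono) auto
          then show False using lt by simp
        qed
        then have "norm (H s z - h) < \<epsilon>"
          using near[OF K, of \<i>] near[OF K, of "- \<i>"] sb s \<delta> by auto
        then have "norm (H s z - h) * poisson s z \<le> \<epsilon> * poisson s z"
          using P0 by (intro mult_right_mono) auto
        then show ?thesis using n e0 by linarith
      next
        case False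
        have "1 + z\<^sup>2 = (1 + of_real s * z\<^sup>2) + of_real (1 - s) * z\<^sup>2" by (simp add: algebra_simps)
        then have "norm (1 + z\<^sup>2) \<le> norm (1 + of_real s * z\<^sup>2) + norm (of_real (1 - s) * z\<^sup>2)"
          by (metis norm_triangle_ineq)
        also have "norm (of_real (1 - s) * z\<^sup>2) = 1 - s"
          using s z by (simp only: norm_mult norm_of_real norm_power) simp
        finally have low: "\<delta> / 2 \<le> norm (1 + of_real s * z\<^sup>2)" using False sb by linarith
        then have pos: "0 < norm (1 + of_real s * z\<^sup>2)" using \<delta>(1) by linarith
        from low have "(\<delta> / 2)\<^sup>2 \<le> (norm (1 + of_real s * z\<^sup>2))\<^sup>2" using \<delta> by (intro power_mono) auto
        then have "poisson s z \<le> (1 - s\<^sup>2) / (\<delta> / 2)\<^sup>2"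
          unfolding poisson_def using \<delta>(1) pos s sb(4)
          by (intro divide_left_mono mult_pos_pos zero_less_power) (auto simp: power_le_one)
        then have "norm (H s z - h) * poisson s z \<le> M * ((1 - s\<^sup>2) / (\<delta> / 2)\<^sup>2)"
          using M[OF K] P0 by (intro mult_mono) auto
        moreover have "0 \<le> \<epsilon> * poisson s z" using \<epsilon> P0 by simp
        ultimately show ?thesis using n by (simp add: e_def)
      qed
    qed
    have contHs: "continuous_on (sphere 0 1) (H s)"
    proof -
      have "continuous_on (sphere 0 1) (\<lambda>z. H (fst (s, z)) (snd (s, z)))"
        by (rule continuous_on_compose2[OF contH])
          (use sb s in \<open>auto simp: K_def intro!: continuous_on_Pair continuous_on_const continuous_on_id\<close>)
      then show ?thesis by simp
    qed
    have cP: "continuous_on (sphere 0 1) (poisson s)" using poisson_continuous sb s by auto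
    have int: "(\<lambda>t. H s (circlepath 0 1 t) * of_real (poisson s (circlepath 0 1 t))) integrable_on {0..1}"
      "(\<lambda>t. h * of_real (poisson s (circlepath 0 1 t))) integrable_on {0..1}"
      "(\<lambda>t. \<epsilon> * poisson s (circlepath 0 1 t) + e) integrable_on {0..1}"
      "(\<lambda>t. poisson s (circlepath 0 1 t)) integrable_on {0..1}"
      by (intro integrable_continuous_real continuous_on_circle_compose continuous_intros contHs cP)+
    have cp: "norm (circlepath 0 1 t) = 1" for t by (simp add: circlepath norm_mult)
    have "integral {0..1} (\<lambda>t. h * of_real (poisson s (circlepath 0 1 t))) = h"
      using integral_poisson[of s] sb s by simp
    then have "integral {0..1} (\<lambda>t. H s (circlepath 0 1 t) * of_real (poisson s (circlepath 0 1 t))) - h =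
        integral {0..1} (\<lambda>t. (H s (circlepath 0 1 t) - h) * of_real (poisson s (circlepath 0 1 t)))"
      using integral_diff[OF int(1,2)] by (simp add: left_diff_distrib)
    also have "norm \<dots> \<le> integral {0..1} (\<lambda>t. \<epsilon> * poisson s (circlepath 0 1 t) + e)"
      using integrable_diff[OF int(1,2)] bound cp
      by (intro integral_norm_bound_integral int) (simp_all add: left_diff_distrib)
    also have "\<dots> = \<epsilon> * integral {0..1} (\<lambda>t. poisson s (circlepath 0 1 t)) + e"
    proof -
      have "((\<lambda>t. e) has_integral e) {0..1::real}" using has_integral_const_real[of e 0 1] by simp
      from has_integral_add[OF has_integral_mult_right[OF integrable_integral[OF int(4)], of \<epsilon>] this]
      show ?thesis by (rule integral_unique)
    qed
    also have "integral {0..1} (\<lambda>t. poisson s (circlepath 0 1 t)) = 1"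
    proof -
      have "complex_of_real (integral {0..1} (\<lambda>t. poisson s (circlepath 0 1 t))) = 1"
        using integral_poisson[of s] sb s
          integral_linear[OF int(4) bounded_linear_of_real[where 'a = complex]] by (simp add: o_def)
      then show ?thesis by simp
    qed
    finally show ?thesis using e by (simp add: \<epsilon>_def)
  qed
  then show "\<forall>\<^sub>F s in at_left 1. dist (integral {0..1} (\<lambda>t. H s (circlepath 0 1 t) *
      of_real (poisson s (circlepath 0 1 t)))) (H 1 \<i>) < \<epsilon>'"
    using \<open>b < 1\<close> eventually_at_left[OF \<open>b < 1\<close>] by (auto simp: h_def dist_norm)
qed

section \<open>Evaluation of the constant\<close>

lemma euler_prod_eq: "euler_prod q = qpoch q q"
  by (simp add: euler_prod_def qpoch_def)

text \<open>The elliptic gamma function with its pole at \<open>1\<close> removed.\<close>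

definition reg_gamma :: "complex \<Rightarrow> complex \<Rightarrow> complex \<Rightarrow> complex" where
  "reg_gamma q p x = qpoch2 (p * q / x) q p / (qpoch (x * p) p * qpoch2 (x * q) q p)"

context
  fixes q p :: complex
  assumes q: "norm q < 1" and p: "norm p < 1"
begin

lemma ell_gamma_eq_reg: "ell_gamma q p x = reg_gamma q p x / (1 - x)"
  unfolding ell_gamma_eq[OF q p] reg_gamma_def
  by (subst qpoch2_split1[OF q p, of x], subst qpoch_split[OF p, of x]) (simp add: mult_ac)

lemma reg_gamma_den_nonzero:
  assumes "norm x \<le> 1"
  shows "qpoch (x * p) p * qpoch2 (x * q) q p \<noteq> 0"
proof -
  have "norm x * norm p \<le> norm p" "norm x * norm q \<le> norm q"
    using assms by (auto intro: mult_left_le_one_le)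
  then show ?thesis
    using p q by (intro no_zero_divisors qpoch_nonzero qpoch2_nonzero) (auto simp: norm_mult)
qed

lemma reg_gamma_continuous [continuous_intros]:
  assumes "continuous_on S f" "\<And>x. x \<in> S \<Longrightarrow> norm (f x) \<le> 1" "\<And>x. x \<in> S \<Longrightarrow> f x \<noteq> 0"
  shows "continuous_on S (\<lambda>x. reg_gamma q p (f x))"
  unfolding reg_gamma_def
  by (intro continuous_on_divide qpoch2_continuous q p continuous_on_mult qpoch_continuous
      continuous_on_const assms ballI reg_gamma_den_nonzero)

text \<open>The source of the Euler products in \<open>kappa\<close>: (q; q, p) splits into (q; q)
  and (pq; q, p), and the latter cancels the numerator.\<close>

lemma reg_gamma_1: "reg_gamma q p 1 = 1 / (qpoch p p * qpoch q q)"
proof -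
  have "norm (p * q) < 1" using norm_mult_less_one[OF p q] .
  then have "qpoch2 (p * q) q p \<noteq> 0" by (intro qpoch2_nonzero q p)
  then show ?thesis
    using qpoch2_split2[OF q p, of q] by (simp add: reg_gamma_def mult.commute)
qed

lemma kappa_nonzero: "kappa q p \<noteq> 0"
  using qpoch_nonzero[OF q q] qpoch_nonzero[OF p p] by (simp add: kappa_def euler_prod_eq)

text \<open>By constancy the ratio may be evaluated along the family \<open>f s\<close>,
  \<open>- f s\<close>, \<open>\<tau>\<close>, \<open>\<tau>\<close>, \<open>\<tau>\<close>; both of
  its members, freed of their poles in \<open>s\<close>, have limits as s -> 1.\<close>

lemma beta_ratio_value:
  assumes q0: "q \<noteq> 0" and dom: "beta_domain q p a b c d e"
  shows "kappa q p * beta_ratio q p a b c d e = 1"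
proof -
  have "norm (p * q) < 1" using norm_mult_less_one[OF p q] .
  \<comment> \<open>The product of the five special parameters will be s y^3, hence the cube;
    \<open>s0\<close> leaves room for \<open>s\<close> below 1.\<close>
  then obtain y where y: "norm (p * q) < y ^ 3" "0 < y" "y < 1"
    using power_gap[of "norm (p * q)" 3] by auto
  then obtain s0 where s0: "norm (p * q) / y ^ 3 < s0" "s0 < 1"
    using dense[of "norm (p * q) / y ^ 3" 1] by (auto simp: field_simps)
  have s0': "0 < s0" using s0 y by (smt (verit) divide_nonneg_pos norm_ge_zero zero_less_power)
  define \<tau> where "\<tau> = complex_of_real y"
  have \<tau>: "norm \<tau> < 1" "\<tau> \<noteq> 0" "norm (p * q) < norm (\<tau> ^ 3)" using y by (simp_all add: \<tau>_def norm_power)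
  \<comment> \<open>Then (1 - f s w)(1 + f s w) = 1 + s w^2, and the product over w = z and w = 1/z
    is the denominator of the Poisson kernel.\<close>
  define f where "f = (\<lambda>s. \<i> * complex_of_real (sqrt s))"
  define S where "S = {s0..1}"
  have ff: "f s * - f s = of_real s" if "s \<in> S" for s
  proof -
    have "f s * - f s = - (\<i> * \<i>) * of_real (sqrt s * sqrt s)"
      unfolding f_def of_real_mult by algebra
    also have "sqrt s * sqrt s = s" using that s0' by (simp add: S_def)
    finally show ?thesis by simp
  qed
  have nf: "norm (f s) \<le> 1" "f s \<noteq> 0" if "s \<in> S" for s
    using that s0' by (auto simp: f_def S_def norm_mult)
  have A: "norm (of_real s * \<tau> ^ 3) < 1" "of_real s * \<tau> ^ 3 \<noteq> 0" "norm (p * q) < norm (of_real s * \<tau> ^ 3)"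
    if "s \<in> S" for s :: real
  proof -
    have s: "s0 \<le> s" "s \<le> 1" using that by (auto simp: S_def)
    have n: "norm (of_real s * \<tau> ^ 3) = s * y ^ 3"
      using s s0' y by (simp add: \<tau>_def norm_mult norm_power)
    have "norm (p * q) < s0 * y ^ 3" using s0 y by (simp add: field_simps)
    also have "\<dots> \<le> s * y ^ 3" using s y by (intro mult_right_mono) auto
    finally show "norm (p * q) < norm (of_real s * \<tau> ^ 3)" by (simp only: n)
    have "s * y ^ 3 \<le> y ^ 3" using s y by (intro mult_left_le_one_le) (use s0' in auto)
    also have "\<dots> < 1" using y by (intro power_less_one_iff[THEN iffD2]) auto
    finally show "norm (of_real s * \<tau> ^ 3) < 1" by (simp only: n)
    show "of_real s * \<tau> ^ 3 \<noteq> 0" using s s0' \<tau> by auto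
  qed
  define G where "G = ell_gamma q p"
  define L where "L = reg_gamma q p"
  define H where "H = (\<lambda>s z. beta_weight q p z *
     (L (f s * z) * L (f s * inverse z) * (L (- f s * z) * L (- f s * inverse z)) * ell_gamma_pm q p \<tau> z ^ 3) /
     ell_gamma_pm q p (of_real s * \<tau> ^ 3) z)"
  define V where "V = (\<lambda>s. L (of_real s) *
     (G (f s * \<tau>) ^ 3 * G (- f s * \<tau>) ^ 3 * G (\<tau> * \<tau>) ^ 3) /
     (G (f s * \<tau> ^ 3) * G (- f s * \<tau> ^ 3) * G (of_real s * (\<tau> * \<tau>)) ^ 3))"
  define C where "C = beta_ratio q p a b c d e"
  have AI: "f s * - f s * \<tau> * \<tau> * \<tau> = of_real s * \<tau> ^ 3" if "s \<in> S" for s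
    unfolding ff[OF that] by (simp add: power3_eq_cube mult_ac)
  \<comment> \<open>The integrand is \<open>H\<close> times the kernel over 1 - s^2, while the value
    has the pole 1/(1 - s) from Gamma(t_1 t_2); the quotient leaves 1 + s.\<close>
  have main: "2 * of_real pi * \<i> * integral {0..1} (\<lambda>t. H s (circlepath 0 1 t) * of_real (poisson s (circlepath 0 1 t)))
      = C * V s * (1 + of_real s)" if s: "s0 < s" "s < 1" for s
  proof -
    have sS: "s \<in> S" using s by (auto simp: S_def)
    have "beta_domain q p (f s) (- f s) \<tau> \<tau> \<tau>"
      unfolding beta_domain_def AI[OF sS] using A[OF sS] \<tau> s s0' by (simp add: f_def norm_mult)
    note dom' = this
    have CR: "beta_integral q p (f s) (- f s) \<tau> \<tau> \<tau> = C * beta_value q p (f s) (- f s) \<tau> \<tau> \<tau>"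
      using beta_ratio_const[OF q p q0 dom dom'] beta_value_nonzero[OF q p dom']
      by (simp add: C_def beta_ratio_def)
    have "1 - s\<^sup>2 \<noteq> 0" using s s0' by (simp add: power2_eq_1_iff)
    then have s2: "1 - complex_of_real (s\<^sup>2) \<noteq> 0" by (metis of_real_1 of_real_diff of_real_eq_0_iff)
    have int: "beta_integrand q p (f s) (- f s) \<tau> \<tau> \<tau> z =
        H s z * of_real (poisson s z) / (1 - of_real (s\<^sup>2))" if z: "norm z = 1" for z
    proof -
      have k: "(1 - f s * w) * (1 - - f s * w) = 1 + of_real s * w\<^sup>2" for w
      proof -
        have "(1 - f s * w) * (1 - - f s * w) = 1 + f s * - f s * w\<^sup>2" by (simp add: algebra_simps power2_eq_square)
        then show ?thesis by (simp only: ff[OF sS])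
      qed
      have g: "ell_gamma_pm q p (f s) z * ell_gamma_pm q p (- f s) z =
        L (f s * z) * L (f s * inverse z) * (L (- f s * z) * L (- f s * inverse z)) /
        (((1 - f s * z) * (1 - - f s * z)) * ((1 - f s * inverse z) * (1 - - f s * inverse z)))"
        unfolding ell_gamma_pm_def ell_gamma_eq_reg L_def by (simp add: mult_ac)
      have "beta_integrand q p (f s) (- f s) \<tau> \<tau> \<tau> z = H s z /
          ((1 + of_real s * z\<^sup>2) * (1 + of_real s * (inverse z)\<^sup>2))"
        unfolding beta_integrand_def AI[OF sS] g k H_def by (simp add: power3_eq_cube mult_ac)
      then show ?thesis
        unfolding poisson_eq[OF z] using s2 by (simp add: power_inverse)
    qed
    have "beta_integral q p (f s) (- f s) \<tau> \<tau> \<tau> =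
        contour_integral (circlepath 0 1) (\<lambda>z. H s z * of_real (poisson s z) / (1 - of_real (s\<^sup>2)) / z)"
      unfolding beta_integral_def by (rule contour_integral_cong) (simp_all add: int)
    also have "\<dots> = 2 * of_real pi * \<i> * integral {0..1} (\<lambda>t. H s (circlepath 0 1 t) *
        of_real (poisson s (circlepath 0 1 t))) / (1 - of_real (s\<^sup>2))"
      unfolding circle_integral by simp
    finally have "2 * of_real pi * \<i> * integral {0..1} (\<lambda>t. H s (circlepath 0 1 t) *
        of_real (poisson s (circlepath 0 1 t))) / (1 - of_real (s\<^sup>2)) = C * beta_value q p (f s) (- f s) \<tau> \<tau> \<tau>"
      using CR by simp
    then have I: "2 * of_real pi * \<i> * integral {0..1} (\<lambda>t. H s (circlepath 0 1 t) *
        of_real (poisson s (circlepath 0 1 t))) = C * beta_value q p (f s) (- f s) \<tau> \<tau> \<tau> * (1 - of_real (s\<^sup>2))"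
      by (simp only: nonzero_divide_eq_eq[OF s2])
    have ab: "f s * - f s = of_real s" by (rule ff[OF sS])
    have R: "beta_value q p (f s) (- f s) \<tau> \<tau> \<tau> = V s / (1 - of_real s)"
    proof -
      have e: "f s * \<tau> * \<tau> * \<tau> = f s * \<tau> ^ 3" "- f s * \<tau> * \<tau> * \<tau> = - f s * \<tau> ^ 3"
        "of_real s * \<tau> * \<tau> = of_real s * (\<tau> * \<tau>)" by (simp_all add: power3_eq_cube mult_ac)
      show ?thesis
        unfolding beta_value_def ab e V_def G_def L_def ell_gamma_eq_reg[of "of_real s"]
        by (simp add: power3_eq_cube mult_ac)
    qed
    have "1 - complex_of_real s \<noteq> 0" using s by auto
    moreover have "1 - complex_of_real (s\<^sup>2) = (1 - of_real s) * (1 + of_real s)"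
      by (simp add: algebra_simps power2_eq_square)
    ultimately show ?thesis unfolding I R by simp
  qed
  have contf: "continuous_on T (\<lambda>x. f (g x))" if "continuous_on T g" for g :: "'x::topological_space \<Rightarrow> real" and T
    unfolding f_def using that by (intro continuous_intros)
  have limH: "((\<lambda>s. integral {0..1} (\<lambda>t. H s (circlepath 0 1 t) * of_real (poisson s (circlepath 0 1 t))))
      \<longlongrightarrow> H 1 \<i>) (at_left 1)"
  proof (rule poisson_limit[OF _ s0(2)])
    show "0 \<le> s0" using s0' by simp
    show "H 1 (- \<i>) = H 1 \<i>"
      by (simp add: H_def beta_weight_def ell_gamma_pm_def mult_ac)
    have x: "fst x \<in> S" "norm (snd x) = 1" "snd x \<noteq> 0" if "x \<in> S \<times> sphere 0 1" for x :: "real \<times> complex"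
      using that by auto
    have L1: "continuous_on (S \<times> sphere 0 1) (\<lambda>x. L (g x))"
      if "continuous_on (S \<times> sphere 0 1) g" "\<And>x. x \<in> S \<times> sphere 0 1 \<Longrightarrow> norm (g x) = norm (f (fst x))"
      for g :: "real \<times> complex \<Rightarrow> complex"
    proof -
      have "norm (g w) \<le> 1" "g w \<noteq> 0" if "w \<in> S \<times> sphere 0 1" for w
        using nf[OF x(1)[OF that]] \<open>\<And>x. x \<in> S \<times> sphere 0 1 \<Longrightarrow> norm (g x) = norm (f (fst x))\<close>[OF that]
        by auto
      then show ?thesis unfolding L_def using that(1) by (intro reg_gamma_continuous)
    qed
    have cf: "continuous_on (S \<times> sphere 0 1) (\<lambda>x. f (fst x))"
      by (intro contf continuous_on_fst continuous_on_id)
    have ci: "continuous_on (S \<times> sphere 0 1) (\<lambda>x. inverse (snd x :: complex))"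
      using x by (intro continuous_on_inverse continuous_on_snd continuous_on_id) blast
    have 1: "continuous_on (S \<times> sphere 0 1) (\<lambda>x. L (f (fst x) * snd x))"
      "continuous_on (S \<times> sphere 0 1) (\<lambda>x. L (f (fst x) * inverse (snd x)))"
      "continuous_on (S \<times> sphere 0 1) (\<lambda>x. L (- f (fst x) * snd x))"
      "continuous_on (S \<times> sphere 0 1) (\<lambda>x. L (- f (fst x) * inverse (snd x)))"
      by (rule L1; (intro continuous_on_mult continuous_on_minus cf ci continuous_on_snd continuous_on_id |
          simp add: norm_mult norm_inverse x))+
    have 2: "continuous_on (S \<times> sphere 0 1) (\<lambda>x. beta_weight q p (snd x))"
      by (intro beta_weight_continuous[OF q p] continuous_on_snd continuous_on_id x)
    have 3: "continuous_on (S \<times> sphere 0 1) (\<lambda>x. ell_gamma_pm q p \<tau> (snd x))"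
      by (intro ell_gamma_pm_continuous[OF q p] continuous_on_snd continuous_on_id continuous_on_const x \<tau>)
    have 4: "continuous_on (S \<times> sphere 0 1) (\<lambda>x. ell_gamma_pm q p (of_real (fst x) * \<tau> ^ 3) (snd x))"
      by (intro ell_gamma_pm_continuous[OF q p] continuous_on_mult continuous_on_of_real continuous_on_fst
          continuous_on_snd continuous_on_id continuous_on_const x A)
    have 5: "\<forall>x\<in>S \<times> sphere 0 1. ell_gamma_pm q p (of_real (fst x) * \<tau> ^ 3) (snd x) \<noteq> 0"
      by (intro ballI ell_gamma_pm_nonzero[OF q p] A x)
    show "continuous_on ({s0..1} \<times> sphere 0 1) (\<lambda>(s, z). H s z)"
      unfolding H_def case_prod_unfold S_def[symmetric]
      by (intro continuous_on_divide continuous_on_mult continuous_on_power 1 2 3 4 5)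
  qed
  \<comment> \<open>Every gamma argument in \<open>V\<close> other than \<open>s\<close> itself and
    \<tau>^2 is treated here: its modulus lies between those of s \<tau>^3 and \<tau>, hence
    strictly between |pq| and 1.\<close>
  have VG: "continuous_on S (\<lambda>s. G (g s))" "\<forall>s\<in>S. G (g s) \<noteq> 0"
    if "continuous_on S g" "\<And>s. s \<in> S \<Longrightarrow> norm (of_real s * \<tau> ^ 3) \<le> norm (g s)" "\<And>s. s \<in> S \<Longrightarrow> norm (g s) \<le> norm \<tau>" for g :: "real \<Rightarrow> complex"
  proof -
    have "norm (p * q) < norm (g s)" "norm (g s) < 1" if "s \<in> S" for s
      using A(3)[OF that] \<open>\<And>s. s \<in> S \<Longrightarrow> norm (of_real s * \<tau> ^ 3) \<le> norm (g s)\<close>[OF that]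
        \<open>\<And>s. s \<in> S \<Longrightarrow> norm (g s) \<le> norm \<tau>\<close>[OF that] \<tau>(1) by linarith+
    moreover from this have "g s \<noteq> 0" if "s \<in> S" for s using that not_less[of "norm (p * q)" 0] by fastforce
    ultimately show "continuous_on S (\<lambda>s. G (g s))" "\<forall>s\<in>S. G (g s) \<noteq> 0"
      unfolding G_def using that(1) by (auto intro!: ell_gamma_continuous[OF q p] simp: ell_gamma_nonzero[OF q p])
  qed
  have sb: "0 < s" "s \<le> 1" "s \<le> sqrt s" "sqrt s \<le> 1" if "s \<in> S" for s
    using that s0' by (auto simp: S_def real_le_rsqrt power2_eq_square mult_left_le)
  have yb: "y ^ 3 \<le> y * y" "y * y \<le> y" "y ^ 3 \<le> y"
    using y by (auto simp: power3_eq_cube mult_left_le mult_le_one)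
  have mm: "u * v \<le> u' * v'" if "u \<le> u'" "v \<le> v'" "0 \<le> u" "0 \<le> v" for u v u' v' :: real
    using that by (intro mult_mono) auto
  have mm1: "u * v \<le> v'" if "u \<le> 1" "v \<le> v'" "0 \<le> u" "0 \<le> v" for u v v' :: real
    using mm[of u 1 v v'] that by simp
  have nn: "norm (of_real s * \<tau> ^ 3) = s * y ^ 3" "norm (f s * \<tau>) = sqrt s * y" "norm (- f s * \<tau>) = sqrt s * y"
    "norm (f s * \<tau> ^ 3) = sqrt s * y ^ 3" "norm (- f s * \<tau> ^ 3) = sqrt s * y ^ 3" "norm (\<tau> * \<tau>) = 1 * (y * y)"
    "norm (of_real s * (\<tau> * \<tau>)) = s * (y * y)" "norm \<tau> = y"
    if "s \<in> S" for s
    using sb[OF that] y by (simp_all add: f_def \<tau>_def norm_mult norm_power)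
  have cf: "continuous_on S f" using contf[OF continuous_on_id] by simp
  note ci = continuous_on_mult continuous_on_minus cf continuous_on_const continuous_on_of_real continuous_on_id
  have vg: "continuous_on S (\<lambda>s. G (f s * \<tau>))" "continuous_on S (\<lambda>s. G (- f s * \<tau>))"
      "continuous_on S (\<lambda>s. G (f s * \<tau> ^ 3))" "continuous_on S (\<lambda>s. G (- f s * \<tau> ^ 3))"
      "continuous_on S (\<lambda>s. G (of_real s * (\<tau> * \<tau>)))"
    by (rule VG; (intro ci | simp only: nn; intro mm mm1 sb yb order_refl; use y sb in \<open>auto simp: less_imp_le\<close>))+
  have vn: "\<forall>s\<in>S. G (f s * \<tau>) \<noteq> 0" "\<forall>s\<in>S. G (- f s * \<tau>) \<noteq> 0"
      "\<forall>s\<in>S. G (f s * \<tau> ^ 3) \<noteq> 0" "\<forall>s\<in>S. G (- f s * \<tau> ^ 3) \<noteq> 0"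
      "\<forall>s\<in>S. G (of_real s * (\<tau> * \<tau>)) \<noteq> 0"
    by (rule VG; (intro ci | simp only: nn; intro mm mm1 sb yb order_refl; use y sb in \<open>auto simp: less_imp_le\<close>))+
  have "norm (complex_of_real s) \<le> 1" "complex_of_real s \<noteq> 0" if "s \<in> S" for s
    using sb[OF that] by auto
  then have "continuous_on S (\<lambda>s. L (of_real s))"
    unfolding L_def by (intro reg_gamma_continuous ci)
  then have contV: "continuous_on S V"
    unfolding V_def using vn by (intro continuous_on_divide continuous_on_mult continuous_on_power continuous_on_const vg) auto
  have oneS: "1 \<in> S" using s0 by (simp add: S_def)
  have limV: "(V \<longlongrightarrow> V 1) (at_left 1)"
  proof -
    have "(V \<longlongrightarrow> V 1) (at 1 within S)" using contV oneS by (simp add: continuous_on_def)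
    moreover have "at 1 within S = at_left 1"
      unfolding S_def using s0(2) by (rule at_within_Icc_at_left)
    ultimately show ?thesis by simp
  qed
  have ev: "\<forall>\<^sub>F s in at_left 1. 2 * of_real pi * \<i> * integral {0..1} (\<lambda>t. H s (circlepath 0 1 t) *
      of_real (poisson s (circlepath 0 1 t))) = C * V s * (1 + of_real s)"
    using eventually_at_left[OF s0(2)] main s0(2) by blast
  have "((\<lambda>s. 2 * of_real pi * \<i> * integral {0..1} (\<lambda>t. H s (circlepath 0 1 t) *
      of_real (poisson s (circlepath 0 1 t)))) \<longlongrightarrow> C * V 1 * (1 + of_real 1)) (at_left 1)"
    unfolding tendsto_cong[OF ev] by (intro tendsto_intros limV)
  moreover have "((\<lambda>s. 2 * of_real pi * \<i> * integral {0..1} (\<lambda>t. H s (circlepath 0 1 t) *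
      of_real (poisson s (circlepath 0 1 t)))) \<longlongrightarrow> 2 * of_real pi * \<i> * H 1 \<i>) (at_left 1)"
    by (intro tendsto_intros limH)
  ultimately have eq: "C * V 1 * (1 + of_real 1) = 2 * of_real pi * \<i> * H 1 \<i>"
    by (rule tendsto_unique[rotated]) simp
  \<comment> \<open>The gamma factors shared by \<open>V 1\<close> and \<open>H 1 \<i>\<close>; the
    cubes of Gamma(\<tau>^2) in \<open>V\<close> cancel at s = 1.\<close>
  define X where "X = G (\<i> * \<tau>) ^ 3 * G (- \<i> * \<tau>) ^ 3 / (G (\<i> * \<tau> ^ 3) * G (- \<i> * \<tau> ^ 3))"
  have f1: "f 1 = \<i>" by (simp add: f_def)
  have nzG: "G (\<i> * \<tau>) \<noteq> 0" "G (- \<i> * \<tau>) \<noteq> 0" "G (\<i> * \<tau> ^ 3) \<noteq> 0" "G (- \<i> * \<tau> ^ 3) \<noteq> 0" "G (\<tau> * \<tau>) \<noteq> 0"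
    using vn[THEN bspec, OF oneS] by (simp_all add: f1)
  then have X0: "X \<noteq> 0" by (simp add: X_def)
  have V1: "V 1 = L 1 * X"
    using nzG by (simp add: V_def f1 X_def)
  have Lm: "L (- 1) \<noteq> 0"
    unfolding L_def reg_gamma_def
    using reg_gamma_den_nonzero[of "-1"] qpoch2_nonzero[OF q p, of "- (p * q)"] \<open>norm (p * q) < 1\<close> by simp
  have "beta_weight q p \<i> = 1 / (ell_gamma q p (- 1) * ell_gamma q p (- 1))"
    using inverse_ell_gamma_pm[OF q p, of "-1"] by (simp add: beta_weight_def)
  \<comment> \<open>Gamma(-1) is half of L(-1), whence the 4; together with 2 pi i from the circle
    and 1 + s -> 2 it gives the 4 pi i of \<open>kappa\<close>.\<close>
  then have W: "beta_weight q p \<i> = 4 / L (- 1) ^ 2"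
    by (simp add: ell_gamma_eq_reg L_def power2_eq_square)
  have H1: "H 1 \<i> = 4 * L 1 ^ 2 * X"
    using Lm by (simp add: H_def f1 W X_def ell_gamma_pm_def G_def mult.commute[of \<tau>] mult.commute[of "\<tau> ^ 3"]
        power2_eq_square power_mult_distrib)
  have L1: "L 1 = 1 / (qpoch p p * qpoch q q)" unfolding L_def by (rule reg_gamma_1)
  have pq0: "qpoch p p * qpoch q q \<noteq> 0" using qpoch_nonzero p q by simp
  have "C * (L 1 * X * 2) = (4 * of_real pi * \<i> * L 1) * (L 1 * X * 2)"
    using eq unfolding V1 H1 by (simp add: power2_eq_square mult_ac)
  moreover have "L 1 * X * 2 \<noteq> 0" using X0 pq0 by (simp add: L1)
  ultimately have "C = 4 * of_real pi * \<i> * L 1"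
    using mult_right_cancel by blast
  then show ?thesis
    using pq0 by (simp add: kappa_def euler_prod_eq C_def L1)
qed

end

section \<open>The elliptic beta integral\<close>

lemma kappa_commute: "kappa q p = kappa p q"
  by (simp add: kappa_def mult.commute)

lemma beta_weight_eq:
  assumes "norm q < 1" "norm p < 1" "norm z = 1"
  shows "beta_weight q p z = 1 / ell_gamma_pm q p 1 (z\<^sup>2)"
  using inverse_ell_gamma_pm[OF assms(1,2), of "z\<^sup>2"] assms(3)
  by (simp add: beta_weight_def ell_gamma_pm_def norm_power)

lemma qpoch_continuous_base:
  fixes f :: "'a::topological_space \<Rightarrow> complex" and r :: "'a \<Rightarrow> real"
  assumes "continuous_on S f" "continuous_on S r"
    and "\<And>x. x \<in> S \<Longrightarrow> norm (f x) \<le> 1" "\<And>x. x \<in> S \<Longrightarrow> r x \<in> {0..1 / 2}"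
  shows "continuous_on S (\<lambda>x. qpoch (f x) (of_real (r x)))"
proof -
  have "continuous_on S (\<lambda>x. (\<lambda>(a, q). qpoch a q) (f x, of_real (r x)))"
    by (rule continuous_on_compose2[OF qpoch_continuous_joint[of "1 / 2" 1]])
      (use assms in \<open>auto intro!: continuous_intros\<close>)
  then show ?thesis by simp
qed

text \<open>The case \<open>p = q = 0\<close> is the limit \<open>q \<rightarrow> 0\<close> of the case \<open>p = 0\<close>.\<close>

lemma beta_evaluation_degenerate:
  assumes dom: "beta_domain 0 0 a b c d e"
  shows "kappa 0 0 * beta_integral 0 0 a b c d e = beta_value 0 0 a b c d e"
proof -
  \<comment> \<open>Real bases bounded away from 1, so that joint continuity holds on a compact
    set.\<close>
  define I where "I = {0..1 / 2 :: real}"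
  define D where "D = (\<lambda>r. kappa (of_real r) 0 * beta_integral (of_real r) 0 a b c d e
    - beta_value (of_real r) 0 a b c d e)"
  have q: "norm (complex_of_real r) < 1" "norm (complex_of_real r) \<le> 1" if "r \<in> I" for r
    using that by (auto simp: I_def)
  have p: "norm (0::complex) < 1" by simp
  have dom': "beta_domain (of_real r) 0 a b c d e" for r
    using dom by (simp add: beta_domain_def)
  have gamma: "ell_gamma (of_real r) 0 x = 1 / qpoch x (of_real r)" if "r \<in> I" for r x
    using ell_gamma_eq[OF q(1)[OF that] p] by (simp add: qpoch2_0_right)
  have nz: "qpoch x (of_real r) \<noteq> 0" if "r \<in> I" "norm x < 1" for r x
    using q(1) that by (intro qpoch_nonzero)
  have Gn: "ell_gamma (of_real r) 0 x \<noteq> 0" if "r \<in> I" "norm x < 1" for r x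
    using gamma nz that by simp
  have Gc: "continuous_on S (\<lambda>x. ell_gamma (of_real (r x)) 0 (f x))"
    if "continuous_on S f" "continuous_on S r" and fr: "\<And>x. x \<in> S \<Longrightarrow> norm (f x) < 1" "\<And>x. x \<in> S \<Longrightarrow> r x \<in> I"
    for S and f :: "'x::topological_space \<Rightarrow> complex" and r
  proof -
    have "continuous_on S (\<lambda>x. 1 / qpoch (f x) (of_real (r x)))"
      using nz that by (intro continuous_on_divide continuous_on_const qpoch_continuous_base)
        (auto simp: I_def less_imp_le)
    then show ?thesis
      by (rule continuous_on_eq) (simp add: gamma fr)
  qed
  have n: "norm a < 1" "norm b < 1" "norm c < 1" "norm d < 1" "norm e < 1"
    using dom by (auto simp: beta_domain_def)
  have nA: "norm (a * b * c * d * e) < 1" by (intro norm_mult_less_one n)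
  have contI: "continuous_on I (\<lambda>r. beta_integral (of_real r) 0 a b c d e)"
    unfolding beta_integral_def
  proof (rule continuous_on_contour_integral_param[OF _ _ continuous_vector_derivative_circlepath])
    show "path (circlepath 0 1)" by simp
    define S where "S = I \<times> sphere (0::complex) 1"
    have S: "fst x \<in> I" "norm (snd x) = 1" "snd x \<noteq> 0" if "x \<in> S" for x
      using that by (auto simp: S_def)
    have i: "continuous_on S (\<lambda>x. inverse (snd x))"
      using S by (intro continuous_on_inverse continuous_on_snd continuous_on_id) blast
    have f: "continuous_on S fst" by (intro continuous_on_fst continuous_on_id)
    have pm: "continuous_on S (\<lambda>x. ell_gamma_pm (of_real (fst x)) 0 t (snd x))"
      and pmn: "\<forall>x\<in>S. ell_gamma_pm (of_real (fst x)) 0 t (snd x) \<noteq> 0" if "norm t < 1" for t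
    proof -
      have t: "norm (t * snd x) < 1" "norm (t * inverse (snd x)) < 1" if "x \<in> S" for x
        using S[OF that] \<open>norm t < 1\<close> by (simp_all add: norm_mult norm_inverse)
      show "continuous_on S (\<lambda>x. ell_gamma_pm (of_real (fst x)) 0 t (snd x))"
        unfolding ell_gamma_pm_def using t S
        by (intro continuous_on_mult Gc f i continuous_on_const continuous_on_snd continuous_on_id)
      show "\<forall>x\<in>S. ell_gamma_pm (of_real (fst x)) 0 t (snd x) \<noteq> 0"
        unfolding ell_gamma_pm_def using Gn t S by (metis mult_eq_0_iff)
    qed
    have w: "continuous_on S (\<lambda>x. beta_weight (of_real (fst x)) 0 (snd x))"
    proof -
      have "beta_weight (of_real (fst x)) 0 (snd x) = (1 - (snd x)\<^sup>2) *
          (qpoch (inverse ((snd x)\<^sup>2)) (of_real (fst x)) *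
           qpoch (of_real (fst x) * (snd x)\<^sup>2) (of_real (fst x)))" for x
        by (simp add: beta_weight_def theta_def qpoch_0_right divide_inverse)
      moreover have "continuous_on S (\<lambda>x. qpoch (inverse ((snd x)\<^sup>2)) (of_real (fst x)))"
        using S by (intro qpoch_continuous_base f continuous_on_inverse continuous_on_power
            continuous_on_snd continuous_on_id) (auto simp: I_def norm_inverse norm_power)
      moreover have "continuous_on S (\<lambda>x. qpoch (of_real (fst x) * (snd x)\<^sup>2) (of_real (fst x)))"
      proof (intro qpoch_continuous_base f continuous_on_mult continuous_on_of_real continuous_on_power
            continuous_on_snd continuous_on_id)
        show "norm (of_real (fst x) * (snd x)\<^sup>2) \<le> 1" if "x \<in> S" for x
          using S(2)[OF that] q(2)[OF S(1)[OF that]] by (simp add: norm_mult norm_power)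
        show "fst x \<in> {0..1 / 2}" if "x \<in> S" for x
          using S(1)[OF that] by (simp add: I_def)
      qed
      ultimately show ?thesis
        by (simp only:) (intro continuous_on_mult continuous_on_diff continuous_on_const continuous_on_power
            continuous_on_snd continuous_on_id)
    qed
    have "continuous_on S (\<lambda>x. beta_integrand (of_real (fst x)) 0 a b c d e (snd x) / snd x)"
      unfolding beta_integrand_def
      by (intro continuous_on_divide continuous_on_mult w pm pmn n nA continuous_on_snd continuous_on_id)
        (use S in blast)
    then show "continuous_on (I \<times> path_image (circlepath 0 1))
        (\<lambda>(r, z). beta_integrand (of_real r) 0 a b c d e z / z)"
      by (simp add: S_def case_prod_unfold)
  qed
  have contK: "continuous_on I (\<lambda>r. kappa (of_real r) 0)"
    unfolding kappa_def euler_prod_eq using q(2)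
    by (intro continuous_on_divide continuous_on_mult qpoch_continuous_base continuous_on_const
        continuous_on_of_real continuous_on_id) (auto simp: I_def)
  have contV: "continuous_on I (\<lambda>r. beta_value (of_real r) 0 a b c d e)"
  proof -
    have G: "continuous_on I (\<lambda>r. ell_gamma (of_real r) 0 x)" "\<forall>r\<in>I. ell_gamma (of_real r) 0 x \<noteq> 0"
      if "norm x < 1" for x
      using Gc[of I "\<lambda>_. x" "\<lambda>r. r"] Gn that by auto
    have "\<forall>r\<in>I. ell_gamma (of_real r) 0 (b * c * d * e) * ell_gamma (of_real r) 0 (a * c * d * e) *
       ell_gamma (of_real r) 0 (a * b * d * e) * ell_gamma (of_real r) 0 (a * b * c * e) *
       ell_gamma (of_real r) 0 (a * b * c * d) \<noteq> 0"
      using G(2) n norm_mult_less_one by (metis mult_eq_0_iff)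
    then show ?thesis
      unfolding beta_value_def
      by (intro continuous_on_divide continuous_on_mult G norm_mult_less_one n)
  qed
  have cl: "closure {0<..1 / 2 :: real} = I" unfolding I_def by (intro closure_greaterThanAtMost) simp
  \<comment> \<open>The point 0 is only in the closure of the bases already treated, and continuity
    of \<open>D\<close> carries the identity there.\<close>
  have "D 0 = 0"
  proof (rule continuous_constant_on_closure[where S = "{0<..1 / 2 :: real}" and f = D])
    show "continuous_on (closure {0<..1 / 2}) D"
      unfolding cl D_def by (intro continuous_on_diff continuous_on_mult contK contI contV)
    show "0 \<in> closure {0<..1 / 2 :: real}" unfolding cl I_def by simp
    fix r :: real assume "r \<in> {0<..1 / 2}"
    then have r: "r \<in> I" "complex_of_real r \<noteq> 0" by (auto simp: I_def)
    show "D r = 0"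
      using beta_ratio_value[OF q(1)[OF r(1)] p r(2) dom'] beta_value_nonzero[OF q(1)[OF r(1)] p dom']
      by (simp add: D_def beta_ratio_def field_simps)
  qed
  then show ?thesis by (simp add: D_def)
qed

theorem beta_evaluation:
  assumes q: "norm q < 1" and p: "norm p < 1" and dom: "beta_domain q p a b c d e"
  shows "kappa q p * beta_integral q p a b c d e = beta_value q p a b c d e"
proof -
  have generic: "kappa q p * beta_integral q p a b c d e = beta_value q p a b c d e"
    if "norm q < 1" "norm p < 1" "beta_domain q p a b c d e" "q \<noteq> 0" for q p
    using beta_ratio_value[OF that(1,2,4,3)] beta_value_nonzero[OF that(1-3)]
    by (simp add: beta_ratio_def field_simps)
  consider "q \<noteq> 0" | "q = 0" "p \<noteq> 0" | "q = 0" "p = 0" by blast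
  then show ?thesis
  proof cases
    case 1
    then show ?thesis using generic assms by blast
  next
    case 2
    have g: "ell_gamma 0 p = ell_gamma p 0" using p by (intro ext ell_gamma_0_left)
    then have gpm: "ell_gamma_pm 0 p = ell_gamma_pm p 0" by (simp add: fun_eq_iff ell_gamma_pm_def)
    \<comment> \<open>The definition of the weight treats the two bases differently; the symmetry
      becomes visible only through the gamma function.\<close>
    have "beta_weight 0 p z = beta_weight p 0 z" if "norm z = 1" for z
      using that p by (simp add: beta_weight_eq gpm)
    then have "beta_integral 0 p a b c d e = beta_integral p 0 a b c d e"
      unfolding beta_integral_def by (intro contour_integral_cong) (simp_all add: beta_integrand_def gpm)
    moreover have "beta_value 0 p a b c d e = beta_value p 0 a b c d e"
      by (simp add: beta_value_def g)
    moreover have "beta_domain p 0 a b c d e" using dom 2 by (simp add: beta_domain_def)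
    ultimately show ?thesis
      using generic[of p 0] p 2 by (simp add: kappa_commute[of 0])
  next
    case 3
    then show ?thesis using dom beta_evaluation_degenerate by simp
  qed
qed

section \<open>The star-triangle relation\<close>

text \<open>The k-th factor of the multiple integral, with z = x_k, w = x_(k+1) and T = t s_1 ...
  s_(k-1).\<close>

definition fold_kernel ::
    "complex \<Rightarrow> complex \<Rightarrow> complex \<Rightarrow> complex \<Rightarrow> complex \<Rightarrow> complex \<Rightarrow> complex \<Rightarrow> complex" where
  "fold_kernel q p T s u z w =
     (ell_gamma_pm q p (T\<^sup>2 * s * u) w * ell_gamma_pm_pm q p s w z * ell_gamma_pm q p u z) /
     (ell_gamma_pm q p (s * u) w * ell_gamma_pm q p 1 (z\<^sup>2) * ell_gamma_pm q p (T\<^sup>2 * s\<^sup>2 * u) z)"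

text \<open>The part of the single integrand that does not involve the boundary variable, after
  \<open>m\<close> integrations.\<close>

definition fold_weight ::
    "complex \<Rightarrow> complex \<Rightarrow> complex \<Rightarrow> (nat \<Rightarrow> complex) \<Rightarrow> (nat \<Rightarrow> complex) \<Rightarrow> (nat \<Rightarrow> complex) \<Rightarrow>
      (nat \<Rightarrow> complex) \<Rightarrow> nat \<Rightarrow> complex \<Rightarrow> complex" where
  "fold_weight q p t tr T s u m y =
     (\<Prod>r=0..2. ell_gamma_pm q p (tr r) y) /
     (ell_gamma_pm q p 1 (y\<^sup>2) * ell_gamma_pm q p (t\<^sup>2 * tr 0 * tr 1 * tr 2) y) *
     (\<Prod>k=1..m. ell_gamma_pm q p (T k * u k) y / ell_gamma_pm q p (T k * (s k)\<^sup>2 * u k) y)"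

lemma prod_0_2: "(\<Prod>r=0..2. f r) = f 0 * f 1 * f (2::nat)" for f :: "nat \<Rightarrow> complex"
  by (simp add: numeral_2_eq_2 prod.atLeast0_atMost_Suc)

lemma source_algebra:
  fixes A :: complex
  assumes "A \<noteq> 0" "h1 \<noteq> 0" "h2 \<noteq> 0" "h3 \<noteq> 0" "g1 \<noteq> 0" "g2 \<noteq> 0" "g3 \<noteq> 0"
  shows "x0 * x0' * (x1 * x1') * (x2 * x2') / (y * y') = 1 / A * (g1 / h1 * (g2 / h2) * (g3 / h3)) *
    (A * x0 * x1 * x2 * x0' * x1' * x2' * h1 * h2 * h3 / (y' * y * g3 * g2 * g1))"
  using assms by (cases "y = 0"; cases "y' = 0"; simp add: field_simps)

text \<open>No integrability is asked for: the totalised integral respects scalars in any case. So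
  constants move through iterated integrals freely.\<close>

lemma contour_integral_cmult: "contour_integral \<gamma> (\<lambda>z. c * f z) = c * contour_integral \<gamma> f"
  by (simp add: contour_integral_integral mult.assoc)

context
  fixes q p :: complex
  assumes q: "norm q < 1" and p: "norm p < 1"
begin

lemma ell_gamma_pm_pm_eq:
  "ell_gamma_pm_pm q p a z x = ell_gamma_pm q p (a * z) x * ell_gamma_pm q p (a / z) x"
  by (simp add: ell_gamma_pm_pm_def ell_gamma_pm_def divide_inverse mult_ac)

lemma ell_gamma_pm_pm_commute:
  "ell_gamma_pm_pm q p a z x = ell_gamma_pm_pm q p a x z"
  by (simp add: ell_gamma_pm_pm_def mult_ac)

lemma elliptic_beta_integral:
  assumes "beta_domain q p a b c d e"
  shows "kappa q p * contour_integral (circlepath 0 1) (\<lambda>z.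
     (ell_gamma_pm q p a z * ell_gamma_pm q p b z * ell_gamma_pm q p c z * ell_gamma_pm q p d z *
      ell_gamma_pm q p e z) / (ell_gamma_pm q p 1 (z\<^sup>2) * ell_gamma_pm q p (a * b * c * d * e) z) / z)
    = beta_value q p a b c d e"
proof -
  have "contour_integral (circlepath 0 1) (\<lambda>z.
     (ell_gamma_pm q p a z * ell_gamma_pm q p b z * ell_gamma_pm q p c z * ell_gamma_pm q p d z *
      ell_gamma_pm q p e z) / (ell_gamma_pm q p 1 (z\<^sup>2) * ell_gamma_pm q p (a * b * c * d * e) z) / z)
    = beta_integral q p a b c d e"
    unfolding beta_integral_def
    by (rule contour_integral_cong) (simp_all add: beta_integrand_def beta_weight_eq[OF q p])
  then show ?thesis using beta_evaluation[OF q p assms] by simp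
qed

text \<open>The beta integral at T y, T / y, s w, s / w, u, whose product T^2 s^2 u is the
  denominator parameter of the kernel. In its value, Gamma(s u w, s u / w) over Gamma(T^2 s u w, T^2
  s u / w) cancels the prefactor in \<open>w\<close>.\<close>

lemma star_triangle:
  assumes n: "norm T < 1" "norm s < 1" "norm u < 1" and lower: "norm (p * q) < norm (T\<^sup>2 * s\<^sup>2 * u)"
    and w: "norm w = 1" and y: "norm y = 1"
  shows "kappa q p * contour_integral (circlepath 0 1)
      (\<lambda>z. fold_kernel q p T s u z w * ell_gamma_pm_pm q p T z y / z) =
    ell_gamma q p (T\<^sup>2) * ell_gamma q p (s\<^sup>2) / ell_gamma q p (T\<^sup>2 * s\<^sup>2) *
    (ell_gamma_pm_pm q p (T * s) w y * (ell_gamma_pm q p (T * u) y / ell_gamma_pm q p (T * s\<^sup>2 * u) y))"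
proof -
  have nz: "w \<noteq> 0" "y \<noteq> 0" using w y by auto
  have A: "T * y * (T / y) * (s * w) * (s / w) * u = T\<^sup>2 * s\<^sup>2 * u"
    using nz by (simp add: power2_eq_square)
  have dom: "beta_domain q p (T * y) (T / y) (s * w) (s / w) u"
    unfolding beta_domain_def A using n w y lower by (simp add: norm_mult norm_divide)
  note P = beta_domain_products[OF dom]
  have lt: "norm (p * q) < norm (s * u)" "norm (s * u) < 1"
    "norm (p * q) < norm (T\<^sup>2 * s * u)" "norm (T\<^sup>2 * s * u) < 1"
  proof -
    have "T\<^sup>2 * s\<^sup>2 * u = (s * u) * (T * T * s)" "T\<^sup>2 * s\<^sup>2 * u = (T\<^sup>2 * s * u) * s"
      by (simp_all add: power2_eq_square)
    then show "norm (p * q) < norm (s * u)" "norm (p * q) < norm (T\<^sup>2 * s * u)"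
      using lower n norm_mult_less_one norm_mult_lower by metis+
    show "norm (s * u) < 1" "norm (T\<^sup>2 * s * u) < 1"
      unfolding power2_eq_square by (intro norm_mult_less_one n)+
  qed
  have g0: "ell_gamma_pm q p (s * u) w \<noteq> 0" "ell_gamma_pm q p (T\<^sup>2 * s * u) w \<noteq> 0"
    using lt w by (simp_all add: ell_gamma_pm_nonzero[OF q p])
  define c where "c = ell_gamma_pm q p (T\<^sup>2 * s * u) w / ell_gamma_pm q p (s * u) w"
  have "contour_integral (circlepath 0 1) (\<lambda>z. fold_kernel q p T s u z w * ell_gamma_pm_pm q p T z y / z) =
    contour_integral (circlepath 0 1) (\<lambda>z. c *
     ((ell_gamma_pm q p (T * y) z * ell_gamma_pm q p (T / y) z * ell_gamma_pm q p (s * w) z * ell_gamma_pm q p (s / w) z *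
      ell_gamma_pm q p u z) / (ell_gamma_pm q p 1 (z\<^sup>2) * ell_gamma_pm q p (T * y * (T / y) * (s * w) * (s / w) * u) z) / z))"
    unfolding A fold_kernel_def c_def ell_gamma_pm_pm_commute[of T _ y]
    unfolding ell_gamma_pm_pm_eq
    by (simp add: mult_ac)
  then have "kappa q p * contour_integral (circlepath 0 1) (\<lambda>z. fold_kernel q p T s u z w * ell_gamma_pm_pm q p T z y / z) =
      c * beta_value q p (T * y) (T / y) (s * w) (s / w) u"
    unfolding contour_integral_cmult elliptic_beta_integral[OF dom, symmetric] by simp
  also have "\<dots> = ell_gamma q p (T\<^sup>2) * ell_gamma q p (s\<^sup>2) / ell_gamma q p (T\<^sup>2 * s\<^sup>2) *
    (ell_gamma_pm_pm q p (T * s) w y * (ell_gamma_pm q p (T * u) y / ell_gamma_pm q p (T * s\<^sup>2 * u) y))"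
  proof -
    have e: "T * y * (T / y) = T\<^sup>2" "s * w * (s / w) = s\<^sup>2" "T * y * (s * w) = T * s * w * y"
      "T * y * (s / w) = T * s * inverse w * y" "T / y * (s * w) = T * s * w * inverse y"
      "T / y * (s / w) = T * s * inverse w * inverse y" "T * y * u = T * u * y" "T / y * u = T * u * inverse y"
      "s * w * u = s * u * w" "s / w * u = s * u * inverse w"
      "T * s * w * inverse y * (s / w) * u = T * s\<^sup>2 * u * inverse y"
      "T * s * w * y * (s / w) * u = T * s\<^sup>2 * u * y"
      "T\<^sup>2 * (s / w) * u = T\<^sup>2 * s * u * inverse w" "T\<^sup>2 * (s * w) * u = T\<^sup>2 * s * u * w"
      "T\<^sup>2 * (s * w) * (s / w) = T\<^sup>2 * s\<^sup>2"
      using nz by (simp_all add: power2_eq_square field_simps)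
    show ?thesis
      using g0 unfolding c_def beta_value_def e ell_gamma_pm_pm_def ell_gamma_pm_def
      by (simp add: divide_inverse mult_ac) (auto simp: field_simps)
  qed
  finally show ?thesis .
qed

lemma continuous_on_ell_gamma_pm_sphere:
  "norm a < 1 \<Longrightarrow> a \<noteq> 0 \<Longrightarrow> continuous_on (sphere 0 1) (ell_gamma_pm q p a)"
  using ell_gamma_pm_continuous[OF q p, of "sphere 0 1" "\<lambda>_. a" "\<lambda>z. z"] by simp

lemma continuous_on_inverse_ell_gamma_pm_sphere:
  assumes "norm a < 1" "norm (p * q) < norm a"
  shows "continuous_on (sphere 0 1) (\<lambda>z. 1 / ell_gamma_pm q p a z)"
proof -
  have "a \<noteq> 0" using assms(2) not_less[of "norm (p * q)" 0] by auto
  then show ?thesis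
    using assms by (intro continuous_on_divide continuous_on_const continuous_on_ell_gamma_pm_sphere)
      (auto simp: ell_gamma_pm_nonzero[OF q p])
qed

lemma continuous_on_reciprocal_weight_sphere:
  "continuous_on (sphere 0 1) (\<lambda>z. 1 / ell_gamma_pm q p 1 (z\<^sup>2))"
proof -
  have "continuous_on (sphere 0 1) (\<lambda>z. beta_weight q p z)"
    by (intro beta_weight_continuous[OF q p] continuous_on_id) simp
  then show ?thesis by (rule continuous_on_eq) (simp add: beta_weight_eq[OF q p])
qed

lemma continuous_on_fold_kernel:
  assumes "norm T < 1" "norm s < 1" "norm u < 1" "norm (p * q) < norm (T\<^sup>2 * s\<^sup>2 * u)" "norm w = 1"
  shows "continuous_on (sphere 0 1) (\<lambda>z. fold_kernel q p T s u z w)"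
proof -
  have nz: "s \<noteq> 0" "u \<noteq> 0" "w \<noteq> 0" using assms(4,5) not_less[of "norm (p * q)" 0] by auto
  have c: "continuous_on (sphere 0 1) (\<lambda>z. ell_gamma_pm q p a z)" if "a \<in> {s * w, s / w, u}" for a
    by (rule continuous_on_ell_gamma_pm_sphere) (use that assms nz in \<open>auto simp: norm_mult norm_divide\<close>)
  have "norm (T\<^sup>2 * s\<^sup>2 * u) < 1"
    unfolding power2_eq_square by (intro norm_mult_less_one assms)
  then have d: "continuous_on (sphere 0 1) (\<lambda>z. 1 / ell_gamma_pm q p (T\<^sup>2 * s\<^sup>2 * u) z)"
    by (intro continuous_on_inverse_ell_gamma_pm_sphere assms(4))
  have "(\<lambda>z. fold_kernel q p T s u z w) = (\<lambda>z. ell_gamma_pm q p (T\<^sup>2 * s * u) w / ell_gamma_pm q p (s * u) w *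
     (ell_gamma_pm q p (s * w) z * ell_gamma_pm q p (s / w) z * ell_gamma_pm q p u z) *
     (1 / ell_gamma_pm q p 1 (z\<^sup>2)) * (1 / ell_gamma_pm q p (T\<^sup>2 * s\<^sup>2 * u) z))"
    by (simp add: fun_eq_iff fold_kernel_def ell_gamma_pm_pm_eq)
  then show ?thesis
    by (simp only:) (intro continuous_on_mult continuous_on_const c d continuous_on_reciprocal_weight_sphere; simp)
qed

lemma continuous_on_fold_weight:
  assumes tr: "\<And>r. r \<in> {0..2} \<Longrightarrow> norm (tr r) < 1" and t: "norm t < 1"
    and low: "norm (p * q) < norm (t\<^sup>2 * tr 0 * tr 1 * tr 2)"
    and k: "\<And>k. k \<in> {1..m} \<Longrightarrow> norm (T k) < 1 \<and> norm (s k) < 1 \<and> norm (u k) < 1 \<and>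
      norm (p * q) < norm ((T k)\<^sup>2 * (s k)\<^sup>2 * u k)"
  shows "continuous_on (sphere 0 1) (\<lambda>y. fold_weight q p t tr T s u m y)"
proof -
  have tr0: "tr r \<noteq> 0" if "r \<in> {0..2}" for r
  proof -
    have "r = 0 \<or> r = 1 \<or> r = 2" using that by auto
    then show ?thesis using low not_less[of "norm (p * q)" 0] by auto
  qed
  have "norm (t\<^sup>2 * tr 0 * tr 1 * tr 2) < 1"
    unfolding power2_eq_square by (intro norm_mult_less_one t tr) auto
  then have d: "continuous_on (sphere 0 1) (\<lambda>z. 1 / ell_gamma_pm q p (t\<^sup>2 * tr 0 * tr 1 * tr 2) z)"
    by (intro continuous_on_inverse_ell_gamma_pm_sphere low)
  have f: "continuous_on (sphere 0 1) (\<lambda>y. ell_gamma_pm q p (T k * u k) y / ell_gamma_pm q p (T k * (s k)\<^sup>2 * u k) y)"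
    if "k \<in> {1..m}" for k
  proof -
    note k = k[OF that]
    have nz: "T k \<noteq> 0" "u k \<noteq> 0" using k not_less[of "norm (p * q)" 0] by auto
    have lt: "norm (T k * u k) < 1" "norm (T k * (s k)\<^sup>2 * u k) < 1"
      unfolding power2_eq_square using k by (intro norm_mult_less_one; simp)+
    have "(T k)\<^sup>2 * (s k)\<^sup>2 * u k = (T k * (s k)\<^sup>2 * u k) * T k" by (simp add: power2_eq_square)
    then have "norm (p * q) < norm (T k * (s k)\<^sup>2 * u k)" using k norm_mult_lower by metis
    then have "continuous_on (sphere 0 1) (\<lambda>y. ell_gamma_pm q p (T k * u k) y * (1 / ell_gamma_pm q p (T k * (s k)\<^sup>2 * u k) y))"
      using lt nz by (intro continuous_on_mult continuous_on_inverse_ell_gamma_pm_sphere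
          continuous_on_ell_gamma_pm_sphere) auto
    then show ?thesis by simp
  qed
  have "(\<lambda>y. fold_weight q p t tr T s u m y) = (\<lambda>y. (\<Prod>r=0..2. ell_gamma_pm q p (tr r) y) *
     ((1 / ell_gamma_pm q p 1 (y\<^sup>2)) * (1 / ell_gamma_pm q p (t\<^sup>2 * tr 0 * tr 1 * tr 2) y)) *
     (\<Prod>k=1..m. ell_gamma_pm q p (T k * u k) y / ell_gamma_pm q p (T k * (s k)\<^sup>2 * u k) y))"
    by (simp add: fun_eq_iff fold_weight_def)
  then show ?thesis
    using tr tr0 by (simp only:)
      (intro continuous_on_mult continuous_on_prod continuous_on_ell_gamma_pm_sphere d f
        continuous_on_reciprocal_weight_sphere)
qed

text \<open>The beta integral at t x, t / x, t_0, t_1, t_2 read backwards; all pairings free of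
  \<open>x\<close> are collected in the prefactor.\<close>

lemma source_identity:
  assumes tr: "\<And>r. r \<in> {0..2} \<Longrightarrow> norm (tr r) < 1" and t: "norm t < 1"
    and low: "norm (p * q) < norm (t\<^sup>2 * tr 0 * tr 1 * tr 2)" and x: "norm x = 1"
  shows "(\<Prod>r=0..2. ell_gamma_pm q p (t * tr r) x) / ell_gamma_pm q p (t * tr 0 * tr 1 * tr 2) x =
    kappa q p * (1 / ell_gamma q p (t\<^sup>2) *
      (ell_gamma q p (t\<^sup>2 * tr 0 * tr 1) / ell_gamma q p (tr 0 * tr 1) *
       (ell_gamma q p (t\<^sup>2 * tr 0 * tr 2) / ell_gamma q p (tr 0 * tr 2)) *
       (ell_gamma q p (t\<^sup>2 * tr 1 * tr 2) / ell_gamma q p (tr 1 * tr 2)))) *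
    contour_integral (circlepath 0 1) (\<lambda>y. ell_gamma_pm_pm q p t x y * fold_weight q p t tr T s u 0 y / y)"
proof -
  have nz: "x \<noteq> 0" using x by auto
  have A: "t * x * (t / x) * tr 0 * tr 1 * tr 2 = t\<^sup>2 * tr 0 * tr 1 * tr 2"
    using nz by (simp add: power2_eq_square)
  have dom: "beta_domain q p (t * x) (t / x) (tr 0) (tr 1) (tr 2)"
    unfolding beta_domain_def A using tr t x low by (simp add: norm_mult norm_divide)
  note P = beta_domain_products[OF dom]
  have e: "t * x * (t / x) = t\<^sup>2" "t * x * tr r = t * tr r * x" "t / x * tr r = t * tr r * inverse x"
    "t * tr 0 * inverse x * tr 1 * tr 2 = t * tr 0 * tr 1 * tr 2 * inverse x"
    "t * tr 0 * x * tr 1 * tr 2 = t * tr 0 * tr 1 * tr 2 * x" for r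
    using nz by (simp_all add: power2_eq_square field_simps)
  have g: "ell_gamma q p z \<noteq> 0" if "z \<in> {z. norm (p * q) < norm z \<and> norm z < 1}" for z
    using that ell_gamma_nonzero[OF q p] by simp
  note g0 = P[THEN g, unfolded e]
  have "contour_integral (circlepath 0 1) (\<lambda>y. ell_gamma_pm_pm q p t x y * fold_weight q p t tr T s u 0 y / y)
    = contour_integral (circlepath 0 1) (\<lambda>z.
     (ell_gamma_pm q p (t * x) z * ell_gamma_pm q p (t / x) z * ell_gamma_pm q p (tr 0) z * ell_gamma_pm q p (tr 1) z *
      ell_gamma_pm q p (tr 2) z) / (ell_gamma_pm q p 1 (z\<^sup>2) * ell_gamma_pm q p (t * x * (t / x) * tr 0 * tr 1 * tr 2) z) / z)"
    unfolding A fold_weight_def prod_0_2 ell_gamma_pm_pm_eq by (simp add: mult_ac)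
  then have 1: "kappa q p * contour_integral (circlepath 0 1) (\<lambda>y. ell_gamma_pm_pm q p t x y * fold_weight q p t tr T s u 0 y / y)
      = beta_value q p (t * x) (t / x) (tr 0) (tr 1) (tr 2)"
    using elliptic_beta_integral[OF dom] by simp
  have 2: "(\<Prod>r=0..2. ell_gamma_pm q p (t * tr r) x) / ell_gamma_pm q p (t * tr 0 * tr 1 * tr 2) x =
    (1 / ell_gamma q p (t\<^sup>2) *
      (ell_gamma q p (t\<^sup>2 * tr 0 * tr 1) / ell_gamma q p (tr 0 * tr 1) *
       (ell_gamma q p (t\<^sup>2 * tr 0 * tr 2) / ell_gamma q p (tr 0 * tr 2)) *
       (ell_gamma q p (t\<^sup>2 * tr 1 * tr 2) / ell_gamma q p (tr 1 * tr 2)))) *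
    beta_value q p (t * x) (t / x) (tr 0) (tr 1) (tr 2)"
    unfolding beta_value_def e prod_0_2 ell_gamma_pm_def by (rule source_algebra[OF g0(1,8,9,10,15,14,13)])
  show ?thesis unfolding 2 1[symmetric] by (simp only: mult_ac)
qed

section \<open>Integrating out the torus variables by induction\<close>

lemma torus_integral_mult:
  assumes "\<And>x i z. i \<in> {1..m} \<Longrightarrow> c (x(i := z)) = c x"
  shows "torus_integral m (\<lambda>x. c x * F x) x = c x * torus_integral m F x"
  using assms
proof (induction m arbitrary: x)
  case (Suc m)
  then have "torus_integral (Suc m) (\<lambda>x. c x * F x) x =
      contour_integral (circlepath 0 1) (\<lambda>z. c (x(Suc m := z)) * torus_integral m F (x(Suc m := z)))"
    by simp
  also have "\<dots> = contour_integral (circlepath 0 1) (\<lambda>z. c x * torus_integral m F (x(Suc m := z)))"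
  proof -
    have "c (x(Suc m := z)) = c x" for z by (rule Suc.prems) simp
    then show ?thesis by (simp only:)
  qed
  finally show ?case by (simp add: contour_integral_cmult)
qed simp

text \<open>The products t s_1 ... s_(k-1) enter as a sequence \<open>T\<close> with a recursion.
  Induction removes the outermost variable: the hypothesis for \<open>m\<close> is inserted, Fubini
  is applied, and \<open>star_triangle\<close> performs the remaining inner integral.\<close>

lemma fold_identity:
  fixes tr s u T x :: "nat \<Rightarrow> complex"
  assumes tr: "\<And>r. r \<in> {0..2} \<Longrightarrow> norm (tr r) < 1" and t: "norm t < 1"
    and low: "norm (p * q) < norm (t\<^sup>2 * tr 0 * tr 1 * tr 2)" and T1: "T 1 = t"
    and k: "\<And>k. k \<in> {1..m} \<Longrightarrow> norm (s k) < 1 \<and> norm (u k) < 1 \<and> T (Suc k) = T k * s k \<and>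
      norm (p * q) < norm ((T k)\<^sup>2 * (s k)\<^sup>2 * u k)"
    and x: "norm (x (Suc m)) = 1"
  defines "R \<equiv> 1 / ell_gamma q p (t\<^sup>2) *
      (ell_gamma q p (t\<^sup>2 * tr 0 * tr 1) / ell_gamma q p (tr 0 * tr 1) *
       (ell_gamma q p (t\<^sup>2 * tr 0 * tr 2) / ell_gamma q p (tr 0 * tr 2)) *
       (ell_gamma q p (t\<^sup>2 * tr 1 * tr 2) / ell_gamma q p (tr 1 * tr 2)))"
  shows "kappa q p ^ m *
     (\<Prod>k=1..m. ell_gamma q p ((T (Suc k))\<^sup>2) / (ell_gamma q p ((s k)\<^sup>2) * ell_gamma q p ((T k)\<^sup>2))) *
     torus_integral m (\<lambda>x. (\<Prod>r=0..2. ell_gamma_pm q p (t * tr r) (x 1)) /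
          ell_gamma_pm q p (t * tr 0 * tr 1 * tr 2) (x 1) *
          (\<Prod>k=1..m. fold_kernel q p (T k) (s k) (u k) (x k) (x (Suc k))) * (\<Prod>l=1..m. 1 / x l)) x
    = kappa q p * R * contour_integral (circlepath 0 1)
       (\<lambda>y. ell_gamma_pm_pm q p (T (Suc m)) (x (Suc m)) y * fold_weight q p t tr T s u m y / y)"
  using k x
proof (induction m arbitrary: x)
  case 0
  then show ?case
    using source_identity[OF tr t low, of "x 1" T s u] by (simp add: T1[unfolded One_nat_def] R_def)
next
  case (Suc m)
  let ?\<gamma> = "circlepath 0 1 :: real \<Rightarrow> complex"
  define a where "a = T (Suc m)"
  define b where "b = s (Suc m)"
  define v where "v = u (Suc m)"
  define w where "w = x (Suc (Suc m))"
  have w: "norm w = 1" using Suc.prems(2) by (simp add: w_def)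
  have abv: "norm b < 1" "norm v < 1" "T (Suc (Suc m)) = a * b" "norm (p * q) < norm (a\<^sup>2 * b\<^sup>2 * v)"
    using Suc.prems(1)[of "Suc m"] by (simp_all add: a_def b_def v_def)
  \<comment> \<open>The index is shifted because the recursion starts at \<open>T 1\<close>; nothing
    is known about \<open>T 0\<close>.\<close>
  have normT: "norm (T (Suc k)) < 1" if "k \<le> m" for k
    using that
  proof (induction k)
    case 0
    then show ?case using T1 t by simp
  next
    case (Suc k)
    then have "T (Suc (Suc k)) = T (Suc k) * s (Suc k)" "norm (s (Suc k)) < 1"
      using \<open>\<And>k. k \<in> {1..Suc m} \<Longrightarrow> _\<close>[of "Suc k"] by auto
    then show ?case using Suc norm_mult_less_one by simp
  qed
  have a: "norm a < 1" using normT[of m] by (simp add: a_def)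
  define L where "L = (\<lambda>x. (\<Prod>r=0..2. ell_gamma_pm q p (t * tr r) (x 1)) /
          ell_gamma_pm q p (t * tr 0 * tr 1 * tr 2) (x 1) *
          (\<Prod>k=1..m. fold_kernel q p (T k) (s k) (u k) (x k) (x (Suc k))) * (\<Prod>l=1..m. 1 / x l))"
  define P where "P = (\<Prod>k=1..m. ell_gamma q p ((T (Suc k))\<^sup>2) / (ell_gamma q p ((s k)\<^sup>2) * ell_gamma q p ((T k)\<^sup>2)))"
  define P' where "P' = ell_gamma q p (a\<^sup>2 * b\<^sup>2) / (ell_gamma q p (b\<^sup>2) * ell_gamma q p (a\<^sup>2))"
  define K where "K = (\<lambda>z. fold_kernel q p a b v z w)"
  define W where "W = fold_weight q p t tr T s u m"
  define G where "G = (\<lambda>z y. ell_gamma_pm_pm q p a z y)"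
  \<comment> \<open>The integration variable x_(m+1) becomes the boundary point of the smaller
    identity, so only points of the circle are needed.\<close>
  have IH: "kappa q p ^ m * P * torus_integral m L (x(Suc m := z)) =
      kappa q p * R * contour_integral ?\<gamma> (\<lambda>y. G z y * W y / y)" if "norm z = 1" for z
  proof -
    have "kappa q p ^ m * P * torus_integral m L (x(Suc m := z)) = kappa q p * R * contour_integral ?\<gamma>
       (\<lambda>y. ell_gamma_pm_pm q p (T (Suc m)) ((x(Suc m := z)) (Suc m)) y * fold_weight q p t tr T s u m y / y)"
      unfolding L_def P_def by (rule Suc.IH) (use Suc.prems(1) that in auto)
    then show ?thesis by (simp only: fun_upd_same G_def W_def a_def)
  qed
  have t1: "torus_integral (Suc m) (\<lambda>x. (\<Prod>r=0..2. ell_gamma_pm q p (t * tr r) (x 1)) /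
          ell_gamma_pm q p (t * tr 0 * tr 1 * tr 2) (x 1) *
          (\<Prod>k=1..Suc m. fold_kernel q p (T k) (s k) (u k) (x k) (x (Suc k))) * (\<Prod>l=1..Suc m. 1 / x l)) x
      = contour_integral ?\<gamma> (\<lambda>z. K z / z * torus_integral m L (x(Suc m := z)))"
  proof -
    \<comment> \<open>This factor depends on x_(m+1) and x_(m+2) alone and therefore leaves the
      inner integral over x_1, ..., x_m.\<close>
    define c where "c = (\<lambda>x. fold_kernel q p a b v (x (Suc m)) (x (Suc (Suc m))) / x (Suc m))"
    have c: "torus_integral m (\<lambda>x. c x * L x) y = c y * torus_integral m L y" for y
      by (rule torus_integral_mult) (auto simp: c_def)
    have E: "(\<lambda>x. (\<Prod>r=0..2. ell_gamma_pm q p (t * tr r) (x 1)) /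
          ell_gamma_pm q p (t * tr 0 * tr 1 * tr 2) (x 1) *
          (\<Prod>k=1..Suc m. fold_kernel q p (T k) (s k) (u k) (x k) (x (Suc k))) * (\<Prod>l=1..Suc m. 1 / x l))
       = (\<lambda>x. c x * L x)"
      by (simp add: fun_eq_iff L_def a_def b_def v_def c_def mult_ac)
    show ?thesis
      unfolding torus_integral.simps E c by (simp add: c_def K_def w_def)
  qed
  have cK: "continuous_on (sphere 0 1) K"
    unfolding K_def by (intro continuous_on_fold_kernel a abv w)
  have cW: "continuous_on (sphere 0 1) W"
    unfolding W_def
  proof (rule continuous_on_fold_weight[OF tr t low])
    fix k assume "k \<in> {1..m}"
    then show "norm (T k) < 1 \<and> norm (s k) < 1 \<and> norm (u k) < 1 \<and> norm (p * q) < norm ((T k)\<^sup>2 * (s k)\<^sup>2 * u k)"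
      using Suc.prems(1)[of k] normT[of "k - 1"] by auto
  qed
  have a0: "a \<noteq> 0" using abv(4) not_less[of "norm (p * q)" 0] by auto
  define SS where "SS = sphere (0::complex) 1 \<times> sphere (0::complex) 1"
  have cont: "continuous_on SS (\<lambda>x. K (fst x) / fst x * (G (fst x) (snd x) * W (snd x) / snd x))"
  proof -
    have n: "norm (fst x) = 1" "norm (snd x) = 1" "fst x \<noteq> 0" "snd x \<noteq> 0" if "x \<in> SS" for x
      using that by (auto simp: SS_def)
    note f = continuous_on_fst[OF continuous_on_id] continuous_on_snd[OF continuous_on_id]
    have 1: "continuous_on SS (\<lambda>x. K (fst x))"
      by (rule continuous_on_compose2[OF cK f(1)]) (auto simp: SS_def)
    have 2: "continuous_on SS (\<lambda>x. W (snd x))"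
      by (rule continuous_on_compose2[OF cW f(2)]) (auto simp: SS_def)
    have 3: "continuous_on SS (\<lambda>x. ell_gamma_pm q p (a * fst x) (snd x))"
      "continuous_on SS (\<lambda>x. ell_gamma_pm q p (a / fst x) (snd x))"
      by (rule ell_gamma_pm_continuous[OF q p];
          use n a a0 in \<open>auto intro!: continuous_on_mult continuous_on_divide continuous_on_const f simp: norm_mult norm_divide\<close>)+
    have 4: "\<forall>x\<in>SS. fst x \<noteq> 0" "\<forall>x\<in>SS. snd x \<noteq> 0" using n by auto
    show ?thesis
      unfolding G_def ell_gamma_pm_pm_eq
      by (intro continuous_on_mult continuous_on_divide 1 2 3 4 f)
  qed
  have gn: "ell_gamma q p (a\<^sup>2) \<noteq> 0" "ell_gamma q p (b\<^sup>2) \<noteq> 0" "ell_gamma q p (a\<^sup>2 * b\<^sup>2) \<noteq> 0"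
  proof -
    have lt: "norm (a\<^sup>2) < 1" "norm (b\<^sup>2) < 1" "norm (a\<^sup>2 * b\<^sup>2) < 1"
      unfolding power2_eq_square by (intro norm_mult_less_one a abv)+
    have l1: "norm (p * q) < norm (a\<^sup>2 * b\<^sup>2)" using norm_mult_lower abv by blast
    then have "norm (p * q) < norm (a\<^sup>2)" "norm (p * q) < norm (b\<^sup>2)"
      using norm_mult_lower lt mult.commute by metis+
    then show "ell_gamma q p (a\<^sup>2) \<noteq> 0" "ell_gamma q p (b\<^sup>2) \<noteq> 0" "ell_gamma q p (a\<^sup>2 * b\<^sup>2) \<noteq> 0"
      using l1 lt by (simp_all add: ell_gamma_nonzero[OF q p])
  qed
  have inner: "kappa q p * (P' * contour_integral ?\<gamma> (\<lambda>z. K z / z * (G z y * W y / y))) =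
     ell_gamma_pm_pm q p (a * b) w y * fold_weight q p t tr T s u (Suc m) y / y" if y: "norm y = 1" for y
  proof -
    have "contour_integral ?\<gamma> (\<lambda>z. K z / z * (G z y * W y / y)) =
        contour_integral ?\<gamma> (\<lambda>z. W y / y * (K z * G z y / z))"
      by (simp add: mult_ac)
    also have "\<dots> = W y / y * contour_integral ?\<gamma> (\<lambda>z. K z * G z y / z)"
      by (rule contour_integral_cmult)
    finally have "kappa q p * (P' * contour_integral ?\<gamma> (\<lambda>z. K z / z * (G z y * W y / y))) =
      P' * (W y / y) * (kappa q p * contour_integral ?\<gamma> (\<lambda>z. K z * G z y / z))" by (simp add: mult_ac)
    also have "kappa q p * contour_integral ?\<gamma> (\<lambda>z. K z * G z y / z) =
      ell_gamma q p (a\<^sup>2) * ell_gamma q p (b\<^sup>2) / ell_gamma q p (a\<^sup>2 * b\<^sup>2) *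
      (ell_gamma_pm_pm q p (a * b) w y * (ell_gamma_pm q p (a * v) y / ell_gamma_pm q p (a * b\<^sup>2 * v) y))"
      unfolding K_def G_def by (rule star_triangle[OF a abv(1,2,4) w y])
    also have "P' * (W y / y) * \<dots> = W y * (ell_gamma_pm q p (a * v) y / ell_gamma_pm q p (a * b\<^sup>2 * v) y) *
        ell_gamma_pm_pm q p (a * b) w y / y"
    proof -
      \<comment> \<open>The last factor of the prefactor is the reciprocal of the star-triangle
        constant.\<close>
      have "P' * (ell_gamma q p (a\<^sup>2) * ell_gamma q p (b\<^sup>2) / ell_gamma q p (a\<^sup>2 * b\<^sup>2)) = 1"
        using gn by (simp add: P'_def)
      moreover have "P' * (W y / y) * (g * (h * k)) = P' * g * (W y * k * h / y)" for g h k
        by (simp add: mult_ac)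
      ultimately show ?thesis by (simp only: mult_1_left)
    qed
    also have "W y * (ell_gamma_pm q p (a * v) y / ell_gamma_pm q p (a * b\<^sup>2 * v) y) = fold_weight q p t tr T s u (Suc m) y"
      by (simp add: W_def fold_weight_def a_def b_def v_def)
    finally show ?thesis by (simp add: mult_ac)
  qed
  have "kappa q p ^ m * P * contour_integral ?\<gamma> (\<lambda>z. K z / z * torus_integral m L (x(Suc m := z)))
     = contour_integral ?\<gamma> (\<lambda>z. kappa q p ^ m * P * (K z / z * torus_integral m L (x(Suc m := z))))"
    by (rule contour_integral_cmult[symmetric])
  also have "\<dots> = contour_integral ?\<gamma> (\<lambda>z. kappa q p * R * contour_integral ?\<gamma> (\<lambda>y. K z / z * (G z y * W y / y)))"
  proof (rule contour_integral_cong[OF refl])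
    fix z assume "z \<in> path_image ?\<gamma>"
    then have "norm z = 1" by simp
    have "kappa q p ^ m * P * (K z / z * torus_integral m L (x(Suc m := z))) =
        K z / z * (kappa q p ^ m * P * torus_integral m L (x(Suc m := z)))" by (simp add: mult_ac)
    also have "\<dots> = kappa q p * R * (K z / z * contour_integral ?\<gamma> (\<lambda>y. G z y * W y / y))"
      unfolding IH[OF \<open>norm z = 1\<close>] by (simp add: mult_ac)
    finally show "kappa q p ^ m * P * (K z / z * torus_integral m L (x(Suc m := z))) =
        kappa q p * R * contour_integral ?\<gamma> (\<lambda>y. K z / z * (G z y * W y / y))"
      by (simp only: contour_integral_cmult)
  qed
  also have "\<dots> = kappa q p * R * contour_integral ?\<gamma> (\<lambda>z. contour_integral ?\<gamma> (\<lambda>y. K z / z * (G z y * W y / y)))"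
    by (rule contour_integral_cmult)
  also have "contour_integral ?\<gamma> (\<lambda>z. contour_integral ?\<gamma> (\<lambda>y. K z / z * (G z y * W y / y))) =
      contour_integral ?\<gamma> (\<lambda>y. contour_integral ?\<gamma> (\<lambda>z. K z / z * (G z y * W y / y)))"
    by (rule contour_integral_swap)
      (use cont in \<open>simp_all add: SS_def case_prod_unfold continuous_vector_derivative_circlepath\<close>)
  finally have main: "kappa q p ^ m * P * contour_integral ?\<gamma> (\<lambda>z. K z / z * torus_integral m L (x(Suc m := z))) =
    kappa q p * R * contour_integral ?\<gamma> (\<lambda>y. contour_integral ?\<gamma> (\<lambda>z. K z / z * (G z y * W y / y)))" .
  have "kappa q p * P' * contour_integral ?\<gamma> (\<lambda>y. contour_integral ?\<gamma> (\<lambda>z. K z / z * (G z y * W y / y)))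
     = contour_integral ?\<gamma> (\<lambda>y. kappa q p * P' * contour_integral ?\<gamma> (\<lambda>z. K z / z * (G z y * W y / y)))"
    by (rule contour_integral_cmult[symmetric])
  also have "\<dots> = contour_integral ?\<gamma> (\<lambda>y. ell_gamma_pm_pm q p (a * b) w y * fold_weight q p t tr T s u (Suc m) y / y)"
    by (rule contour_integral_cong[OF refl]) (use inner in \<open>simp add: mult.assoc\<close>)
  finally have outer: "kappa q p * P' * contour_integral ?\<gamma> (\<lambda>y. contour_integral ?\<gamma> (\<lambda>z. K z / z * (G z y * W y / y)))
     = contour_integral ?\<gamma> (\<lambda>y. ell_gamma_pm_pm q p (a * b) w y * fold_weight q p t tr T s u (Suc m) y / y)" .
  have PS: "(\<Prod>k=1..Suc m. ell_gamma q p ((T (Suc k))\<^sup>2) / (ell_gamma q p ((s k)\<^sup>2) * ell_gamma q p ((T k)\<^sup>2))) = P * P'"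
    using abv(3) by (simp add: P_def P'_def a_def b_def power_mult_distrib mult.commute)
  show ?case
    unfolding t1 PS abv(3) w_def[symmetric] outer[symmetric]
    using arg_cong[OF main, of "\<lambda>c. kappa q p * P' * c"] by (simp only: power_Suc mult_ac)
qed

end

theorem mainTheorem3:
  fixes q p t :: complex
    and tr s u x :: "nat \<Rightarrow> complex"
    and m :: nat
  assumes "norm q < 1" and "norm p < 1"
    and "m \<ge> 1"
    and "norm t < 1"
    and "\<And>r. r \<in> {0..2} \<Longrightarrow> norm (tr r) < 1"
    and "\<And>k. k \<in> {1..m} \<Longrightarrow> norm (s k) < 1"
    and "\<And>k. k \<in> {1..m} \<Longrightarrow> norm (u k) < 1"
    and "norm (p * q) < norm (t\<^sup>2 * tr 0 * tr 1 * tr 2)"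
    and "\<And>k. k \<in> {1..m} \<Longrightarrow> norm (p * q) < norm (t\<^sup>2 * (\<Prod>l=1..k. (s l)\<^sup>2) * u k)"
    and "norm (x (m + 1)) = 1"
  shows
    "kappa q p ^ (m - 1) *
     (\<Prod>k=1..m.
        ell_gamma q p (t\<^sup>2 * (\<Prod>l=1..k. (s l)\<^sup>2)) /
        (ell_gamma q p ((s k)\<^sup>2) * ell_gamma q p (t\<^sup>2 * (\<Prod>l=1..<k. (s l)\<^sup>2)))) *
     torus_integral m
       (\<lambda>x.
          (\<Prod>r=0..2. ell_gamma_pm q p (t * tr r) (x 1)) /
          ell_gamma_pm q p (t * tr 0 * tr 1 * tr 2) (x 1) *
          (\<Prod>k=1..m.
             (ell_gamma_pm q p (t\<^sup>2 * (\<Prod>l=1..<k. (s l)\<^sup>2) * s k * u k) (x (k + 1)) *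
              ell_gamma_pm_pm q p (s k) (x (k + 1)) (x k) *
              ell_gamma_pm q p (u k) (x k)) /
             (ell_gamma_pm q p (s k * u k) (x (k + 1)) *
              ell_gamma_pm q p 1 ((x k)\<^sup>2) *
              ell_gamma_pm q p (t\<^sup>2 * (\<Prod>l=1..k. (s l)\<^sup>2) * u k) (x k))) *
          (\<Prod>l=1..m. 1 / x l))
       x
     =
     1 / ell_gamma q p (t\<^sup>2) *
     (\<Prod>(r, j) \<in> {(r, j). 0 \<le> r \<and> r < j \<and> j \<le> (2::nat)}.
        ell_gamma q p (t\<^sup>2 * tr r * tr j) / ell_gamma q p (tr r * tr j)) *
     contour_integral (circlepath 0 1)
       (\<lambda>y.
          (ell_gamma_pm_pm q p (t * (\<Prod>l=1..m. s l)) (x (m + 1)) y *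
           (\<Prod>r=0..2. ell_gamma_pm q p (tr r) y)) /
          (ell_gamma_pm q p 1 (y\<^sup>2) *
           ell_gamma_pm q p (t\<^sup>2 * tr 0 * tr 1 * tr 2) y) *
          (\<Prod>k=1..m.
             ell_gamma_pm q p (t * (\<Prod>l=1..<k. s l) * u k) y /
             ell_gamma_pm q p (t * (\<Prod>l=1..<k. s l) * (s k)\<^sup>2 * u k) y) *
          (1 / y))"
proof -
  note q = assms(1) and p = assms(2)
  \<comment> \<open>The empty product gives \<open>T 1 = t\<close>.\<close>
  define T where "T = (\<lambda>k. t * (\<Prod>l=1..<k. s l))"
  have T1: "T 1 = t" by (simp add: T_def)
  have TS: "T (Suc k) = T k * s k" if "k \<in> {1..m}" for k
    using that by (simp add: T_def)
  have T2: "t\<^sup>2 * (\<Prod>l=1..<k. (s l)\<^sup>2) = (T k)\<^sup>2" for k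
    by (simp add: T_def power_mult_distrib prod_power_distrib)
  have T3: "t\<^sup>2 * (\<Prod>l=1..k. (s l)\<^sup>2) = (T (Suc k))\<^sup>2" for k
    by (simp only: T2[symmetric] atLeastLessThanSuc_atLeastAtMost)
  have T4: "t * (\<Prod>l=1..m. s l) = T (Suc m)"
    by (simp only: T_def atLeastLessThanSuc_atLeastAtMost)
  have k: "norm (s k) < 1 \<and> norm (u k) < 1 \<and> T (Suc k) = T k * s k \<and>
      norm (p * q) < norm ((T k)\<^sup>2 * (s k)\<^sup>2 * u k)" if "k \<in> {1..m}" for k
    using assms(6,7,9)[OF that] TS[OF that] unfolding T3 by (simp add: power_mult_distrib)
  have set: "{(r, j). 0 \<le> r \<and> r < j \<and> j \<le> (2::nat)} = {(0, 1), (0, 2), (1, 2)}"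
    by auto
  have kernel: "(\<Prod>k=1..m.
             (ell_gamma_pm q p ((T k)\<^sup>2 * s k * u k) (x (k + 1)) *
              ell_gamma_pm_pm q p (s k) (x (k + 1)) (x k) *
              ell_gamma_pm q p (u k) (x k)) /
             (ell_gamma_pm q p (s k * u k) (x (k + 1)) *
              ell_gamma_pm q p 1 ((x k)\<^sup>2) *
              ell_gamma_pm q p ((T (Suc k))\<^sup>2 * u k) (x k))) =
     (\<Prod>k=1..m. fold_kernel q p (T k) (s k) (u k) (x k) (x (Suc k)))" for x
    by (rule prod.cong) (simp_all add: fold_kernel_def TS power_mult_distrib)
  \<comment> \<open>One \<open>kappa\<close> is split off, to be cancelled against the one on the
    right of \<open>fold_identity\<close>.\<close>
  have kp: "kappa q p ^ m = kappa q p * kappa q p ^ (m - 1)"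
    using assms(3) by (cases m) auto
  have x1: "norm (x (Suc m)) = 1" using assms(10) by simp
  note F = fold_identity[OF q p, of tr t T m s u x, OF assms(5,4,8) T1 k x1]
  have F': "kappa q p ^ (m - 1) *
     (\<Prod>k=1..m. ell_gamma q p ((T (Suc k))\<^sup>2) / (ell_gamma q p ((s k)\<^sup>2) * ell_gamma q p ((T k)\<^sup>2))) *
     torus_integral m (\<lambda>x. (\<Prod>r=0..2. ell_gamma_pm q p (t * tr r) (x 1)) /
          ell_gamma_pm q p (t * tr 0 * tr 1 * tr 2) (x 1) *
          (\<Prod>k=1..m. fold_kernel q p (T k) (s k) (u k) (x k) (x (Suc k))) * (\<Prod>l=1..m. 1 / x l)) x
    = 1 / ell_gamma q p (t\<^sup>2) *
      (ell_gamma q p (t\<^sup>2 * tr 0 * tr 1) / ell_gamma q p (tr 0 * tr 1) *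
       (ell_gamma q p (t\<^sup>2 * tr 0 * tr 2) / ell_gamma q p (tr 0 * tr 2)) *
       (ell_gamma q p (t\<^sup>2 * tr 1 * tr 2) / ell_gamma q p (tr 1 * tr 2))) * contour_integral (circlepath 0 1)
       (\<lambda>y. ell_gamma_pm_pm q p (T (Suc m)) (x (Suc m)) y * fold_weight q p t tr T s u m y / y)"
  proof -
    have "a * b * c = d * e" if "K * a * b * c = K * d * e" "K \<noteq> 0" for a b c d e K :: complex
      using that by (simp add: mult.assoc)
    then show ?thesis using F kappa_nonzero[OF q p] unfolding kp by blast
  qed
  have weight: "ell_gamma_pm_pm q p (T (Suc m)) (x (m + 1)) y *
           (\<Prod>r=0..2. ell_gamma_pm q p (tr r) y) /
          (ell_gamma_pm q p 1 (y\<^sup>2) *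
           ell_gamma_pm q p (t\<^sup>2 * tr 0 * tr 1 * tr 2) y) *
          (\<Prod>k=1..m.
             ell_gamma_pm q p (T k * u k) y /
             ell_gamma_pm q p (T k * (s k)\<^sup>2 * u k) y) *
          (1 / y) = ell_gamma_pm_pm q p (T (Suc m)) (x (Suc m)) y * fold_weight q p t tr T s u m y / y" for y
    by (simp add: fold_weight_def)
  have Tk: "t * (\<Prod>l=1..<k. s l) = T k" for k by (simp add: T_def)
  have pr: "(\<Prod>(r, j) \<in> {(r, j). 0 \<le> r \<and> r < j \<and> j \<le> (2::nat)}.
        ell_gamma q p (t\<^sup>2 * tr r * tr j) / ell_gamma q p (tr r * tr j)) =
      ell_gamma q p (t\<^sup>2 * tr 0 * tr 1) / ell_gamma q p (tr 0 * tr 1) *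
       (ell_gamma q p (t\<^sup>2 * tr 0 * tr 2) / ell_gamma q p (tr 0 * tr 2)) *
       (ell_gamma q p (t\<^sup>2 * tr 1 * tr 2) / ell_gamma q p (tr 1 * tr 2))"
    unfolding set by (simp add: mult.assoc)
  show ?thesis
    unfolding T2 T3 T4 Tk kernel weight pr by (rule F')
qed

end
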